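(* Let $\mathbf{b}\in\mathbb{R}^N$. The residuals of the iterates generated by applying (restarted or non-restarted) GMRES with an arbitrary initial guess $\mathbf{v}_0\in\mathbb{R}^N$ to solve $\mathbf{P}^{-1/2}\mathbf{A}\mathbf{P}^{-1/2}\mathbf{v}=\mathbf{P}^{-1/2}\mathbf{b}$ satisfy $$\|\mathbf{r}_k\|_2\le\omega^k\|\mathbf{r}_0\|_2 ,$$ where $\mathbf{r}_k=\mathbf{P}^{-1/2}\mathbf{b}-\mathbf{P}^{-1/2}\mathbf{A}\mathbf{P}^{-1/2}\mathbf{v}_k$ is the residual vector at the $k$-th GMRES iteration, $\mathbf{v}_k$ ($k\ge1$) being the corresponding iterative solution, and $\omega$ is the constant independent of $N$ given by $$\omega=\sqrt{\frac{2+4\varsigma^2}{3+4\varsigma^2}}\in\left[\sqrt{\tfrac23},\,1\right)\subset(0,1),\qquad \varsigma=\frac32\max_{1\le i\le3}\tan\left(\frac{\delta_i}{2}\pi\right)\frac{|k_{i,+}-k_{i,-}|}{k_{i,+}+k_{i,-}} .$$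
   Context: Data: $\alpha,\beta,\gamma\in(0,1)$, also written $\delta_1=\alpha,\ \delta_2=\beta,\ \delta_3=\gamma$; real numbers $a_i<b_i$ and positive constants $k_{i,+},k_{i,-}>0$ for $i=1,2,3$; $T>0$; positive integers $M,n_1,n_2,n_3$; $\Delta t=T/M$, $h_i=(b_i-a_i)/(n_i+1)$, $N=n_1n_2n_3$, and $\eta_{\delta_i}=\frac{\Delta t}{2\Gamma(\delta_i+1)h_i^{2-\delta_i}}$, i.e. $\eta_\alpha,\eta_\beta,\eta_\gamma$ for $i=1,2,3$. For $\delta\in(0,1)$ set $s_0^{(\delta)}=(\tfrac12)^\delta$, $s_1^{(\delta)}=(\tfrac32)^\delta-2(\tfrac12)^\delta$, $s_k^{(\delta)}=(k+\tfrac12)^\delta-2(k-\tfrac12)^\delta+(k-\tfrac32)^\delta$ for $k\ge2$; $q_0^{(\delta)}=-s_0^{(\delta)}$ and $q_k^{(\delta)}=s_{k-1}^{(\delta)}-s_k^{(\delta)}$ for $k\ge1$. $\mathbf{T}_{n}^{\delta}\in\mathbb{R}^{n\times n}$ is the lower Hessenberg Toeplitz matrix with $(j,k)$ entry $q_{j-k+1}^{(\delta)}$ if $j-k+1\ge0$ and $0$ otherwise. $\mathbf{A}_n\in\mathbb{R}^{n\times n}$ is the symmetric tridiagonal Toeplitz matrix with diagonal entries $6/8$ and sub-/superdiagonal entries $1/8$. $\mathbf{B}_{n_i}^{\delta_i}=k_{i,+}\mathbf{T}_{n_i}^{\delta_i}+k_{i,-}(\mathbf{T}_{n_i}^{\delta_i})^{\top}$.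 For a real square matrix $\mathbf{Z}$, $\mathcal{H}(\mathbf{Z})=(\mathbf{Z}+\mathbf{Z}^\top)/2$. For a real symmetric Toeplitz matrix $T_n=[t_{|j-k|}]_{j,k=1}^n$, its $\tau$ matrix is $\tau(T_n)=\mathbf{S}_n\,\mathrm{diag}(\lambda_1,\dots,\lambda_n)\,\mathbf{S}_n$, where $[\mathbf{S}_n]_{j,k}=\sqrt{\frac{2}{n+1}}\sin\left(\frac{jk\pi}{n+1}\right)$ and $\lambda_k=t_0+2\sum_{j=1}^{n-1}t_j\cos\left(\frac{jk\pi}{n+1}\right)$. With $\otimes$ the Kronecker product, $$\mathbf{A}=\mathbf{A}_{n_3}\otimes\mathbf{A}_{n_2}\otimes\mathbf{A}_{n_1}+\eta_\alpha\,\mathbf{A}_{n_3}\otimes\mathbf{A}_{n_2}\otimes\mathbf{B}_{n_1}^{\alpha}+\eta_\beta\,\mathbf{A}_{n_3}\otimes\mathbf{B}_{n_2}^{\beta}\otimes\mathbf{A}_{n_1}+\eta_\gamma\,\mathbf{B}_{n_3}^{\gamma}\otimes\mathbf{A}_{n_2}\otimes\mathbf{A}_{n_1},$$ $$\mathbf{P}=\mathbf{A}_{n_3}\otimes\mathbf{A}_{n_2}\otimes\mathbf{A}_{n_1}+\eta_\alpha\,\mathbf{A}_{n_3}\otimes\mathbf{A}_{n_2}\otimes\tau(\mathcal{H}(\mathbf{B}_{n_1}^{\alpha}))+\eta_\beta\,\mathbf{A}_{n_3}\otimes\tau(\mathcal{H}(\mathbf{B}_{n_2}^{\beta}))\otimes\mathbf{A}_{n_1}+\eta_\gamma\,\tau(\mathcal{H}(\mathbf{B}_{n_3}^{\gamma}))\otimes\mathbf{A}_{n_2}\otimes\mathbf{A}_{n_1}.$$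 $\mathbf{P}$ is symmetric positive definite and $\mathbf{P}^{-1/2}$ is the inverse of its symmetric positive definite square root. GMRES for $\mathbf{Z}\mathbf{v}=\mathbf{w}$ with initial guess $\mathbf{v}_0$ and initial residual $\mathbf{r}_0=\mathbf{w}-\mathbf{Z}\mathbf{v}_0$: the $k$-th iterate $\mathbf{v}_k$ minimizes $\|\mathbf{w}-\mathbf{Z}\mathbf{v}\|_2$ over $\mathbf{v}\in\mathbf{v}_0+\mathrm{span}\{\mathbf{r}_0,\mathbf{Z}\mathbf{r}_0,\dots,\mathbf{Z}^{k-1}\mathbf{r}_0\}$. Restarted GMRES with restart length $m\ge1$ performs $m$ such iterations, then restarts with the current iterate as the new initial guess; iterations are counted consecutively. *)

theory Defs
  imports
    "HOL-Analysis.Gamma_Function"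
    "Jordan_Normal_Form.VS_Connect"
    "Jordan_Normal_Form.Gauss_Jordan_Elimination"
begin

text \<open>
  Dimensions vary inside the construction, so matrices and vectors are the carrier-based ones of
  \<open>Jordan_Normal_Form\<close>. Their indices start at 0; the mathematics numbers entries from 1.
\<close>

definition vnorm2 :: "real vec \<Rightarrow> real" where
  "vnorm2 x = sqrt (scalar_prod x x)"

definition kron :: "real mat \<Rightarrow> real mat \<Rightarrow> real mat" (infixl \<open>\<otimes>\<^sub>m\<close> 75) where
  "A \<otimes>\<^sub>m B = mat (dim_row A * dim_row B) (dim_col A * dim_col B)
     (\<lambda>(i, j). A $$ (i div dim_row B, j div dim_col B) * B $$ (i mod dim_row B, j mod dim_col B))"

definition sym_part :: "real mat \<Rightarrow> real mat" where
  "sym_part Z = (1 / 2) \<cdot>\<^sub>m (Z + transpose_mat Z)"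

definition spd_mat :: "nat \<Rightarrow> real mat \<Rightarrow> bool" where
  "spd_mat n A \<longleftrightarrow> A \<in> carrier_mat n n \<and> transpose_mat A = A \<and>
     (\<forall>x\<in>carrier_vec n. x \<noteq> 0\<^sub>v n \<longrightarrow> 0 < scalar_prod x (A *\<^sub>v x))"

text \<open>
  The two definitions below are meaningful only for symmetric positive definite \<open>P\<close>, for which
  the symmetric positive definite square root exists, is unique and is invertible.
\<close>

definition spd_sqrt :: "real mat \<Rightarrow> real mat" where
  "spd_sqrt P = (THE R. spd_mat (dim_row P) R \<and> R * R = P)"

definition inv_sqrt_mat :: "real mat \<Rightarrow> real mat" where
  "inv_sqrt_mat P = the (mat_inverse (spd_sqrt P))"


fun s_coeff :: "real \<Rightarrow> nat \<Rightarrow> real" where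
  "s_coeff \<delta> 0 = (1 / 2) powr \<delta>"
| "s_coeff \<delta> (Suc 0) = (3 / 2) powr \<delta> - 2 * (1 / 2) powr \<delta>"
| "s_coeff \<delta> k = (real k + 1 / 2) powr \<delta> - 2 * (real k - 1 / 2) powr \<delta> + (real k - 3 / 2) powr \<delta>"

fun q_coeff :: "real \<Rightarrow> nat \<Rightarrow> real" where
  "q_coeff \<delta> 0 = - s_coeff \<delta> 0"
| "q_coeff \<delta> (Suc k) = s_coeff \<delta> k - s_coeff \<delta> (Suc k)"

definition T_mat :: "nat \<Rightarrow> real \<Rightarrow> real mat" where
  "T_mat n \<delta> = mat n n (\<lambda>(j, k). if k \<le> j + 1 then q_coeff \<delta> (j + 1 - k) else 0)"

definition A_mat :: "nat \<Rightarrow> real mat" where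
  "A_mat n = mat n n (\<lambda>(j, k). if j = k then 6 / 8 else if j = k + 1 \<or> k = j + 1 then 1 / 8 else 0)"

definition B_mat :: "nat \<Rightarrow> real \<Rightarrow> real \<Rightarrow> real \<Rightarrow> real mat" where
  "B_mat n \<delta> kp km = kp \<cdot>\<^sub>m T_mat n \<delta> + km \<cdot>\<^sub>m transpose_mat (T_mat n \<delta>)"

definition sine_mat :: "nat \<Rightarrow> real mat" where
  "sine_mat n = mat n n (\<lambda>(j, k).
     sqrt (2 / (real n + 1)) * sin (real ((j + 1) * (k + 1)) * pi / (real n + 1)))"

text \<open>
  For a symmetric Toeplitz matrix \<open>T\<close> the coefficient \<open>t\<^sub>j\<close> is the entry \<open>T $$ (0, j)\<close>;
  the \<open>k\<close>-th diagonal entry below is the eigenvalue with 1-based number \<open>k + 1\<close>.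
\<close>

definition tau_mat :: "real mat \<Rightarrow> real mat" where
  "tau_mat T = (let n = dim_row T in
     sine_mat n
     * mat_diag n (\<lambda>k. T $$ (0, 0) +
         2 * (\<Sum>j = 1..n - 1. T $$ (0, j) * cos (real (j * (k + 1)) * pi / (real n + 1))))
     * sine_mat n)"

definition system_mat ::
  "(nat \<Rightarrow> nat) \<Rightarrow> (nat \<Rightarrow> real) \<Rightarrow> (nat \<Rightarrow> real) \<Rightarrow> (nat \<Rightarrow> real) \<Rightarrow> (nat \<Rightarrow> real) \<Rightarrow> real mat" where
  "system_mat n \<eta> \<delta> kp km =
     (let A = (\<lambda>i. A_mat (n i)); B = (\<lambda>i. B_mat (n i) (\<delta> i) (kp i) (km i)) in
       A 3 \<otimes>\<^sub>m A 2 \<otimes>\<^sub>m A 1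
       + \<eta> 1 \<cdot>\<^sub>m (A 3 \<otimes>\<^sub>m A 2 \<otimes>\<^sub>m B 1)
       + \<eta> 2 \<cdot>\<^sub>m (A 3 \<otimes>\<^sub>m B 2 \<otimes>\<^sub>m A 1)
       + \<eta> 3 \<cdot>\<^sub>m (B 3 \<otimes>\<^sub>m A 2 \<otimes>\<^sub>m A 1))"

definition precond_mat ::
  "(nat \<Rightarrow> nat) \<Rightarrow> (nat \<Rightarrow> real) \<Rightarrow> (nat \<Rightarrow> real) \<Rightarrow> (nat \<Rightarrow> real) \<Rightarrow> (nat \<Rightarrow> real) \<Rightarrow> real mat" where
  "precond_mat n \<eta> \<delta> kp km =
     (let A = (\<lambda>i. A_mat (n i));
          C = (\<lambda>i. tau_mat (sym_part (B_mat (n i) (\<delta> i) (kp i) (km i)))) in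
       A 3 \<otimes>\<^sub>m A 2 \<otimes>\<^sub>m A 1
       + \<eta> 1 \<cdot>\<^sub>m (A 3 \<otimes>\<^sub>m A 2 \<otimes>\<^sub>m C 1)
       + \<eta> 2 \<cdot>\<^sub>m (A 3 \<otimes>\<^sub>m C 2 \<otimes>\<^sub>m A 1)
       + \<eta> 3 \<cdot>\<^sub>m (C 3 \<otimes>\<^sub>m A 2 \<otimes>\<^sub>m A 1))"


text \<open>
  GMRES is specified by the minimal-residual property of its iterates. When \<open>Z\<close> is singular the
  minimiser need not be unique, hence predicates rather than functions.
\<close>

definition krylov :: "real mat \<Rightarrow> real vec \<Rightarrow> nat \<Rightarrow> real vec set" where
  "krylov Z r k = LinearCombinations.module.span class_ring (module_vec TYPE(real) (dim_vec r))
     ((\<lambda>i. (Z ^\<^sub>m i) *\<^sub>v r) ` {..<k})"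

definition is_gmres_iterate ::
  "real mat \<Rightarrow> real vec \<Rightarrow> real vec \<Rightarrow> nat \<Rightarrow> real vec \<Rightarrow> bool" where
  "is_gmres_iterate Z w v0 k u \<longleftrightarrow>
     is_arg_min (\<lambda>v. vnorm2 (w - Z *\<^sub>v v))
       (\<lambda>v. v \<in> (\<lambda>y. v0 + y) ` krylov Z (w - Z *\<^sub>v v0) k) u"

definition gmres_iterates ::
  "real mat \<Rightarrow> real vec \<Rightarrow> real vec \<Rightarrow> (nat \<Rightarrow> real vec) \<Rightarrow> bool" where
  "gmres_iterates Z w v0 v \<longleftrightarrow>
     v 0 = v0 \<and> (\<forall>k\<ge>1. is_gmres_iterate Z w v0 k (v k))"

text \<open>
  Restart length \<open>m\<close>; cycle \<open>c\<close> starts from iterate number \<open>c * m\<close>.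
\<close>

definition restarted_gmres_iterates ::
  "nat \<Rightarrow> real mat \<Rightarrow> real vec \<Rightarrow> real vec \<Rightarrow> (nat \<Rightarrow> real vec) \<Rightarrow> bool" where
  "restarted_gmres_iterates m Z w v0 v \<longleftrightarrow>
     v 0 = v0 \<and>
     (\<forall>c. \<forall>j\<in>{1..m}. is_gmres_iterate Z w (v (c * m)) j (v (c * m + j)))"


definition varsigma :: "(nat \<Rightarrow> real) \<Rightarrow> (nat \<Rightarrow> real) \<Rightarrow> (nat \<Rightarrow> real) \<Rightarrow> real" where
  "varsigma \<delta> kp km =
     3 / 2 * (MAX i\<in>{1, 2, 3}. tan (\<delta> i / 2 * pi) * (\<bar>kp i - km i\<bar> / (kp i + km i)))"

definition omega_rate :: "(nat \<Rightarrow> real) \<Rightarrow> (nat \<Rightarrow> real) \<Rightarrow> (nat \<Rightarrow> real) \<Rightarrow> real" where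
  "omega_rate \<delta> kp km =
     sqrt ((2 + 4 * (varsigma \<delta> kp km)\<^sup>2) / (3 + 4 * (varsigma \<delta> kp km)\<^sup>2))"

end

(*
  By minimality r_{k+1} is no longer than r_k - alpha Z r_k for every alpha, where
  Z = P^{-1/2} A P^{-1/2}. Two facts about the bilinear forms of A and P control such a step: P/2 <= H(A) <= 3P/2, and |x.Ay - y.Ax| <= varsigma (x.Px + y.Py).
  Both pass through Kronecker products with the A_n, which are Gram matrices, so they are needed
  only for B_n against tau(H(B_n)) in one dimension.

  The first fact: T - tau(T) is a Hankel matrix built from the coefficients t_k of T, and
  t_1 <= t_2 <= ... <= 0 with t_0 + 2 (t_1 + ... + t_K) > 0 makes tau(T) +- 2 (T - tau(T)) strictly
  diagonally dominant.

  The second fact: up to sign, the entries of T_n are third differences of x_+^delta at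
  half-integers. The odd and even extensions sgn(x)|x|^delta and |x|^delta are mixtures over t > 0 of
  x/(t^2+x^2) and x^2/(t^2+x^2), the constants having ratio tan(delta pi/2). For fixed t the
  Hermitian Toeplitz form with the corresponding coefficients is a positive multiple of
  the integral of exp(-t p) sin^3(p/2) |sum z_j exp(i j p)|^2 over 0 < p < 2 pi, hence nonnegative.
*)

theory Submission
  imports
    Defs
    "HOL-Analysis.Change_Of_Vars"
begin

text \<open>The two facts are kept as bounds on forms because a congruence preserves such bounds:
  with P^{-1/2} x in place of x they say that H(Z) lies between 1/2 and 3/2 and that |x.Zy - y.Zx|
  <= varsigma (|x|^2 + |y|^2). Together they give |Zx|^2 |x|^2 <= (3 + 4 varsigma^2) (x.Zx)^2, and
  the best step length then leaves the fraction 1 - 1 / (3 + 4 varsigma^2) = omega^2 of the squared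
  residual. The factor 3/2 in varsigma is the upper bound of the first fact: the skew part of B_n is
  naturally measured against B_n itself, with constant tan(delta pi/2) |k_+ - k_-| / (k_+ + k_-),
  and this has to be passed on to tau(H(B_n)). A need not be symmetric, but P is diagonalised by a
  Kronecker product of sine matrices, with positive eigenvalues. That supplies its square root, and
  uniqueness of the root identifies it with the one specified by description. The estimate concerns
  a single step and uses only that the current residual lies in the next Krylov space of the running
  cycle, so restarts cost nothing.\<close>

subsection \<open>Integrals of Mellin type\<close>

text \<open>The substitution u = t^2 / (t^2 + a^2) maps the half-line onto (0, 1) and carries the
  Beta integrand over to this one, up to a power of \<open>a\<close>.\<close>

lemma has_integral_powr_over_sum_squares:
  fixes a s :: real
  assumes a: "a > 0" and s: "-1 < s" "s < 1"
  shows "((\<lambda>t. t powr s / (t\<^sup>2 + a\<^sup>2)) has_integral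
           a powr (s - 1) * (Beta ((s + 1) / 2) ((1 - s) / 2) / 2)) {0<..}"
proof -
  define g where "g = (\<lambda>t. t\<^sup>2 / (t\<^sup>2 + a\<^sup>2) :: real)"
  define g' where "g' = (\<lambda>t. 2 * t * a\<^sup>2 / (t\<^sup>2 + a\<^sup>2)\<^sup>2 :: real)"
  define p where "p = (s + 1) / 2"
  define q where "q = (1 - s) / 2"
  define f where "f = (\<lambda>u. u powr (p - 1) * (1 - u) powr (q - 1) :: real)"
  have pos: "t\<^sup>2 + a\<^sup>2 > 0" for t using a by (simp add: add_nonneg_pos)
  have pq: "p > 0" "q > 0" using s by (auto simp: p_def q_def)
  have der: "(g has_field_derivative g' t) (at t within {0<..})" for t
    unfolding g_def g'_def using pos[of t] a
    by (auto intro!: derivative_eq_intros simp: field_simps power2_eq_square)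
  have img: "g ` {0<..} = {0<..<1}"
  proof (intro equalityI subsetI)
    fix u assume "u \<in> g ` {0<..}"
    then obtain t where "t > 0" "u = g t" by auto
    then show "u \<in> {0<..<1}" using pos[of t] a by (simp add: g_def)
  next
    fix u :: real assume u: "u \<in> {0<..<1}"
    define t where "t = a * sqrt (u / (1 - u))"
    have t2: "t\<^sup>2 = a\<^sup>2 * (u / (1 - u))"
      using u by (simp add: t_def power_mult_distrib)
    have "t\<^sup>2 + a\<^sup>2 = a\<^sup>2 / (1 - u)" unfolding t2 using u by (simp add: field_simps)
    then have "g t = u" unfolding g_def t2[symmetric] using u a t2 by (simp add: field_simps)
    moreover have "t > 0" using u a by (simp add: t_def)
    ultimately show "u \<in> g ` {0<..}" by force
  qed
  have inj: "inj_on g {0<..}"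
  proof (rule inj_onI)
    fix x y assume xy: "x \<in> {0<..}" "y \<in> {0<..}" "g x = g y"
    then have "x\<^sup>2 * (y\<^sup>2 + a\<^sup>2) = y\<^sup>2 * (x\<^sup>2 + a\<^sup>2)"
      unfolding g_def using pos[of x] pos[of y] by (simp add: frac_eq_eq)
    then have "x\<^sup>2 * a\<^sup>2 = y\<^sup>2 * a\<^sup>2" by (simp add: algebra_simps)
    then show "x = y" using xy a by (simp add: power2_eq_iff_nonneg)
  qed
  have fint: "(f has_integral Beta p q) {0<..<1}"
    unfolding f_def using has_integral_Beta_real[OF pq] by (simp add: has_integral_Icc_iff_Ioo)
  have fabs: "f absolutely_integrable_on {0<..<1}"
    by (intro nonnegative_absolutely_integrable_1 has_integral_integrable[OF fint]) (auto simp: f_def)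
  have "(\<lambda>t. \<bar>g' t\<bar> * f (g t)) absolutely_integrable_on {0<..} \<and>
        integral {0<..} (\<lambda>t. \<bar>g' t\<bar> * f (g t)) = Beta p q"
    by (subst has_absolute_integral_change_of_variables_1'[OF _ der inj])
       (use fabs fint in \<open>auto simp: img integral_unique\<close>)
  then have "((\<lambda>t. \<bar>g' t\<bar> * f (g t)) has_integral Beta p q) {0<..}"
    using set_lebesgue_integral_eq_integral(1) has_integral_integrable_integral by blast
  \<comment> \<open>The substituted integrand is 2 a^(1 - s) t^s / (t^2 + a^2); the new factor
    removes the constant.\<close>
  then have "((\<lambda>t. \<bar>g' t\<bar> * f (g t) * (a powr (s - 1) / 2)) has_integral Beta p q * (a powr (s - 1) / 2)) {0<..}"
    by (rule has_integral_mult_left)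
  moreover have "\<bar>g' t\<bar> * f (g t) * (a powr (s - 1) / 2) = t powr s / (t\<^sup>2 + a\<^sup>2)" if "t \<in> {0<..}" for t
  proof -
    have t: "t > 0" using that by simp
    define D where "D = t\<^sup>2 + a\<^sup>2"
    have D: "D > 0" using pos by (simp add: D_def)
    have gt: "g t = t powr 2 / D" and gt': "1 - g t = a powr 2 / D"
      using t a D by (auto simp: g_def D_def field_simps)
    have "f (g t) = t powr (s - 1) * a powr (- s - 1) * D"
    proof -
      have "f (g t) = (t powr 2 / D) powr (p - 1) * (a powr 2 / D) powr (q - 1)"
        unfolding f_def gt' unfolding gt ..
      also have "\<dots> = t powr (2 * (p - 1)) * a powr (2 * (q - 1)) / (D powr (p - 1) * D powr (q - 1))"
        using t a D by (simp add: powr_divide powr_powr del: powr_numeral)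
      also have "D powr (p - 1) * D powr (q - 1) = D powr (-1)"
        unfolding powr_add[symmetric] by (simp add: p_def q_def field_simps)
      also have "2 * (p - 1) = s - 1" by (simp add: p_def field_simps)
      also have "2 * (q - 1) = - s - 1" by (simp add: q_def field_simps)
      finally show ?thesis using D by (simp add: powr_minus_divide)
    qed
    moreover have "\<bar>g' t\<bar> = 2 * t powr 1 * a powr 2 / D\<^sup>2"
      using t a D by (simp add: g'_def D_def)
    ultimately have "\<bar>g' t\<bar> * f (g t) * (a powr (s - 1) / 2) =
        (t powr 1 * t powr (s - 1)) * (a powr 2 * a powr (- s - 1) * a powr (s - 1)) / D"
      using D by (simp add: field_simps power2_eq_square)
    also have "t powr 1 * t powr (s - 1) = t powr s" unfolding powr_add[symmetric] by simp
    also have "a powr 2 * a powr (- s - 1) * a powr (s - 1) = 1"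
      unfolding powr_add[symmetric] using a by simp
    finally show ?thesis by (simp only: D_def mult_1_right)
  qed
  ultimately have "((\<lambda>t. t powr s / (t\<^sup>2 + a\<^sup>2)) has_integral Beta p q * (a powr (s - 1) / 2)) {0<..}"
    by (metis (no_types, lifting) has_integral_eq)
  then show ?thesis by (simp add: p_def q_def mult.commute)
qed

lemma Beta_reflection_real:
  fixes x :: real
  assumes "0 < x" "x < 1"
  shows "Beta x (1 - x) = pi / sin (pi * x)"
proof -
  have "complex_of_real (Gamma x * Gamma (1 - x)) = Gamma (of_real x) * Gamma (1 - of_real x)"
    by (simp flip: Gamma_complex_of_real)
  also have "\<dots> = of_real (pi / sin (pi * x))"
    by (simp add: Gamma_reflection_complex flip: sin_of_real)
  finally have "Gamma x * Gamma (1 - x) = pi / sin (pi * x)"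
    by (simp only: of_real_eq_iff)
  then show ?thesis by (simp add: Beta_def)
qed

text \<open>The tangent in \<open>varsigma\<close> originates here. The two Beta values belong to
  the exponents s = d and s = d - 1 in the preceding integral, and reflection turns them into pi /
  cos (d pi / 2) and pi / sin (d pi / 2).\<close>

lemma Beta_half_shift_ratio:
  fixes d :: real
  assumes "0 < d" "d < 1"
  shows "Beta ((d + 1) / 2) ((1 - d) / 2) = tan (d / 2 * pi) * Beta (d / 2) ((2 - d) / 2)"
proof -
  have 1: "Beta ((d + 1) / 2) ((1 - d) / 2) = pi / sin (pi * ((d + 1) / 2))"
    using Beta_reflection_real[of "(d + 1) / 2"] assms by (simp add: field_simps)
  have 2: "Beta (d / 2) ((2 - d) / 2) = pi / sin (pi * (d / 2))"
    using Beta_reflection_real[of "d / 2"] assms by (simp add: field_simps)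
  have 3: "sin (pi * ((d + 1) / 2)) = cos (d / 2 * pi)"
    by (simp add: sin_cos_eq field_simps flip: cos_minus[of "d / 2 * pi"])
  have "sin (pi * (d / 2)) > 0" using assms by (intro sin_gt_zero) (auto simp: field_simps)
  then show ?thesis unfolding 1 2 3 by (simp add: tan_def field_simps)
qed

subsection \<open>Third differences at half-integers\<close>

text \<open>Central third difference with unit step. At an integer the nodes are half-integers, so
  they avoid 0, where the kernel representations of the powers break down.\<close>

definition third_diff :: "(real \<Rightarrow> real) \<Rightarrow> real \<Rightarrow> real" where
  "third_diff f x = f (x + 3/2) - 3 * f (x + 1/2) + 3 * f (x - 1/2) - f (x - 3/2)"

text \<open>As a Fourier multiplier the difference is (2 i sin (p / 2))^3 = - 8 i sin (p / 2)^3; the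
  two claims are the imaginary and the real part of its action on exp (i a p).\<close>

lemma third_diff_sin: "third_diff (\<lambda>a. sin (a * p)) l = - 8 * sin (p / 2) ^ 3 * cos (l * p)"
  and third_diff_cos: "third_diff (\<lambda>a. cos (a * p)) l = 8 * sin (p / 2) ^ 3 * sin (l * p)"
proof -
  define s c where "s = sin (p / 2)" and "c = cos (p / 2)"
  have c2: "c * c = 1 - s * s"
    unfolding s_def c_def using sin_cos_squared_add[of "p / 2"] by (simp add: power2_eq_square)
  then have c3: "c * (c * z) = z - s * (s * z)" for z
    by (simp add: left_diff_distrib flip: mult.assoc)
  have e1: "(l + 1/2) * p = l * p + p / 2" "(l - 1/2) * p = l * p - p / 2"
    and e3: "(l + 3/2) * p = l * p + 3 * (p / 2)" "(l - 3/2) * p = l * p - 3 * (p / 2)"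
    by (simp_all add: algebra_simps)
  have t: "sin (3 * (p / 2)) = 3 * s - 4 * s ^ 3" 
    using sin_add[of "2 * (p / 2)" "p / 2"] unfolding sin_double cos_double_sin
    by (simp add: algebra_simps power3_eq_cube power2_eq_square c3 flip: s_def c_def)
  show "third_diff (\<lambda>a. sin (a * p)) l = - 8 * sin (p / 2) ^ 3 * cos (l * p)"
    unfolding third_diff_def e1 e3 sin_add sin_diff t
    by (simp add: algebra_simps flip: s_def)
  show "third_diff (\<lambda>a. cos (a * p)) l = 8 * sin (p / 2) ^ 3 * sin (l * p)"
    unfolding third_diff_def e1 e3 cos_add cos_diff t
    by (simp add: algebra_simps flip: s_def)
qed

text \<open>Over the whole half-line these would be the usual Laplace transforms. A single period is
  taken because the weight \<open>sin (p / 2) ^ 3\<close> changes sign beyond it. At half-integer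
  frequencies the cut costs only the factor 1 + exp (- 2 pi t), which does not depend on
  \<open>a\<close> and therefore survives differences in \<open>a\<close>.\<close>

lemma has_integral_exp_sin_cos_period:
  fixes a t :: real
  assumes t: "t > 0" and a: "cos (a * (2 * pi)) = - 1"
  shows "((\<lambda>p. exp (- t * p) * sin (a * p)) has_integral
           (1 + exp (- t * (2 * pi))) * (a / (t\<^sup>2 + a\<^sup>2))) {0..2 * pi}"
    and "((\<lambda>p. exp (- t * p) * cos (a * p)) has_integral
           (1 + exp (- t * (2 * pi))) * (t / (t\<^sup>2 + a\<^sup>2))) {0..2 * pi}"
proof -
  have D: "t\<^sup>2 + a\<^sup>2 > 0" using t by (simp add: add_pos_nonneg)
  have sa: "sin (a * (2 * pi)) = 0" using a sin_cos_squared_add[of "a * (2 * pi)"] by simp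
  define D' where "D' = t\<^sup>2 + a\<^sup>2"
  have D': "D' \<noteq> 0" using D unfolding D'_def by linarith
  have "((\<lambda>p. exp (- t * p) * (- t * sin (a * p) - a * cos (a * p)) / D') has_real_derivative
      exp (- t * p) * sin (a * p) * D' / D') (at p within {0..2 * pi})" for p
    by (rule DERIV_cdivide)
       (auto intro!: derivative_eq_intros simp: D'_def algebra_simps power2_eq_square)
  then have "((\<lambda>p. exp (- t * p) * sin (a * p) * D' / D') has_integral
      exp (- t * (2 * pi)) * (- t * sin (a * (2 * pi)) - a * cos (a * (2 * pi))) / D' -
      exp (- t * 0) * (- t * sin (a * 0) - a * cos (a * 0)) / D') {0..2 * pi}"
    by (intro fundamental_theorem_of_calculus)
       (simp_all flip: has_real_derivative_iff_has_vector_derivative)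
  then show "((\<lambda>p. exp (- t * p) * sin (a * p)) has_integral
           (1 + exp (- t * (2 * pi))) * (a / (t\<^sup>2 + a\<^sup>2))) {0..2 * pi}"
    using D' unfolding sa a D'_def[symmetric] by (simp add: algebra_simps add_divide_distrib)
  have "((\<lambda>p. exp (- t * p) * (- t * cos (a * p) + a * sin (a * p)) / D') has_real_derivative
      exp (- t * p) * cos (a * p) * D' / D') (at p within {0..2 * pi})" for p
    by (rule DERIV_cdivide)
       (auto intro!: derivative_eq_intros simp: D'_def algebra_simps power2_eq_square)
  then have "((\<lambda>p. exp (- t * p) * cos (a * p) * D' / D') has_integral
      exp (- t * (2 * pi)) * (- t * cos (a * (2 * pi)) + a * sin (a * (2 * pi))) / D' -
      exp (- t * 0) * (- t * cos (a * 0) + a * sin (a * 0)) / D') {0..2 * pi}"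
    by (intro fundamental_theorem_of_calculus)
       (simp_all flip: has_real_derivative_iff_has_vector_derivative)
  then show "((\<lambda>p. exp (- t * p) * cos (a * p)) has_integral
           (1 + exp (- t * (2 * pi))) * (t / (t\<^sup>2 + a\<^sup>2))) {0..2 * pi}"
    using D' unfolding sa a D'_def[symmetric] by (simp add: algebra_simps add_divide_distrib)
qed

lemma cos_half_odd_period:
  assumes "x = of_int l + 1/2"
  shows "cos (x * (2 * pi)) = - 1"
proof -
  have "x * (2 * pi) = 2 * pi * of_int l + pi" by (simp add: assms algebra_simps)
  then show ?thesis by (simp add: cos_add)
qed

lemma has_integral_third_diff_kernel:
  fixes t :: real and l :: int
  assumes t: "t > 0"
  shows "((\<lambda>p. exp (- t * p) * (8 * sin (p / 2) ^ 3 * cos (l * p))) has_integral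
           - (1 + exp (- t * (2 * pi))) * third_diff (\<lambda>a. a / (t\<^sup>2 + a\<^sup>2)) l) {0..2 * pi}"
    and "((\<lambda>p. exp (- t * p) * (8 * sin (p / 2) ^ 3 * sin (l * p))) has_integral
           (1 + exp (- t * (2 * pi))) * third_diff (\<lambda>a. t / (t\<^sup>2 + a\<^sup>2)) l) {0..2 * pi}"
proof -
  have c: "cos ((l + 3/2) * (2 * pi)) = - 1" "cos ((l + 1/2) * (2 * pi)) = - 1"
    "cos ((l - 1/2) * (2 * pi)) = - 1" "cos ((l - 3/2) * (2 * pi)) = - 1"
    by (rule cos_half_odd_period[of _ "l + 1"] cos_half_odd_period[of _ l]
      cos_half_odd_period[of _ "l - 1"] cos_half_odd_period[of _ "l - 2"]; simp; fail)+
  define E where "E = 1 + exp (- t * (2 * pi))"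
  note i1 = c[THEN has_integral_exp_sin_cos_period(1)[OF t, folded E_def]]
  note i2 = c[THEN has_integral_exp_sin_cos_period(2)[OF t, folded E_def]]
  have "((\<lambda>p. - (exp (- t * p) * third_diff (\<lambda>a. sin (a * p)) l)) has_integral
           - (E * third_diff (\<lambda>a. a / (t\<^sup>2 + a\<^sup>2)) l)) {0..2 * pi}"
    by (rule has_integral_neg,
        rule has_integral_eq_rhs[OF has_integral_eq[OF _ has_integral_diff[OF has_integral_add[OF
          has_integral_diff[OF i1(1) has_integral_mult_right[OF i1(2), of 3]]
          has_integral_mult_right[OF i1(3), of 3]] i1(4)]]])
       (simp_all add: third_diff_def algebra_simps)
  then show "((\<lambda>p. exp (- t * p) * (8 * sin (p / 2) ^ 3 * cos (l * p))) has_integral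
           - (1 + exp (- t * (2 * pi))) * third_diff (\<lambda>a. a / (t\<^sup>2 + a\<^sup>2)) l) {0..2 * pi}"
    unfolding third_diff_sin E_def[symmetric] by simp
  have "((\<lambda>p. exp (- t * p) * third_diff (\<lambda>a. cos (a * p)) l) has_integral
           E * third_diff (\<lambda>a. t / (t\<^sup>2 + a\<^sup>2)) l) {0..2 * pi}"
    by (rule has_integral_eq_rhs[OF has_integral_eq[OF _ has_integral_diff[OF has_integral_add[OF
          has_integral_diff[OF i2(1) has_integral_mult_right[OF i2(2), of 3]]
          has_integral_mult_right[OF i2(3), of 3]] i2(4)]]])
       (simp_all add: third_diff_def algebra_simps)
  then show "((\<lambda>p. exp (- t * p) * (8 * sin (p / 2) ^ 3 * sin (l * p))) has_integral
           (1 + exp (- t * (2 * pi))) * third_diff (\<lambda>a. t / (t\<^sup>2 + a\<^sup>2)) l) {0..2 * pi}"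
    unfolding third_diff_cos E_def[symmetric] by simp
qed

text \<open>The sum equals |sum_j (x j + i y j) exp (i j p)|^2; antisymmetry of the sine merges its
  two cross terms into the one with factor 2.\<close>

lemma trig_form_nonneg:
  fixes x y :: "nat \<Rightarrow> real"
  shows "0 \<le> (\<Sum>j<n. \<Sum>k<n. cos ((real j - real k) * p) * (x j * x k + y j * y k)
                + 2 * (sin ((real j - real k) * p) * (x j * y k)))"
proof -
  define C where "C z = (\<Sum>j<n. z j * cos (real j * p))" for z :: "nat \<Rightarrow> real"
  define S where "S z = (\<Sum>j<n. z j * sin (real j * p))" for z :: "nat \<Rightarrow> real"
  have "(\<Sum>j<n. \<Sum>k<n. cos ((real j - real k) * p) * (x j * x k + y j * y k)
                + 2 * (sin ((real j - real k) * p) * (x j * y k)))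
      = (\<Sum>j<n. \<Sum>k<n.
          (x j * cos (real j * p)) * (x k * cos (real k * p))
          + (x j * sin (real j * p)) * (x k * sin (real k * p))
          + (y j * cos (real j * p)) * (y k * cos (real k * p))
          + (y j * sin (real j * p)) * (y k * sin (real k * p))
          + 2 * ((x j * sin (real j * p)) * (y k * cos (real k * p)))
          - 2 * ((x j * cos (real j * p)) * (y k * sin (real k * p))))"
    by (intro sum.cong refl) (simp add: left_diff_distrib cos_diff sin_diff algebra_simps)
  also have "\<dots> = C x * C x + S x * S x + C y * C y + S y * S y + 2 * (S x * C y) - 2 * (C x * S y)"
    unfolding C_def S_def sum_product by (simp add: sum.distrib sum_subtractf sum_distrib_left)
  also have "\<dots> = (C x - S y)\<^sup>2 + (S x + C y)\<^sup>2"
    by (simp add: power2_eq_square algebra_simps)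
  finally show ?thesis by simp
qed

lemma third_diff_kernel_form_nonneg:
  fixes x y :: "nat \<Rightarrow> real"
  assumes t: "t > 0"
  shows "0 \<le> (\<Sum>j<n. \<Sum>k<n.
            - third_diff (\<lambda>a. a / (t\<^sup>2 + a\<^sup>2)) (real j - real k) * (x j * x k + y j * y k)
            + 2 * (third_diff (\<lambda>a. t / (t\<^sup>2 + a\<^sup>2)) (real j - real k) * (x j * y k)))"
    (is "0 \<le> ?F")
proof -
  define E where "E = 1 + exp (- t * (2 * pi))"
  have E: "E > 0" by (simp add: E_def add_pos_pos)
  have i: "((\<lambda>p. exp (- t * p) * (8 * sin (p / 2) ^ 3 * cos ((real j - real k) * p))) has_integral
           - E * third_diff (\<lambda>a. a / (t\<^sup>2 + a\<^sup>2)) (real j - real k)) {0..2 * pi}"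
          "((\<lambda>p. exp (- t * p) * (8 * sin (p / 2) ^ 3 * sin ((real j - real k) * p))) has_integral
           E * third_diff (\<lambda>a. t / (t\<^sup>2 + a\<^sup>2)) (real j - real k)) {0..2 * pi}" for j k
    using has_integral_third_diff_kernel[OF t, of "int j - int k"] by (simp_all add: E_def)
  have "((\<lambda>p. \<Sum>j<n. \<Sum>k<n.
          exp (- t * p) * (8 * sin (p / 2) ^ 3 * cos ((real j - real k) * p)) * (x j * x k + y j * y k)
          + exp (- t * p) * (8 * sin (p / 2) ^ 3 * sin ((real j - real k) * p)) * (2 * (x j * y k)))
        has_integral (\<Sum>j<n. \<Sum>k<n.
          - E * third_diff (\<lambda>a. a / (t\<^sup>2 + a\<^sup>2)) (real j - real k) * (x j * x k + y j * y k)
          + E * third_diff (\<lambda>a. t / (t\<^sup>2 + a\<^sup>2)) (real j - real k) * (2 * (x j * y k)))) {0..2 * pi}"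
    by (intro has_integral_sum has_integral_add has_integral_mult_left i) auto
  moreover have "0 \<le> (\<Sum>j<n. \<Sum>k<n.
          exp (- t * p) * (8 * sin (p / 2) ^ 3 * cos ((real j - real k) * p)) * (x j * x k + y j * y k)
          + exp (- t * p) * (8 * sin (p / 2) ^ 3 * sin ((real j - real k) * p)) * (2 * (x j * y k)))"
    (is "0 \<le> ?G p") if p: "p \<in> {0..2 * pi}" for p
  proof -
    have "?G p = exp (- t * p) * (8 * sin (p / 2) ^ 3) *
      (\<Sum>j<n. \<Sum>k<n. cos ((real j - real k) * p) * (x j * x k + y j * y k)
                + 2 * (sin ((real j - real k) * p) * (x j * y k)))"
      by (simp add: sum_distrib_left algebra_simps)
    moreover have "sin (p / 2) \<ge> 0" using p by (intro sin_ge_zero) auto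
    ultimately show ?thesis using trig_form_nonneg
      by (metis (no_types, lifting) exp_ge_zero mult_nonneg_nonneg zero_le_numeral zero_le_power)
  qed
  ultimately have "0 \<le> (\<Sum>j<n. \<Sum>k<n.
          - E * third_diff (\<lambda>a. a / (t\<^sup>2 + a\<^sup>2)) (real j - real k) * (x j * x k + y j * y k)
          + E * third_diff (\<lambda>a. t / (t\<^sup>2 + a\<^sup>2)) (real j - real k) * (2 * (x j * y k)))"
    by (rule has_integral_nonneg)
  also have "\<dots> = E * ?F"
    by (simp add: sum_distrib_left algebra_simps)
  finally show ?thesis using E by (simp add: zero_le_mult_iff)
qed

subsection \<open>The sector condition\<close>

lemma has_integral_third_diff_powr:
  fixes d :: real and l :: int
  assumes d: "0 < d" "d < 1"
  shows "((\<lambda>t. t powr d * third_diff (\<lambda>a. a / (t\<^sup>2 + a\<^sup>2)) l) has_integral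
           Beta ((d + 1) / 2) ((1 - d) / 2) / 2 * third_diff (\<lambda>a. sgn a * \<bar>a\<bar> powr d) l) {0<..}"
    and "((\<lambda>t. t powr d * third_diff (\<lambda>a. t / (t\<^sup>2 + a\<^sup>2)) l) has_integral
           - (Beta (d / 2) ((2 - d) / 2) / 2 * third_diff (\<lambda>a. \<bar>a\<bar> powr d) l)) {0<..}"
proof -
  define K1 where "K1 = Beta ((d + 1) / 2) ((1 - d) / 2) / 2"
  define K0 where "K0 = Beta (d / 2) ((2 - d) / 2) / 2"
  have i1: "((\<lambda>t. t powr d * (a / (t\<^sup>2 + a\<^sup>2))) has_integral K1 * (sgn a * \<bar>a\<bar> powr d)) {0<..}"
    if "a \<noteq> 0" for a
  proof -
    have "\<bar>a\<bar> powr d = \<bar>a\<bar> powr (d - 1) * \<bar>a\<bar> powr 1" unfolding powr_add[symmetric] by simp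
    then have "sgn a * \<bar>a\<bar> powr d = a * \<bar>a\<bar> powr (d - 1)" by (simp add: sgn_if)
    then show ?thesis
      using has_integral_mult_right[OF has_integral_powr_over_sum_squares[of "\<bar>a\<bar>" d], of a] that d
      by (simp add: K1_def mult_ac)
  qed
  have i0: "((\<lambda>t. t powr (d - 1) * (a\<^sup>2 / (t\<^sup>2 + a\<^sup>2))) has_integral K0 * \<bar>a\<bar> powr d) {0<..}"
    if "a \<noteq> 0" for a
  proof -
    have "\<bar>a\<bar> powr d = \<bar>a\<bar> powr (d - 2) * \<bar>a\<bar> powr 2" unfolding powr_add[symmetric] by simp
    then have "\<bar>a\<bar> powr d = a\<^sup>2 * \<bar>a\<bar> powr (d - 2)" using that by simp
    then show ?thesis
      using has_integral_mult_right[OF has_integral_powr_over_sum_squares[of "\<bar>a\<bar>" "d - 1"], of "a\<^sup>2"] that d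
      by (simp add: K0_def mult_ac)
  qed
  have nz: "l + 3/2 \<noteq> (0::real)" "l + 1/2 \<noteq> (0::real)" "l - 1/2 \<noteq> (0::real)" "l - 3/2 \<noteq> (0::real)"
  proof -
    have "2 * l + 3 \<noteq> 0" "2 * l + 1 \<noteq> 0" "2 * l - 1 \<noteq> 0" "2 * l - 3 \<noteq> 0" by presburger+
    then have "2 * real_of_int l + 3 \<noteq> 0" "2 * real_of_int l + 1 \<noteq> 0"
      "2 * real_of_int l - 1 \<noteq> 0" "2 * real_of_int l - 3 \<noteq> 0"
      by linarith+
    then show "l + 3/2 \<noteq> (0::real)" "l + 1/2 \<noteq> (0::real)" "l - 1/2 \<noteq> (0::real)" "l - 3/2 \<noteq> (0::real)"
      by linarith+
  qed
  show "((\<lambda>t. t powr d * third_diff (\<lambda>a. a / (t\<^sup>2 + a\<^sup>2)) l) has_integral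
           Beta ((d + 1) / 2) ((1 - d) / 2) / 2 * third_diff (\<lambda>a. sgn a * \<bar>a\<bar> powr d) l) {0<..}"
    unfolding K1_def[symmetric]
    by (rule has_integral_eq_rhs[OF has_integral_eq[OF _ has_integral_diff[OF has_integral_add[OF
          has_integral_diff[OF i1[OF nz(1)] has_integral_mult_right[OF i1[OF nz(2)], of 3]]
          has_integral_mult_right[OF i1[OF nz(3)], of 3]] i1[OF nz(4)]]]])
       (simp_all only: third_diff_def distrib_left right_diff_distrib mult_ac)
  \<comment> \<open>For a single node, t^d times t / (t^2 + a^2) decays only like t^(d - 1) and is
    not integrable. The representation therefore starts from a^2 / (t^2 + a^2) = 1 - t * (t / (t^2 +
    a^2)), whose constant 1 is annihilated by the difference.\<close>
  have "((\<lambda>t. t powr (d - 1) * third_diff (\<lambda>a. a\<^sup>2 / (t\<^sup>2 + a\<^sup>2)) l) has_integral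
           K0 * third_diff (\<lambda>a. \<bar>a\<bar> powr d) l) {0<..}"
    by (rule has_integral_eq_rhs[OF has_integral_eq[OF _ has_integral_diff[OF has_integral_add[OF
          has_integral_diff[OF i0[OF nz(1)] has_integral_mult_right[OF i0[OF nz(2)], of 3]]
          has_integral_mult_right[OF i0[OF nz(3)], of 3]] i0[OF nz(4)]]]])
       (simp_all only: third_diff_def distrib_left right_diff_distrib mult_ac)
  from has_integral_neg[OF this]
  have "((\<lambda>t. - (t powr (d - 1) * third_diff (\<lambda>a. a\<^sup>2 / (t\<^sup>2 + a\<^sup>2)) l)) has_integral
           - (K0 * third_diff (\<lambda>a. \<bar>a\<bar> powr d) l)) {0<..}" .
  moreover have "- (t powr (d - 1) * third_diff (\<lambda>a. a\<^sup>2 / (t\<^sup>2 + a\<^sup>2)) l) =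
      t powr d * third_diff (\<lambda>a. t / (t\<^sup>2 + a\<^sup>2)) l" if "t \<in> {0<..}" for t
  proof -
    have t: "t > 0" using that by simp
    have "t powr d = t powr (d - 1) * t powr 1" unfolding powr_add[symmetric] by simp
    then have td: "t powr d = t powr (d - 1) * t" using t by simp
    have e: "a\<^sup>2 / (t\<^sup>2 + a\<^sup>2) = 1 - t * (t / (t\<^sup>2 + a\<^sup>2))" for a
    proof -
      have "t\<^sup>2 + a\<^sup>2 \<noteq> 0" using t by (simp add: add_nonneg_eq_0_iff)
      then show ?thesis by (simp add: field_simps power2_eq_square)
    qed
    show ?thesis unfolding td e by (simp add: third_diff_def algebra_simps del: times_divide_eq_right)
  qed
  ultimately show "((\<lambda>t. t powr d * third_diff (\<lambda>a. t / (t\<^sup>2 + a\<^sup>2)) l) has_integral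
           - (Beta (d / 2) ((2 - d) / 2) / 2 * third_diff (\<lambda>a. \<bar>a\<bar> powr d) l)) {0<..}"
    unfolding K0_def[symmetric] by (metis (no_types, lifting) has_integral_eq)
qed

text \<open>Every \<open>t\<close> contributes a nonnegative form, and t^d is the weight under which
  both kernels integrate to powers. Dividing by the constant \<open>K\<close> of the even part
  leaves the ratio of the constants, the tangent, on the odd part.\<close>

lemma third_diff_powr_form_nonneg:
  fixes x y :: "nat \<Rightarrow> real" and d :: real
  assumes d: "0 < d" "d < 1"
  shows "0 \<le> (\<Sum>j<n. \<Sum>k<n.
       - third_diff (\<lambda>a. sgn a * \<bar>a\<bar> powr d) (real j - real k) * tan (d / 2 * pi) * (x j * x k + y j * y k)
       - 2 * (third_diff (\<lambda>a. \<bar>a\<bar> powr d) (real j - real k) * (x j * y k)))" (is "0 \<le> ?F")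
proof -
  define K where "K = Beta (d / 2) ((2 - d) / 2) / 2"
  have K: "K > 0" unfolding K_def Beta_def using d
    by (intro divide_pos_pos mult_pos_pos Gamma_real_pos) (auto simp: field_simps)
  have i: "((\<lambda>t. t powr d * third_diff (\<lambda>a. a / (t\<^sup>2 + a\<^sup>2)) (real j - real k)) has_integral
           K * tan (d / 2 * pi) * third_diff (\<lambda>a. sgn a * \<bar>a\<bar> powr d) (real j - real k)) {0<..}"
          "((\<lambda>t. t powr d * third_diff (\<lambda>a. t / (t\<^sup>2 + a\<^sup>2)) (real j - real k)) has_integral
           - (K * third_diff (\<lambda>a. \<bar>a\<bar> powr d) (real j - real k))) {0<..}" for j k
    using has_integral_third_diff_powr[OF d, of "int j - int k"]
    by (simp_all add: K_def Beta_half_shift_ratio[OF d] mult_ac)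
  have "((\<lambda>t. \<Sum>j<n. \<Sum>k<n.
          t powr d * third_diff (\<lambda>a. a / (t\<^sup>2 + a\<^sup>2)) (real j - real k) * (- (x j * x k + y j * y k))
          + t powr d * third_diff (\<lambda>a. t / (t\<^sup>2 + a\<^sup>2)) (real j - real k) * (2 * (x j * y k)))
        has_integral (\<Sum>j<n. \<Sum>k<n.
          K * tan (d / 2 * pi) * third_diff (\<lambda>a. sgn a * \<bar>a\<bar> powr d) (real j - real k) * (- (x j * x k + y j * y k))
          + - (K * third_diff (\<lambda>a. \<bar>a\<bar> powr d) (real j - real k)) * (2 * (x j * y k)))) {0<..}"
    by (intro has_integral_sum has_integral_add has_integral_mult_left i) auto
  moreover have "0 \<le> (\<Sum>j<n. \<Sum>k<n.
          t powr d * third_diff (\<lambda>a. a / (t\<^sup>2 + a\<^sup>2)) (real j - real k) * (- (x j * x k + y j * y k))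
          + t powr d * third_diff (\<lambda>a. t / (t\<^sup>2 + a\<^sup>2)) (real j - real k) * (2 * (x j * y k)))"
    (is "0 \<le> ?G t") if t: "t \<in> {0<..}" for t
  proof -
    have "?G t = t powr d * (\<Sum>j<n. \<Sum>k<n.
            - third_diff (\<lambda>a. a / (t\<^sup>2 + a\<^sup>2)) (real j - real k) * (x j * x k + y j * y k)
            + 2 * (third_diff (\<lambda>a. t / (t\<^sup>2 + a\<^sup>2)) (real j - real k) * (x j * y k)))"
      unfolding sum_distrib_left by (intro sum.cong refl) (simp add: algebra_simps)
    then show ?thesis using third_diff_kernel_form_nonneg[of t] t by simp
  qed
  ultimately have "0 \<le> (\<Sum>j<n. \<Sum>k<n.
          K * tan (d / 2 * pi) * third_diff (\<lambda>a. sgn a * \<bar>a\<bar> powr d) (real j - real k) * (- (x j * x k + y j * y k))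
          + - (K * third_diff (\<lambda>a. \<bar>a\<bar> powr d) (real j - real k)) * (2 * (x j * y k)))"
    by (rule has_integral_nonneg)
  also have "\<dots> = K * ?F"
    unfolding sum_distrib_left by (intro sum.cong refl) (simp add: algebra_simps)
  finally show ?thesis using K by (simp add: zero_le_mult_iff)
qed

text \<open>Truncation at 0 unites the three cases: the terms absent for \<open>k = 0\<close> and
  \<open>k = 1\<close> have negative bases, and \<open>0 powr d = 0\<close>.\<close>

lemma s_coeff_eq:
  assumes "0 < d"
  shows "s_coeff d k = max 0 (real k + 1/2) powr d - 2 * max 0 (real k - 1/2) powr d
           + max 0 (real k - 3/2) powr d"
  using assms by (cases "(d, k)" rule: s_coeff.cases) (auto simp: max_def)

text \<open>The shift by 1 undoes the Hessenberg offset: entry (j, k) of \<open>T_mat\<close>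
  carries the coefficient with index j - k + 1, so it becomes a third difference at j - k.\<close>

lemma q_coeff_eq:
  assumes "0 < d"
  shows "q_coeff d k = - third_diff (\<lambda>a. max 0 a powr d) (real k - 1)"
proof (cases k)
  case 0
  then show ?thesis by (simp add: third_diff_def)
next
  case (Suc m)
  show ?thesis unfolding Suc q_coeff.simps s_coeff_eq[OF assms] third_diff_def
    by (simp add: algebra_simps)
qed

lemma T_mat_index:
  assumes "0 < d" "j < n" "k < n"
  shows "T_mat n d $$ (j, k) = - third_diff (\<lambda>a. max 0 a powr d) (real j - real k)"
proof (cases "k \<le> j + 1")
  case True
  then show ?thesis using assms
    by (simp add: T_mat_def q_coeff_eq of_nat_diff)
next
  case False
  \<comment> \<open>All four nodes are now negative, so the formula also reproduces the zeros above
    the superdiagonal.\<close>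
  then have "real j + 2 \<le> real k" by linarith
  then show ?thesis using assms False by (simp add: T_mat_def third_diff_def max_def)
qed

lemma scalar_prod_mult_mat_vec:
  fixes x y :: "real vec"
  assumes "M \<in> carrier_mat n n" "x \<in> carrier_vec n" "y \<in> carrier_vec n"
  shows "scalar_prod x (M *\<^sub>v y) = (\<Sum>i<n. \<Sum>j<n. vec_index x i * M $$ (i, j) * vec_index y j)"
proof -
  have "scalar_prod x (M *\<^sub>v y) = (\<Sum>i<n. vec_index x i * (\<Sum>j<n. M $$ (i, j) * vec_index y j))"
    using assms unfolding scalar_prod_def[of x] 
    by (auto simp: scalar_prod_def lessThan_atLeast0 intro!: sum.cong)
  then show ?thesis by (simp add: sum_distrib_left mult_ac)
qed

lemma T_mat_carrier [simp]: "T_mat n d \<in> carrier_mat n n"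
  by (simp add: T_mat_def)

lemma third_diff_reflect: "third_diff (\<lambda>a. f (- a)) x = - third_diff f (- x)"
  by (simp add: third_diff_def add.commute)

text \<open>Third differences turn odd functions into even ones and conversely. Hence the odd
  extension of the truncated power yields the symmetrised entries of \<open>T_mat\<close>, and the
  even extension the antisymmetrised ones. Exchanging \<open>x\<close> and \<open>y\<close> gives
  the other sign of the skew term.\<close>

lemma T_mat_sector_one_sided:
  assumes d: "0 < d" "d < 1" and x: "x \<in> carrier_vec n" and y: "y \<in> carrier_vec n"
  shows "0 \<le> tan (d / 2 * pi) * (scalar_prod x (T_mat n d *\<^sub>v x) + scalar_prod y (T_mat n d *\<^sub>v y))
           + (scalar_prod x (T_mat n d *\<^sub>v y) - scalar_prod y (T_mat n d *\<^sub>v x))"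
proof -
  define D where "D = third_diff (\<lambda>a. max 0 a powr d)"
  define t where "t = tan (d / 2 * pi)"
  define X Y where "X = vec_index x" and "Y = vec_index y"
  have odd: "third_diff (\<lambda>a. sgn a * \<bar>a\<bar> powr d) l = D l + D (- l)" for l
  proof -
    have "(\<lambda>a. sgn a * \<bar>a\<bar> powr d) = (\<lambda>a. max 0 a powr d - max 0 (- a) powr d)"
      by (auto simp: max_def sgn_if)
    then show ?thesis
      using third_diff_reflect[of "\<lambda>a. max 0 a powr d" l] by (simp add: D_def third_diff_def)
  qed
  have even: "third_diff (\<lambda>a. \<bar>a\<bar> powr d) l = D l - D (- l)" for l
  proof -
    have "(\<lambda>a. \<bar>a\<bar> powr d) = (\<lambda>a. max 0 a powr d + max 0 (- a) powr d)"
      using d by (auto simp: max_def)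
    then show ?thesis
      using third_diff_reflect[of "\<lambda>a. max 0 a powr d" l] by (simp add: D_def third_diff_def)
  qed
  define G where "G u w = (\<Sum>j<n. \<Sum>k<n. D (real j - real k) * (u j * w k))" for u w :: "nat \<Rightarrow> real"
  have form: "scalar_prod z (T_mat n d *\<^sub>v w) = - G (vec_index z) (vec_index w)"
    if "z \<in> carrier_vec n" "w \<in> carrier_vec n" for z w
    unfolding scalar_prod_mult_mat_vec[OF T_mat_carrier that] sum_negf[symmetric] G_def
    by (intro sum.cong refl) (simp add: T_mat_index d D_def)
  have swap: "(\<Sum>j<n. \<Sum>k<n. D (real k - real j) * (u j * w k)) = G w u" for u w
    unfolding G_def by (subst sum.swap) (simp add: mult_ac)
  have "0 \<le> (\<Sum>j<n. \<Sum>k<n.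
       - (D (real j - real k) + D (real k - real j)) * t * (X j * X k + Y j * Y k)
       - 2 * ((D (real j - real k) - D (real k - real j)) * (X j * Y k)))"
    using third_diff_powr_form_nonneg[OF d, where n = n and x = X and y = Y] unfolding odd even t_def by simp
  also have "\<dots> = (\<Sum>j<n. \<Sum>k<n.
       2 * (D (real k - real j) * (X j * Y k)) - 2 * (D (real j - real k) * (X j * Y k))
       - t * (D (real j - real k) * (X j * X k)) - t * (D (real k - real j) * (X j * X k))
       - t * (D (real j - real k) * (Y j * Y k)) - t * (D (real k - real j) * (Y j * Y k)))"
    by (intro sum.cong refl) (simp add: algebra_simps)
  also have "\<dots> = 2 * G Y X - 2 * G X Y - t * G X X - t * G X X - t * G Y Y - t * G Y Y"
    unfolding sum_subtractf sum_distrib_left[symmetric] swap G_def[symmetric] ..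
  also have "\<dots> = 2 * (t * (scalar_prod x (T_mat n d *\<^sub>v x) + scalar_prod y (T_mat n d *\<^sub>v y))
           + (scalar_prod x (T_mat n d *\<^sub>v y) - scalar_prod y (T_mat n d *\<^sub>v x)))"
    unfolding form[OF x x] form[OF y y] form[OF x y] form[OF y x] X_def Y_def
    by (simp add: algebra_simps)
  finally show ?thesis by (simp add: t_def)
qed

lemma T_mat_sector:
  assumes "0 < d" "d < 1" "x \<in> carrier_vec n" "y \<in> carrier_vec n"
  shows "\<bar>scalar_prod x (T_mat n d *\<^sub>v y) - scalar_prod y (T_mat n d *\<^sub>v x)\<bar>
      \<le> tan (d / 2 * pi) * (scalar_prod x (T_mat n d *\<^sub>v x) + scalar_prod y (T_mat n d *\<^sub>v y))"
  using T_mat_sector_one_sided[of d x n y] T_mat_sector_one_sided[of d y n x] assms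
  by (simp add: abs_le_iff add.commute)

subsection \<open>Signs and monotonicity of the Toeplitz coefficients\<close>

definition central_diff :: "(real \<Rightarrow> real) \<Rightarrow> real \<Rightarrow> real" where
  "central_diff f x = f (x + 1/2) - f (x - 1/2)"

lemma has_real_derivative_central_diff_powr:
  assumes "real n / 2 < x"
  shows "((central_diff ^^ n) (\<lambda>x. x powr e) has_real_derivative
           e * (central_diff ^^ n) (\<lambda>x. x powr (e - 1)) x) (at x)"
  using assms
proof (induction n arbitrary: x)
  case 0
  then show ?case by (auto intro!: derivative_eq_intros)
next
  case (Suc n)
  let ?F = "(central_diff ^^ n) (\<lambda>x. x powr e)"
  let ?F' = "(central_diff ^^ n) (\<lambda>x. x powr (e - 1))"
  have 1: "((\<lambda>x. ?F (x + 1/2)) has_real_derivative e * ?F' (x + 1/2)) (at x)"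
    using Suc.IH[of "x + 1/2"] Suc.prems unfolding DERIV_shift by simp
  have 2: "((\<lambda>x. ?F (x + (- 1/2))) has_real_derivative e * ?F' (x + (- 1/2))) (at x)"
    using Suc.IH[of "x + (- 1/2)"] Suc.prems unfolding DERIV_shift by simp
  have eq: "(central_diff ^^ Suc n) f = (\<lambda>x. (central_diff ^^ n) f (x + 1/2) - (central_diff ^^ n) f (x + (- 1/2)))" for f
    by (simp add: fun_eq_iff central_diff_def)
  show ?case unfolding eq using DERIV_diff[OF 1 2] by (simp add: algebra_simps)
qed

text \<open>The mean value theorem trades one difference for one derivative, that is, for the factor
  \<open>e\<close> and the exponent \<open>e - 1\<close>. The bound on \<open>x\<close> keeps all
  nodes positive.\<close>

lemma central_diff_powr_Suc_mvt:
  assumes "real (Suc n) / 2 < x"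
  obtains z where "real n / 2 < z"
    "(central_diff ^^ Suc n) (\<lambda>x. x powr e) x = e * (central_diff ^^ n) (\<lambda>x. x powr (e - 1)) z"
proof -
  have "\<exists>z>x - 1/2. z < x + 1/2 \<and> (central_diff ^^ n) (\<lambda>x. x powr e) (x + 1/2) - (central_diff ^^ n) (\<lambda>x. x powr e) (x - 1/2)
      = ((x + 1/2) - (x - 1/2)) * (e * (central_diff ^^ n) (\<lambda>x. x powr (e - 1)) z)"
    by (rule MVT2) (use assms in \<open>auto intro!: has_real_derivative_central_diff_powr\<close>)
  then obtain z where "z > x - 1/2" "(central_diff ^^ Suc n) (\<lambda>x. x powr e) x = e * (central_diff ^^ n) (\<lambda>x. x powr (e - 1)) z"
    by (auto simp: central_diff_def)
  then show thesis using assms that[of z] by simp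
qed

text \<open>Each such trade contributes the current exponent, and \<open>e\<close>,
  \<open>e - 1\<close>, ... are all negative.\<close>

lemma central_diff_powr_neg_exponent_sign:
  assumes "e < 0" "real n / 2 < x"
  shows "0 < (- 1) ^ n * (central_diff ^^ n) (\<lambda>x. x powr e) x"
  using assms
proof (induction n arbitrary: e x)
  case 0
  then show ?case by simp
next
  case (Suc n)
  obtain z where z: "real n / 2 < z"
    "(central_diff ^^ Suc n) (\<lambda>x. x powr e) x = e * (central_diff ^^ n) (\<lambda>x. x powr (e - 1)) z"
    using central_diff_powr_Suc_mvt[OF Suc.prems(2)] by metis
  have "0 < - e * ((- 1) ^ n * (central_diff ^^ n) (\<lambda>x. x powr (e - 1)) z)"
    using Suc.IH[of "e - 1" z] z(1) Suc.prems(1) by (simp add: mult_neg_pos)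
  then show ?case unfolding z(2) by (simp add: mult_ac)
qed

text \<open>The first trade contributes \<open>d > 0\<close> and every later one a negative
  exponent, so there is one sign change fewer than there are differences.\<close>

lemma central_diff_powr_sign:
  assumes "0 < d" "d < 1" "real (Suc n) / 2 < x"
  shows "0 < (- 1) ^ n * (central_diff ^^ Suc n) (\<lambda>x. x powr d) x"
proof -
  obtain z where z: "real n / 2 < z"
    "(central_diff ^^ Suc n) (\<lambda>x. x powr d) x = d * (central_diff ^^ n) (\<lambda>x. x powr (d - 1)) z"
    using central_diff_powr_Suc_mvt[OF assms(3)] by metis
  have "0 < d * ((- 1) ^ n * (central_diff ^^ n) (\<lambda>x. x powr (d - 1)) z)"
    using central_diff_powr_neg_exponent_sign[of "d - 1" n z] z(1) assms by simp
  then show ?thesis unfolding z(2) by (simp add: mult_ac)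
qed

text \<open>
  The inequality \<open>t\<^sub>1 \<le> t\<^sub>2\<close>, which the sign of the fourth difference does not give because its nodes
  straddle 0. The derivative of the left-hand side divided by \<open>3\<^sup>d\<close> is decreasing on \<open>[0, 1]\<close>
  and still positive at 1, where the left-hand side vanishes.
\<close>

lemma powr_3_5_7_ineq:
  fixes d :: real
  assumes "0 < d" "d < 1"
  shows "7 powr d - 4 * 5 powr d + 6 * 3 powr d - 5 < 0"
proof -
  define f where "f = (\<lambda>d. 7 powr d - 4 * 5 powr d + 6 * 3 powr d - (5::real))"
  define g where "g = (\<lambda>d. ln 7 * (7/3) powr d - 4 * ln 5 * (5/3) powr d + 6 * ln (3::real))"
  have f': "(f has_real_derivative 3 powr x * g x) (at x)" for x
    unfolding f_def g_def
    by (auto intro!: derivative_eq_intros simp: powr_divide algebra_simps)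
  have g': "(g has_real_derivative
      ln 7 * (ln (7/3) * (7/3) powr x) - 4 * ln 5 * (ln (5/3) * (5/3) powr x)) (at x)" for x
    unfolding g_def by (auto intro!: derivative_eq_intros)
  have l57: "4 * ln 7 \<le> 5 * ln (5::real)"
  proof -
    have "4 * ln 7 = ln ((7::real) ^ 4)" using ln_realpow[of "7::real" 4] by simp
    also have "\<dots> \<le> ln (5 ^ 5)" by (subst ln_le_cancel_iff) auto
    also have "\<dots> = 5 * ln (5::real)" using ln_realpow[of "5::real" 5] by simp
    finally show ?thesis .
  qed
  have l73: "ln (7/3) \<le> 2 * ln (5/3::real)"
  proof -
    have "ln (7/3::real) \<le> ln ((5/3) ^ 2)" by (subst ln_le_cancel_iff) (auto simp: power2_eq_square)
    also have "\<dots> = 2 * ln (5/3::real)" using ln_realpow[of "5/3::real" 2] by simp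
    finally show ?thesis .
  qed
  have l5: "ln (5::real) > 0" "ln (5/3::real) > 0" "ln (7::real) > 0" by simp_all
  have g'_neg: "ln 7 * (ln (7/3) * (7/3) powr x) - 4 * ln 5 * (ln (5/3) * (5/3) powr x) < 0"
    if "x \<le> 1" for x :: real
  proof -
    have "(7/3) powr x = (7/5) powr x * (5/3) powr (x::real)"
      by (simp add: powr_mult[symmetric])
    moreover have "(7/5) powr x \<le> (7/5::real)"
      using powr_mono[of x 1 "7/5"] that by simp
    ultimately have 73: "(7/3) powr x \<le> 7/5 * (5/3) powr x" by simp
    \<comment> \<open>The three comparisons multiply to 5/4 * 2 * 7/5 = 7/2, which stays below the
      required 4.\<close>
    have "ln 7 * (ln (7/3) * (7/3) powr x) \<le> (5/4 * ln 5) * ((2 * ln (5/3)) * (7/5 * (5/3) powr x))"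
      by (intro mult_mono 73 l73) (use l57 l5 in auto)
    also have "\<dots> < 4 * ln 5 * (ln (5/3) * (5/3) powr x)"
      using l5 by simp
    finally show ?thesis by simp
  qed
  have g1: "g 1 > 0"
  proof -
    \<comment> \<open>Multiplied by 3 and exponentiated, the claim reads 5^20 < 7^7 * 3^18.\<close>
    have "20 * ln 5 = ln ((5::real) ^ 20)" using ln_realpow[of "5::real" 20] by simp
    also have "\<dots> < ln (7 ^ 7 * 3 ^ 18)" by (subst ln_less_cancel_iff) auto
    also have "\<dots> = ln (7 ^ 7) + ln (3 ^ 18 :: real)" by (rule ln_mult_pos) auto
    also have "\<dots> = 7 * ln 7 + 18 * ln (3::real)"
      using ln_realpow[of "7::real" 7] ln_realpow[of "3::real" 18] by simp
    finally have "20 * ln 5 < 7 * ln 7 + 18 * ln (3::real)" .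
    then show ?thesis by (simp add: g_def)
  qed
  have g_pos: "g x > 0" if "x < 1" for x
  proof -
    have "g 1 < g x"
      by (rule DERIV_neg_imp_decreasing[OF that]) (use g' g'_neg in blast)
    then show ?thesis using g1 by simp
  qed
  have "f d < f 1"
  proof (rule DERIV_pos_imp_increasing_open[OF assms(2)])
    show "\<exists>y. (f has_real_derivative y) (at x) \<and> 0 < y" if "d < x" "x < 1" for x
      using f'[of x] g_pos[of x] that by (intro exI[of _ "3 powr x * g x"]) auto
    show "continuous_on {d..1} f"
      by (rule DERIV_continuous_on) (use f' DERIV_subset in blast)
  qed
  then show ?thesis by (simp add: f_def)
qed

text \<open>
  The coefficients of \<open>(T + T\<^sup>T) / 2\<close>: symmetrising the entries of \<open>T\<close> replaces \<open>x\<^sub>+\<^sup>d\<close> by half of its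
  odd extension, since third differences at half-integer nodes are odd operators.
\<close>

definition toep_coeff :: "real \<Rightarrow> nat \<Rightarrow> real" where
  "toep_coeff d k = - third_diff (\<lambda>a. sgn a * \<bar>a\<bar> powr d) (real k) / 2"

lemma third_diff_conv_central_diff: "third_diff f x = (central_diff ^^ 3) f x"
  by (simp add: third_diff_def central_diff_def eval_nat_numeral algebra_simps)

lemma toep_coeff_eq:
  assumes "2 \<le> k"
  shows "toep_coeff d k = - third_diff (\<lambda>a. a powr d) (real k) / 2"
proof -
  have "real k - 3/2 > 0" using assms by simp
  then show ?thesis by (simp add: toep_coeff_def third_diff_def sgn_if)
qed

lemma toep_coeff_1_le_2:
  assumes d: "0 < d" "d < 1"
  shows "toep_coeff d 1 \<le> toep_coeff d 2"
proof -
  have h: "(7/2) powr d = 7 powr d * (1/2) powr d" "(5/2) powr d = 5 powr d * (1/2) powr d"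
    "(3/2) powr d = 3 powr d * (1/2) powr d"
    by (simp_all add: powr_divide)
  have "2 * (toep_coeff d 1 - toep_coeff d 2) = (1/2) powr d * (7 powr d - 4 * 5 powr d + 6 * 3 powr d - 5)"
    by (simp add: toep_coeff_def third_diff_def sgn_if h field_simps)
  also have "\<dots> \<le> 0" using powr_3_5_7_ineq[OF d] by (simp add: mult_nonneg_nonpos)
  finally show ?thesis by simp
qed

text \<open>Consecutive coefficients differ by half a fourth difference of x^d, and for
  \<open>k \<ge> 2\<close> its nodes k - 3/2, ..., k + 5/2 are positive.\<close>

lemma toep_coeff_mono:
  assumes d: "0 < d" "d < 1" and k: "1 \<le> k"
  shows "toep_coeff d k \<le> toep_coeff d (Suc k)"
proof (cases "k = 1")
  case True
  then show ?thesis using toep_coeff_1_le_2[OF d] by (simp add: numeral_2_eq_2)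
next
  case False
  then have k2: "2 \<le> k" using k by simp
  have "0 < (- 1) ^ 3 * (central_diff ^^ Suc 3) (\<lambda>x. x powr d) (real k + 1/2)"
    using k2 by (intro central_diff_powr_sign d) auto
  also have "(central_diff ^^ Suc 3) (\<lambda>x. x powr d) (real k + 1/2) =
      third_diff (\<lambda>x. x powr d) (real (Suc k)) - third_diff (\<lambda>x. x powr d) (real k)"
    unfolding third_diff_conv_central_diff
    by (subst funpow.simps(2)) (simp add: central_diff_def[of "(central_diff ^^ 3) (\<lambda>x. x powr d)"] add.commute)
  finally show ?thesis using k2 by (simp add: toep_coeff_eq)
qed

text \<open>From \<open>k = 2\<close> on the third difference of x^d has a definite sign; the first
  coefficient lies below the second.\<close>

lemma toep_coeff_nonpos:
  assumes d: "0 < d" "d < 1" and k: "1 \<le> k"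
  shows "toep_coeff d k \<le> 0"
proof -
  have *: "toep_coeff d k \<le> 0" if "2 \<le> k" for k
  proof -
    have "0 < (- 1) ^ 2 * (central_diff ^^ Suc 2) (\<lambda>x. x powr d) (real k)"
      using that by (intro central_diff_powr_sign d) auto
    then show ?thesis using that
      by (simp add: toep_coeff_eq third_diff_conv_central_diff numeral_3_eq_3 numeral_2_eq_2)
  qed
  show ?thesis
  proof (cases "k = 1")
    case True
    then show ?thesis using toep_coeff_1_le_2[OF d] *[of 2] by simp
  next
    case False
    then show ?thesis using *[of k] k by simp
  qed
qed

text \<open>Third differences telescope: the partial sum is minus a second difference of the odd
  extension at K + 1/2, and x^d is concave. For \<open>K = 0\<close> one node is -1/2, and the claim
  reduces to 3^d < 3.\<close>

lemma toep_coeff_sum_pos: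
  assumes d: "0 < d" "d < 1"
  shows "0 < toep_coeff d 0 + 2 * (\<Sum>k = 1..K. toep_coeff d k)"
proof -
  define w where "w = (\<lambda>a. sgn a * \<bar>a\<bar> powr d)"
  define E where "E = (\<lambda>x. w (x + 1) - 2 * w x + w (x - 1))"
  have step: "2 * toep_coeff d (Suc k) = E (real k + 1/2) - E (real (Suc k) + 1/2)" for k
    unfolding toep_coeff_def third_diff_def E_def w_def[symmetric] by (simp add: field_simps)
  have "toep_coeff d 0 + 2 * (\<Sum>k = 1..K. toep_coeff d k) = - E (real K + 1/2)"
  proof (induction K)
    case 0
    show ?case by (simp add: toep_coeff_def third_diff_def E_def w_def)
  next
    case (Suc K)
    then show ?case using step[of K] by (simp add: distrib_left)
  qed
  moreover have "E (real K + 1/2) < 0"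
  proof (cases "K = 0")
    case True
    have "(3::real) powr d < 3 powr 1" using d by (intro powr_less_mono) auto
    then have "3 powr d * (1/2) powr d < 3 * (1/2::real) powr d" by simp
    moreover have "(3/2) powr d = 3 powr d * (1/2::real) powr d" by (simp add: powr_divide)
    ultimately show ?thesis using True by (simp add: E_def w_def)
  next
    case False
    have "0 < (- 1) ^ 1 * (central_diff ^^ Suc 1) (\<lambda>x. x powr d) (real K + 1/2)"
      using False by (intro central_diff_powr_sign d) auto
    then have "(real K + 1/2 + 1) powr d - 2 * (real K + 1/2) powr d + (real K + 1/2 - 1) powr d < 0"
      by (simp add: central_diff_def algebra_simps)
    moreover have "real K + 1/2 - 1 > 0" using False by simp
    ultimately show ?thesis by (simp add: E_def w_def sgn_if)
  qed
  ultimately show ?thesis by simp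
qed

subsection \<open>Diagonal dominance\<close>

lemma neg_less_of_sum_pos: "0 < a + b \<Longrightarrow> - b < (a::real)"
  by simp

text \<open>Off-diagonal products are absorbed by 2 b x_i x_j >= - |b| (x_i^2 + x_j^2). Symmetry
  charges both squares to row sums, which leaves the sum of \<open>R i\<close> times x_i^2 with
  every \<open>R i\<close> positive.\<close>

lemma strict_diag_dominant_form_pos:
  fixes a :: "nat \<Rightarrow> nat \<Rightarrow> real" and x :: "nat \<Rightarrow> real"
  assumes sym: "\<And>i j. i < n \<Longrightarrow> j < n \<Longrightarrow> a i j = a j i"
    and dom: "\<And>i. i < n \<Longrightarrow> (\<Sum>j\<in>{..<n} - {i}. \<bar>a i j\<bar>) < a i i"
    and k: "k < n" "x k \<noteq> 0"
  shows "0 < (\<Sum>i<n. \<Sum>j<n. a i j * (x i * x j))"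
proof -
  define b where "b i j = (if i = j then 0 else a i j)" for i j
  define R where "R i = a i i - (\<Sum>j\<in>{..<n} - {i}. \<bar>a i j\<bar>)" for i
  have split: "(\<Sum>j<n. f j) = f i + (\<Sum>j\<in>{..<n} - {i}. f j)" if "i < n" for i and f :: "nat \<Rightarrow> real"
    using that by (subst sum.remove[of _ i]) auto
  have R: "R i = a i i - (\<Sum>j<n. \<bar>b i j\<bar>)" if "i < n" for i
    using split[OF that, of "\<lambda>j. \<bar>b i j\<bar>"] by (simp add: R_def b_def)
  have row: "(\<Sum>j<n. a i j * (x i * x j)) = a i i * (x i * x i) + (\<Sum>j<n. b i j * (x i * x j))" if "i < n" for i
    using split[OF that, of "\<lambda>j. a i j * (x i * x j)"] split[OF that, of "\<lambda>j. b i j * (x i * x j)"]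
    by (simp add: b_def)
  define Q where "Q = (\<Sum>i<n. \<Sum>j<n. \<bar>b i j\<bar> * (x i * x i))"
  have Q': "Q = (\<Sum>i<n. \<Sum>j<n. \<bar>b i j\<bar> * (x j * x j))"
    unfolding Q_def by (subst sum.swap) (intro sum.cong refl, simp add: b_def sym)
  have "0 \<le> (\<Sum>i<n. \<Sum>j<n. 2 * (b i j * (x i * x j)) + \<bar>b i j\<bar> * (x i * x i) + \<bar>b i j\<bar> * (x j * x j))"
  proof (intro sum_nonneg)
    fix i j
    have "0 \<le> \<bar>b i j\<bar> * (x i + sgn (b i j) * x j)\<^sup>2" by simp
    also have "\<dots> = 2 * (b i j * (x i * x j)) + \<bar>b i j\<bar> * (x i * x i) + \<bar>b i j\<bar> * (x j * x j)"
      by (simp add: power2_eq_square sgn_if algebra_simps)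
    finally show "0 \<le> 2 * (b i j * (x i * x j)) + \<bar>b i j\<bar> * (x i * x i) + \<bar>b i j\<bar> * (x j * x j)" .
  qed
  also have "\<dots> = 2 * (\<Sum>i<n. \<Sum>j<n. b i j * (x i * x j)) + Q + Q"
    unfolding sum.distrib sum_distrib_left[symmetric] by (subst Q') (simp add: Q_def)
  finally have "- Q \<le> (\<Sum>i<n. \<Sum>j<n. b i j * (x i * x j))" by simp
  moreover have "(\<Sum>i<n. \<Sum>j<n. a i j * (x i * x j)) = (\<Sum>i<n. a i i * (x i * x i)) + (\<Sum>i<n. \<Sum>j<n. b i j * (x i * x j))"
    unfolding sum.distrib[symmetric] by (intro sum.cong refl) (simp add: row)
  moreover have "(\<Sum>i<n. R i * (x i * x i)) = (\<Sum>i<n. a i i * (x i * x i)) - Q"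
    unfolding Q_def sum_subtractf[symmetric]
    by (intro sum.cong refl) (simp add: R left_diff_distrib sum_distrib_right)
  moreover have "0 < (\<Sum>i<n. R i * (x i * x i))"
  proof (rule sum_pos2[of _ k])
    show "0 < R k * (x k * x k)" using dom[OF k(1)] k(2)
      unfolding R_def power2_eq_square[symmetric] by (intro mult_pos_pos) auto
    show "0 \<le> R i * (x i * x i)" if "i \<in> {..<n}" for i
      using dom[of i] that by (simp add: R_def)
  qed (use k in auto)
  ultimately show ?thesis by linarith
qed

text \<open>A Toeplitz matrix of order \<open>n\<close> has no coefficients from \<open>n\<close>
  on, whereas the Hankel indices below run past \<open>n\<close>.\<close>

definition trunc_coeff :: "nat \<Rightarrow> (nat \<Rightarrow> real) \<Rightarrow> nat \<Rightarrow> real" where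
  "trunc_coeff n c m = (if m < n then c m else 0)"

text \<open>
  The entries of \<open>T - \<tau>(T)\<close>, namely \<open>t\<close> at the sum of the indices and at its reflection in \<open>n + 1\<close>;
  the shift by 2 is due to indices starting at 0.
\<close>

definition hankel_coeff :: "nat \<Rightarrow> (nat \<Rightarrow> real) \<Rightarrow> nat \<Rightarrow> nat \<Rightarrow> real" where
  "hankel_coeff n c i j = trunc_coeff n c (i + j + 2) + trunc_coeff n c (2 * n - i - j)"

definition ndist :: "nat \<Rightarrow> nat \<Rightarrow> nat" where
  "ndist i j = (if i \<le> j then j - i else i - j)"

text \<open>Let c be the Toeplitz and h the Hankel entry. Off the diagonal \<open>c \<le> h\<close>
  and \<open>h \<le> 0\<close>, so for |s| <= 2 the entry has absolute value at most - c - h, while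
  a diagonal entry is at least c 0 + h. Dominance thus reduces to positive row sums of c + h, and in
  a row each of c 1, ..., c (n - 1) occurs at most twice.\<close>

lemma tau_form_pos:
  fixes c :: "nat \<Rightarrow> real" and x :: "nat \<Rightarrow> real"
  assumes mono: "\<And>k. 1 \<le> k \<Longrightarrow> c k \<le> c (Suc k)"
    and nonpos: "\<And>k. 1 \<le> k \<Longrightarrow> c k \<le> 0"
    and sum_pos: "0 < c 0 + 2 * (\<Sum>k = 1..n - 1. c k)"
    and s: "\<bar>s\<bar> \<le> 2" and k: "k < n" "x k \<noteq> 0"
  shows "0 < (\<Sum>i<n. \<Sum>j<n. (c (ndist i j) - hankel_coeff n c i j + s * hankel_coeff n c i j) * (x i * x j))"
proof (rule strict_diag_dominant_form_pos[where k = k and x = x, OF _ _ k])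
  let ?h = "hankel_coeff n c"
  let ?c = "trunc_coeff n c"
  show "c (ndist i j) - ?h i j + s * ?h i j = c (ndist j i) - ?h j i + s * ?h j i" for i j
    by (simp add: hankel_coeff_def ndist_def add.commute diff_commute)
  have mono': "c k \<le> c l" if "1 \<le> k" "k \<le> l" for k l
    using that(2)
  proof (induction rule: dec_induct)
    case (step m)
    then show ?case using mono[of m] that(1) by simp
  qed simp
  have c_nonpos: "?c m \<le> 0" if "1 \<le> m" for m using nonpos that by (simp add: trunc_coeff_def)
  have c_mono: "?c k \<le> ?c l" if "1 \<le> k" "k \<le> l" for k l
    using mono'[OF that] nonpos[OF that(1)] that by (auto simp: trunc_coeff_def)
  fix i assume i: "i < n"
  have h_nonpos: "?h i j \<le> 0" if "j < n" for j
    unfolding hankel_coeff_def using i that by (intro add_nonpos_nonpos c_nonpos) auto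
  have off: "\<bar>c (ndist i j) - ?h i j + s * ?h i j\<bar> \<le> - c (ndist i j) - ?h i j"
    if j: "j < n" "j \<noteq> i" for j
  proof -
    have d: "1 \<le> ndist i j" "ndist i j < n" using i j by (auto simp: ndist_def)
    have "c (ndist i j) = ?c (ndist i j)" using d by (simp add: trunc_coeff_def)
    moreover have "?c (ndist i j) \<le> ?c (i + j + 2)" "?c (ndist i j) \<le> ?c (2 * n - i - j)"
      using i j d by (auto intro!: c_mono simp: ndist_def)
    \<comment> \<open>The two indices add up to 2 n + 2, so at most one of them is below
      \<open>n\<close>.\<close>
    moreover have "?c (i + j + 2) = 0 \<or> ?c (2 * n - i - j) = 0"
      by (auto simp: trunc_coeff_def)
    ultimately have "c (ndist i j) \<le> ?h i j"
      unfolding hankel_coeff_def by auto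
    moreover have "2 * ?h i j + s * ?h i j \<le> 0"
      using mult_nonneg_nonpos[of "2 + s" "?h i j"] s h_nonpos[OF j(1)] by (simp add: distrib_right)
    moreover have "2 * ?h i j - s * ?h i j \<le> 0"
      using mult_nonneg_nonpos[of "2 - s" "?h i j"] s h_nonpos[OF j(1)] by (simp add: left_diff_distrib)
    ultimately show ?thesis by (intro abs_leI) simp_all
  qed
  have diag: "c 0 + ?h i i \<le> c (ndist i i) - ?h i i + s * ?h i i"
  proof -
    have "(2 - s) * ?h i i \<le> 0" using s h_nonpos[OF i] by (intro mult_nonneg_nonpos) auto
    moreover have "ndist i i = 0" by (simp add: ndist_def)
    ultimately show ?thesis by (simp add: algebra_simps)
  qed
  \<comment> \<open>As the coefficients are nonpositive, a sum over distinct positive indices is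
    smallest when it contains all of 1, ..., n - 1.\<close>
  have part: "(\<Sum>m = 1..n - 1. c m) \<le> (\<Sum>m\<in>A. ?c m)" if A: "finite A" "0 \<notin> A" for A
  proof -
    have "(\<Sum>m = 1..n - 1. c m) = (\<Sum>m = 1..n - 1. ?c m)"
      by (intro sum.cong refl) (auto simp: trunc_coeff_def)
    also have "\<dots> \<le> (\<Sum>m \<in> A \<inter> {1..n - 1}. ?c m)"
    proof -
      have "(\<Sum>m \<in> A \<inter> {1..n - 1}. - ?c m) \<le> (\<Sum>m = 1..n - 1. - ?c m)"
        using c_nonpos by (intro sum_mono2) auto
      then show ?thesis by (simp add: sum_negf)
    qed
    also have "\<dots> = (\<Sum>m\<in>A. ?c m)"
    proof (rule sum.mono_neutral_left)
      show "\<forall>m\<in>A - A \<inter> {1..n - 1}. ?c m = 0"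
      proof
        fix m assume m: "m \<in> A - A \<inter> {1..n - 1}"
        then have "m \<noteq> 0" using A by (cases m) auto
        with m show "?c m = 0" by (auto simp: trunc_coeff_def)
      qed
    qed (use A in auto)
    finally show ?thesis .
  qed
  \<comment> \<open>The distances to the left of the diagonal fill 1, ..., i, and the first family
    of Hankel indices starts at i + 2: no coefficient is met twice. \<open>l2\<close> pairs the
    right side with the second family in the same way.\<close>
  have l1: "(\<Sum>j<i. c (ndist i j)) + (\<Sum>j<n. ?c (i + j + 2)) \<ge> (\<Sum>m = 1..n - 1. c m)"
  proof -
    have "(\<Sum>j<i. c (ndist i j)) = (\<Sum>m = 1..i. ?c m)"
      by (rule sum.reindex_bij_witness[of _ "\<lambda>m. i - m" "\<lambda>j. i - j"])
         (use i in \<open>auto simp: ndist_def trunc_coeff_def\<close>)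
    moreover have "(\<Sum>j<n. ?c (i + j + 2)) = (\<Sum>m = i + 2..<i + 2 + n. ?c m)"
      by (rule sum.reindex_bij_witness[of _ "\<lambda>m. m - (i + 2)" "\<lambda>j. i + j + 2"]) auto
    moreover have "(\<Sum>m = 1..i. ?c m) + (\<Sum>m = i + 2..<i + 2 + n. ?c m) = (\<Sum>m\<in>{1..i} \<union> {i + 2..<i + 2 + n}. ?c m)"
      by (rule sum.union_disjoint[symmetric]) auto
    ultimately show ?thesis using part[of "{1..i} \<union> {i + 2..<i + 2 + n}"] by simp
  qed
  have l2: "(\<Sum>j\<in>{i<..<n}. c (ndist i j)) + (\<Sum>j<n. ?c (2 * n - i - j)) \<ge> (\<Sum>m = 1..n - 1. c m)"
  proof -
    have "(\<Sum>j\<in>{i<..<n}. c (ndist i j)) = (\<Sum>m = 1..<n - i. ?c m)"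
      by (rule sum.reindex_bij_witness[of _ "\<lambda>m. i + m" "\<lambda>j. j - i"])
         (use i in \<open>auto simp: ndist_def trunc_coeff_def\<close>)
    moreover have "(\<Sum>j<n. ?c (2 * n - i - j)) = (\<Sum>m = n - i + 1..2 * n - i. ?c m)"
      by (rule sum.reindex_bij_witness[of _ "\<lambda>m. 2 * n - i - m" "\<lambda>j. 2 * n - i - j"]) (use i in auto)
    moreover have "(\<Sum>m = 1..<n - i. ?c m) + (\<Sum>m = n - i + 1..2 * n - i. ?c m) = (\<Sum>m\<in>{1..<n - i} \<union> {n - i + 1..2 * n - i}. ?c m)"
      by (rule sum.union_disjoint[symmetric]) auto
    ultimately show ?thesis using part[of "{1..<n - i} \<union> {n - i + 1..2 * n - i}"] by simp
  qed
  have set_eq: "{..<n} - {i} = {..<i} \<union> {i<..<n}" using i by auto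
  have e1: "(\<Sum>j\<in>{..<n} - {i}. c (ndist i j)) = (\<Sum>j<i. c (ndist i j)) + (\<Sum>j\<in>{i<..<n}. c (ndist i j))"
    unfolding set_eq by (rule sum.union_disjoint) auto
  have e2: "(\<Sum>j<n. ?h i j) = (\<Sum>j<n. ?c (i + j + 2)) + (\<Sum>j<n. ?c (2 * n - i - j))"
    by (simp add: hankel_coeff_def sum.distrib)
  have e3: "(\<Sum>j<n. ?h i j) = ?h i i + (\<Sum>j\<in>{..<n} - {i}. ?h i j)"
    using i by (intro sum.remove) auto
  have arith: "0 < c0 + h + (P + Q)"
    if "P = P1 + P2" "H = H1 + H2" "H = h + Q" "W \<le> P1 + H1" "W \<le> P2 + H2" "0 < c0 + 2 * W"
    for c0 h P Q P1 P2 H H1 H2 W :: real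
    using that by linarith
  note tot = arith[OF e1 e2 e3 l1 l2 sum_pos]
  have "(\<Sum>j\<in>{..<n} - {i}. \<bar>c (ndist i j) - ?h i j + s * ?h i j\<bar>) \<le> (\<Sum>j\<in>{..<n} - {i}. - c (ndist i j) - ?h i j)"
    by (intro sum_mono off) auto
  also have "\<dots> = - ((\<Sum>j\<in>{..<n} - {i}. c (ndist i j)) + (\<Sum>j\<in>{..<n} - {i}. ?h i j))"
    by (simp add: sum_subtractf sum_negf)
  also have "\<dots> < c 0 + ?h i i" by (rule neg_less_of_sum_pos[OF tot])
  also note diag
  finally show "(\<Sum>j\<in>{..<n} - {i}. \<bar>c (ndist i j) - ?h i j + s * ?h i j\<bar>) < c (ndist i i) - ?h i i + s * ?h i i" .
qed

subsection \<open>Sine transforms and tau matrices\<close>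

lemma cos_of_int_pi: "cos (of_int p * pi) = (if even p then 1 else - 1)"
proof (cases "even p")
  case True
  then obtain q where "p = 2 * q" by (elim evenE)
  then show ?thesis using True cos_int_2pin[of q] by (simp add: mult_ac)
next
  case False
  then obtain q where q: "p = 2 * q + 1" by (elim oddE)
  have "of_int p * pi = (2 * pi) * of_int q + pi" by (simp add: q algebra_simps)
  then show ?thesis using False by (simp only: cos_add cos_pi sin_pi cos_int_2pin) simp
qed

text \<open>Dirichlet kernel at the angle x = p pi / (n + 1): multiplication by 2 sin (x / 2)
  telescopes the sum, and (n + 1/2) x = p pi - x / 2 evaluates its upper end. The value is 0 for odd
  and -1 for even \<open>p\<close>, except that all cosines are 1 when x is a multiple of 2
  pi.\<close>

lemma sum_cos_multiples:
  fixes p :: int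
  shows "(\<Sum>l<n. cos (real (l + 1) * (of_int p * pi / (real n + 1)))) =
    (if 2 * (int n + 1) dvd p then real n + 1 else 0) - (if even p then 1 else 0)"
proof (cases "2 * (int n + 1) dvd p")
  case True
  then obtain q where q: "p = 2 * (int n + 1) * q" by (elim dvdE)
  have "cos (real (l + 1) * (of_int p * pi / (real n + 1))) = 1" for l
  proof -
    have "real (l + 1) * (of_int p * pi / (real n + 1)) = (2 * pi) * of_int (int (l + 1) * q)"
      by (simp add: q field_simps)
    then show ?thesis by (simp only: cos_int_2pin)
  qed
  moreover have "even p" by (simp add: q)
  ultimately show ?thesis using True by simp
next
  case False
  define x where "x = of_int p * pi / (real n + 1)"
  have s: "sin (x / 2) \<noteq> 0"
  proof
    assume "sin (x / 2) = 0"
    then obtain i :: int where "x / 2 = of_int i * pi" by (auto simp: sin_zero_iff_int2)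
    then have "pi * real_of_int p = pi * real_of_int (2 * (int n + 1) * i)"
      by (simp add: x_def field_simps)
    then have "real_of_int p = real_of_int (2 * (int n + 1) * i)"
      unfolding mult_cancel_left by simp
    then have "p = 2 * (int n + 1) * i" by (simp only: of_int_eq_iff)
    with False show False by simp
  qed
  define f where "f l = sin ((real l + 1/2) * x)" for l
  have "2 * sin (x / 2) * (\<Sum>l<n. cos (real (l + 1) * x)) = (\<Sum>l<n. f (Suc l) - f l)"
    unfolding sum_distrib_left
  proof (intro sum.cong refl)
    fix l
    have e: "(real (Suc l) + 1/2) * x = real (l + 1) * x + x / 2" "(real l + 1/2) * x = real (l + 1) * x - x / 2"
      by (simp_all add: algebra_simps)
    show "2 * sin (x / 2) * cos (real (l + 1) * x) = f (Suc l) - f l"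
      unfolding f_def e sin_add sin_diff by simp
  qed
  also have "\<dots> = f n - f 0" by (rule sum_lessThan_telescope)
  also have "f n = - (if even p then 1 else - 1) * sin (x / 2)"
  proof -
    have "(real n + 1/2) * x = of_int p * pi - x / 2" by (simp add: x_def field_simps)
    then show ?thesis
      unfolding f_def by (simp add: sin_diff cos_of_int_pi sin_zero_iff_int2)
  qed
  also have "f 0 = sin (x / 2)" by (simp add: f_def)
  finally have "sin (x / 2) * (\<Sum>l<n. cos (real (l + 1) * x)) = sin (x / 2) * (- (if even p then 1 else 0))"
    by (simp split: if_splits)
  then have "(\<Sum>l<n. cos (real (l + 1) * x)) = - (if even p then 1 else 0)"
    using s by (simp only: mult_cancel_left) simp
  then show ?thesis using False by (simp add: x_def)
qed

text \<open>The delta of the discrete orthogonality relation, extended to all integers: like the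
  sine it is odd and 2 (n + 1)-periodic in \<open>p\<close>. Arguments outside 1, ..., n do occur in
  \<open>tau_mat_toeplitz\<close>.\<close>

definition sine_kron :: "nat \<Rightarrow> int \<Rightarrow> int \<Rightarrow> real" where
  "sine_kron n p k = (if 2 * (int n + 1) dvd p - k then 1 else 0) - (if 2 * (int n + 1) dvd p + k then 1 else 0)"

lemma sum_sin_sin:
  fixes p k :: int
  shows "(\<Sum>l<n. 2 / (real n + 1) * (sin (real (l + 1) * (of_int p * pi / (real n + 1)))
             * sin (real (l + 1) * (of_int k * pi / (real n + 1))))) = sine_kron n p k"
proof -
  have e: "2 / (real n + 1) * (sin (real (l + 1) * (of_int p * pi / (real n + 1)))
             * sin (real (l + 1) * (of_int k * pi / (real n + 1)))) =
      1 / (real n + 1) * (cos (real (l + 1) * (of_int (p - k) * pi / (real n + 1)))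
         - cos (real (l + 1) * (of_int (p + k) * pi / (real n + 1))))" for l
  proof -
    have a: "real (l + 1) * (of_int (p - k) * pi / (real n + 1)) =
        real (l + 1) * (of_int p * pi / (real n + 1)) - real (l + 1) * (of_int k * pi / (real n + 1))"
      "real (l + 1) * (of_int (p + k) * pi / (real n + 1)) =
        real (l + 1) * (of_int p * pi / (real n + 1)) + real (l + 1) * (of_int k * pi / (real n + 1))"
      by (simp_all add: algebra_simps add_divide_distrib diff_divide_distrib)
    show ?thesis unfolding a cos_add cos_diff by simp
  qed
  \<comment> \<open>Equal parity cancels the parity terms of the two cosine sums.\<close>
  have "even (p - k) = even (p + k)" by simp
  then show ?thesis
    unfolding e sum_distrib_left[symmetric] sum_subtractf sum_cos_multiples sine_kron_def
    by (simp add: field_simps)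
qed

lemma sine_mat_carrier [simp]: "sine_mat n \<in> carrier_mat n n"
  by (simp add: sine_mat_def)

lemma sine_mat_dim [simp]: "dim_row (sine_mat n) = n" "dim_col (sine_mat n) = n"
  by (simp_all add: sine_mat_def)

lemma sine_mat_index:
  assumes "i < n" "j < n"
  shows "sine_mat n $$ (i, j) = sqrt (2 / (real n + 1)) * sin (real (j + 1) * (of_int (int (i + 1)) * pi / (real n + 1)))"
  using assms by (simp add: sine_mat_def algebra_simps)

lemma sine_mat_sym: "sine_mat n $$ (i, j) = sine_mat n $$ (j, i)" if "i < n" "j < n"
  using that by (simp add: sine_mat_def algebra_simps)

lemma transpose_sine_mat [simp]: "transpose_mat (sine_mat n) = sine_mat n"
  by (rule eq_matI) (auto simp: sine_mat_sym)

lemma sine_diag_sine_index: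
  assumes "i < n" "j < n"
  shows "(sine_mat n * mat_diag n f * sine_mat n) $$ (i, j) = (\<Sum>l<n. sine_mat n $$ (i, l) * f l * sine_mat n $$ (l, j))"
  using assms
  by (simp add: mat_diag_mult_right[of _ n n] scalar_prod_def lessThan_atLeast0)

lemma sine_diag_sine_index_trig:
  assumes "i < n" "j < n"
  shows "(sine_mat n * mat_diag n f * sine_mat n) $$ (i, j) =
    (\<Sum>l<n. 2 / (real n + 1) * (sin (real (l + 1) * (of_int (int (i + 1)) * pi / (real n + 1)))
             * sin (real (l + 1) * (of_int (int (j + 1)) * pi / (real n + 1)))) * f l)"
proof -
  define r where "r = sqrt (2 / (real n + 1))"
  have rr: "r * r = 2 / (real n + 1)" by (simp add: r_def)
  show ?thesis unfolding sine_diag_sine_index[OF assms] rr[symmetric]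
  proof (intro sum.cong refl)
    fix l assume "l \<in> {..<n}"
    then have l: "l < n" by simp
    show "sine_mat n $$ (i, l) * f l * sine_mat n $$ (l, j) =
        r * r * (sin (real (l + 1) * (of_int (int (i + 1)) * pi / (real n + 1)))
           * sin (real (l + 1) * (of_int (int (j + 1)) * pi / (real n + 1)))) * f l"
      unfolding sine_mat_sym[OF l assms(2)] sine_mat_index[OF assms(1) l] sine_mat_index[OF assms(2) l] r_def[symmetric]
      by (simp only: mult_ac)
  qed
qed

lemma dvd_int_abs_less: "\<bar>x\<bar> < d \<Longrightarrow> d dvd x \<longleftrightarrow> x = (0::int)"
  using zdvd_not_zless[of "\<bar>x\<bar>" d] by auto

lemma sine_kron_eq:
  assumes "1 \<le> a" "a \<le> int n" "1 \<le> b" "b \<le> int n"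
  shows "sine_kron n a b = (if a = b then 1 else 0)"
  using assms by (simp add: sine_kron_def dvd_int_abs_less)

lemma sine_mat_square: "sine_mat n * sine_mat n = 1\<^sub>m n"
proof -
  have "sine_mat n * mat_diag n (\<lambda>_. 1) * sine_mat n = 1\<^sub>m n"
  proof (rule eq_matI)
    fix i j assume "i < dim_row (1\<^sub>m n :: real mat)" "j < dim_col (1\<^sub>m n :: real mat)"
    then have ij: "i < n" "j < n" by simp_all
    show "(sine_mat n * mat_diag n (\<lambda>_. 1) * sine_mat n) $$ (i, j) = (1\<^sub>m n :: real mat) $$ (i, j)"
      unfolding sine_diag_sine_index_trig[OF ij] mult_1_right sum_sin_sin
      using ij by (simp add: sine_kron_eq)
  qed auto
  then show ?thesis by simp
qed

lemma sum_coeff_delta: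
  fixes c :: "nat \<Rightarrow> real" and z :: int
  shows "(\<Sum>m = 1..n - 1. c m * (if int m = z then 1 else 0)) = (if 1 \<le> z \<and> z < int n then c (nat z) else 0)"
proof (cases "1 \<le> z \<and> z < int n")
  case True
  then have "int m = z \<longleftrightarrow> nat z = m" for m by auto
  moreover have "nat z \<in> {1..n - 1}" using True by auto
  ultimately show ?thesis using True by (simp add: if_distrib[of "\<lambda>x. _ * x"] sum.delta cong: if_cong)
next
  case False
  have "(\<Sum>m = 1..n - 1. c m * (if int m = z then 1 else 0)) = 0"
    using False by (intro sum.neutral) auto
  then show ?thesis by (simp only: if_not_P[OF False])
qed

text \<open>By 2 sin (a x) cos (m x) = sin ((a + m) x) + sin ((a - m) x), the coefficient
  \<open>c m\<close> couples the index a to a + m and a - m. When these leave the range 1, ..., n,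
  the sine reflects them in 0 or n + 1 with a minus sign, and this produces the Hankel part.\<close>

lemma tau_mat_toeplitz:
  assumes T: "T = mat n n (\<lambda>(i, j). c (ndist i j))"
  shows "tau_mat T = mat n n (\<lambda>(i, j). c (ndist i j) - hankel_coeff n c i j)"
proof (rule eq_matI)
  fix i j assume "i < dim_row (mat n n (\<lambda>(i, j). c (ndist i j) - hankel_coeff n c i j))"
    "j < dim_col (mat n n (\<lambda>(i, j). c (ndist i j) - hankel_coeff n c i j))"
  then have ij: "i < n" "j < n" by simp_all
  define \<theta> where "\<theta> = (\<lambda>(l::nat) (p::int). real (l + 1) * (of_int p * pi / (real n + 1)))"
  define a b where "a = int (i + 1)" and "b = int (j + 1)"
  have ab: "1 \<le> a" "a \<le> int n" "1 \<le> b" "b \<le> int n" using ij by (auto simp: a_def b_def)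
  have dim: "dim_row T = n" by (simp add: T)
  have T0: "T $$ (0, 0) + 2 * (\<Sum>m = 1..n - 1. T $$ (0, m) * cos (real (m * (l + 1)) * pi / (real n + 1)))
      = c 0 + (\<Sum>m = 1..n - 1. 2 * c m * cos (\<theta> l (int m)))" for l
    unfolding sum_distrib_left using ij
    by (intro arg_cong2[where f = "(+)"] sum.cong) (auto simp: T ndist_def \<theta>_def algebra_simps)
  have prod: "2 * sin (\<theta> l a) * cos (\<theta> l (int m)) = sin (\<theta> l (a + int m)) + sin (\<theta> l (a - int m))" for l m
  proof -
    have "\<theta> l (a + int m) = \<theta> l a + \<theta> l (int m)" "\<theta> l (a - int m) = \<theta> l a - \<theta> l (int m)"
      by (simp_all add: \<theta>_def add_divide_distrib diff_divide_distrib algebra_simps)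
    then show ?thesis by (simp add: sin_add sin_diff)
  qed
  have gen: "(\<Sum>l<n. k * X l + (\<Sum>m = 1..q. c m * Y l m + c m * Z l m)) =
      k * (\<Sum>l<n. X l) + (\<Sum>m = 1..q. c m * (\<Sum>l<n. Y l m) + c m * (\<Sum>l<n. Z l m))" for k q X Y Z
    unfolding sum.distrib sum_distrib_left sum.swap[of _ "{..<n}" "{1..q}"] ..
  have "tau_mat T $$ (i, j) = (\<Sum>l<n. 2 / (real n + 1) * (sin (\<theta> l a) * sin (\<theta> l b))
      * (c 0 + (\<Sum>m = 1..n - 1. 2 * c m * cos (\<theta> l (int m)))))"
    unfolding tau_mat_def Let_def dim T0 sine_diag_sine_index_trig[OF ij] by (simp add: \<theta>_def a_def b_def)
  also have "\<dots> = (\<Sum>l<n. c 0 * (2 / (real n + 1) * (sin (\<theta> l a) * sin (\<theta> l b)))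
      + (\<Sum>m = 1..n - 1. c m * (2 / (real n + 1) * (sin (\<theta> l (a + int m)) * sin (\<theta> l b)))
           + c m * (2 / (real n + 1) * (sin (\<theta> l (a - int m)) * sin (\<theta> l b)))))"
  proof (intro sum.cong refl)
    fix l
    define r where "r = 2 / (real n + 1)"
    have "r * (sin (\<theta> l a) * sin (\<theta> l b)) * (2 * c m * cos (\<theta> l (int m))) =
        c m * (r * (sin (\<theta> l (a + int m)) * sin (\<theta> l b))) + c m * (r * (sin (\<theta> l (a - int m)) * sin (\<theta> l b)))" for m
    proof -
      have "r * (sin (\<theta> l a) * sin (\<theta> l b)) * (2 * c m * cos (\<theta> l (int m))) =
          c m * (r * ((2 * sin (\<theta> l a) * cos (\<theta> l (int m))) * sin (\<theta> l b)))"
        by (simp only: mult_ac)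
      then show ?thesis unfolding prod by (simp only: distrib_left distrib_right)
    qed
    then show "2 / (real n + 1) * (sin (\<theta> l a) * sin (\<theta> l b))
      * (c 0 + (\<Sum>m = 1..n - 1. 2 * c m * cos (\<theta> l (int m)))) =
      c 0 * (2 / (real n + 1) * (sin (\<theta> l a) * sin (\<theta> l b)))
      + (\<Sum>m = 1..n - 1. c m * (2 / (real n + 1) * (sin (\<theta> l (a + int m)) * sin (\<theta> l b)))
           + c m * (2 / (real n + 1) * (sin (\<theta> l (a - int m)) * sin (\<theta> l b))))"
      unfolding r_def[symmetric] distrib_left sum_distrib_left by (simp only: mult.commute[of "c 0"])
  qed
  also have "\<dots> = c 0 * sine_kron n a b
      + (\<Sum>m = 1..n - 1. c m * sine_kron n (a + int m) b + c m * sine_kron n (a - int m) b)"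
    unfolding gen unfolding \<theta>_def sum_sin_sin ..
  also have "\<dots> = c 0 * (if a = b then 1 else 0)
      + (\<Sum>m = 1..n - 1. c m * (if int m = b - a then 1 else 0) - c m * (if int m = 2 * (int n + 1) - a - b then 1 else 0)
          + (c m * (if int m = a - b then 1 else 0) - c m * (if int m = a + b then 1 else 0)))"
  proof (intro arg_cong2[where f = "(+)"] sum.cong refl)
    show "c 0 * sine_kron n a b = c 0 * (if a = b then 1 else 0)" using ab by (simp add: sine_kron_eq)
    fix m assume "m \<in> {1..n - 1}"
    then have m: "1 \<le> int m" "int m < int n" by auto
    \<comment> \<open>a + m + b may exceed one period 2 (n + 1) but stays below two; subtracting one
      brings it into the range of \<open>dvd_int_abs_less\<close>.\<close>
    have sh: "D dvd X \<longleftrightarrow> D dvd X - D" for D X :: int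
      by (metis diff_add_cancel dvd_add_triv_right_iff)
    have d1: "2 * (int n + 1) dvd a + int m - b \<longleftrightarrow> int m = b - a"
      using ab m by (intro trans[OF dvd_int_abs_less]) auto
    have d2: "2 * (int n + 1) dvd a + int m + b \<longleftrightarrow> int m = 2 * (int n + 1) - a - b"
      unfolding sh[of _ "a + int m + b"] using ab m by (intro trans[OF dvd_int_abs_less]) auto
    have d3: "2 * (int n + 1) dvd a - int m - b \<longleftrightarrow> int m = a - b"
      using ab m by (intro trans[OF dvd_int_abs_less]) auto
    have d4: "2 * (int n + 1) dvd a - int m + b \<longleftrightarrow> int m = a + b"
      using ab m by (intro trans[OF dvd_int_abs_less]) auto
    show "c m * sine_kron n (a + int m) b = c m * (if int m = b - a then 1 else 0) - c m * (if int m = 2 * (int n + 1) - a - b then 1 else 0)"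
      unfolding sine_kron_def d1 d2 by (simp add: right_diff_distrib)
    show "c m * sine_kron n (a - int m) b = c m * (if int m = a - b then 1 else 0) - c m * (if int m = a + b then 1 else 0)"
      unfolding sine_kron_def d3 d4 by (simp add: right_diff_distrib)
  qed
  also have "\<dots> = c (ndist i j) - hankel_coeff n c i j"
    unfolding sum.distrib sum_subtractf sum_coeff_delta
  proof -
    have 1: "c 0 * (if a = b then 1 else 0) + (if 1 \<le> b - a \<and> b - a < int n then c (nat (b - a)) else 0)
        + (if 1 \<le> a - b \<and> a - b < int n then c (nat (a - b)) else 0) = c (ndist i j)"
    proof (cases i j rule: linorder_cases)
      case less
      then obtain d where "j = i + d" "0 < d" using less_imp_add_positive by blast
      then show ?thesis using ij by (simp add: a_def b_def ndist_def)
    next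
      case equal
      then show ?thesis by (simp add: a_def b_def ndist_def)
    next
      case greater
      then obtain d where "i = j + d" "0 < d" using less_imp_add_positive by blast
      then show ?thesis using ij by (simp add: a_def b_def ndist_def)
    qed
    have 2: "(if 1 \<le> a + b \<and> a + b < int n then c (nat (a + b)) else 0) = trunc_coeff n c (i + j + 2)"
      by (auto simp: a_def b_def trunc_coeff_def nat_add_distrib)
    obtain q where q: "2 * n - i - j = q" by blast
    have q': "2 * (int n + 1) - a - b = int q" "1 \<le> q" using ij q by (auto simp: a_def b_def)
    have 3: "(if 1 \<le> 2 * (int n + 1) - a - b \<and> 2 * (int n + 1) - a - b < int n then c (nat (2 * (int n + 1) - a - b)) else 0)
        = trunc_coeff n c (2 * n - i - j)"
      unfolding q'(1) q trunc_coeff_def using q'(2) by simp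
    show "c 0 * (if a = b then 1 else 0) +
      ((if 1 \<le> b - a \<and> b - a < int n then c (nat (b - a)) else 0) -
       (if 1 \<le> 2 * (int n + 1) - a - b \<and> 2 * (int n + 1) - a - b < int n then c (nat (2 * (int n + 1) - a - b)) else 0) +
       ((if 1 \<le> a - b \<and> a - b < int n then c (nat (a - b)) else 0) -
        (if 1 \<le> a + b \<and> a + b < int n then c (nat (a + b)) else 0))) =
      c (ndist i j) - hankel_coeff n c i j"
      unfolding 2 3 hankel_coeff_def 1[symmetric] by simp
  qed
  finally show "tau_mat T $$ (i, j) = mat n n (\<lambda>(i, j). c (ndist i j) - hankel_coeff n c i j) $$ (i, j)"
    using ij by simp
qed (simp_all add: tau_mat_def Let_def T)

subsection \<open>One-dimensional form bounds\<close>

definition bform :: "real mat \<Rightarrow> real vec \<Rightarrow> real vec \<Rightarrow> real" where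
  "bform M x y = scalar_prod x (M *\<^sub>v y)"

lemma bform_sum:
  assumes "M \<in> carrier_mat n n" "x \<in> carrier_vec n" "y \<in> carrier_vec n"
  shows "bform M x y = (\<Sum>i<n. \<Sum>j<n. M $$ (i, j) * (vec_index x i * vec_index y j))"
  unfolding bform_def scalar_prod_mult_mat_vec[OF assms] by (intro sum.cong refl) simp

lemma bform_add:
  assumes "M \<in> carrier_mat n n" "N \<in> carrier_mat n n" "x \<in> carrier_vec n" "y \<in> carrier_vec n"
  shows "bform (M + N) x y = bform M x y + bform N x y"
  using assms unfolding bform_def
  by (simp add: add_mult_distrib_mat_vec[of _ n n] scalar_prod_add_distrib[of _ n])

lemma bform_smult:
  assumes "M \<in> carrier_mat n n" "x \<in> carrier_vec n" "y \<in> carrier_vec n"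
  shows "bform (c \<cdot>\<^sub>m M) x y = c * bform M x y"
  using assms by (simp add: bform_sum[of _ n] sum_distrib_left mult.assoc)

lemma bform_transpose:
  assumes "M \<in> carrier_mat n n" "x \<in> carrier_vec n" "y \<in> carrier_vec n"
  shows "bform (transpose_mat M) x y = bform M y x"
proof -
  have "bform (transpose_mat M) x y = (\<Sum>i<n. \<Sum>j<n. M $$ (j, i) * (vec_index x i * vec_index y j))"
    using assms by (subst bform_sum[of _ n]) auto
  also have "\<dots> = bform M y x"
    unfolding bform_sum[OF assms(1,3,2)] by (subst sum.swap) (simp add: mult_ac)
  finally show ?thesis .
qed

lemma bform_zero:
  assumes "M \<in> carrier_mat n n"
  shows "bform M (0\<^sub>v n) (0\<^sub>v n) = 0"
  using assms by (simp add: bform_sum[of _ n])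

lemma B_mat_carrier [simp]: "B_mat n d kp km \<in> carrier_mat n n"
  by (simp add: B_mat_def)

lemma sym_part_carrier [simp]: "Z \<in> carrier_mat n n \<Longrightarrow> sym_part Z \<in> carrier_mat n n"
  by (simp add: sym_part_def)

lemma third_diff_odd:
  assumes "\<And>a. f (- a) = - f a"
  shows "third_diff f (- x) = third_diff f x"
  using third_diff_reflect[of f x] assms by (simp add: third_diff_def)

lemma T_mat_add_transpose_index:
  assumes d: "0 < d" and ij: "i < n" "j < n"
  shows "T_mat n d $$ (i, j) + T_mat n d $$ (j, i) = 2 * toep_coeff d (ndist i j)"
proof -
  define f where "f = (\<lambda>a::real. sgn a * \<bar>a\<bar> powr d)"
  have f: "f = (\<lambda>a. max 0 a powr d - max 0 (- a) powr d)"
    using d by (auto simp: max_def sgn_if f_def)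
  have "T_mat n d $$ (i, j) + T_mat n d $$ (j, i) = - third_diff f (real i - real j)"
    unfolding T_mat_index[OF d ij] T_mat_index[OF d ij(2,1)]
    using third_diff_reflect[of "\<lambda>a. max 0 a powr d" "real i - real j"]
    by (simp add: f third_diff_def)
  also have "third_diff f (real i - real j) = third_diff f (real (ndist i j))"
  proof (cases "i \<le> j")
    case True
    have "real i - real j = - real (ndist i j)" using True by (simp add: ndist_def of_nat_diff)
    moreover have "third_diff f (- x) = third_diff f x" for x
      by (rule third_diff_odd) (simp add: f_def)
    ultimately show ?thesis by simp
  qed (simp add: ndist_def of_nat_diff)
  finally show ?thesis by (simp add: toep_coeff_def f_def)
qed

lemma sym_part_B_mat:
  assumes "0 < d"
  shows "sym_part (B_mat n d kp km) = mat n n (\<lambda>(i, j). (kp + km) * toep_coeff d (ndist i j))"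
proof (rule eq_matI)
  fix i j assume "i < dim_row (mat n n (\<lambda>(i, j). (kp + km) * toep_coeff d (ndist i j)))"
    "j < dim_col (mat n n (\<lambda>(i, j). (kp + km) * toep_coeff d (ndist i j)))"
  then have ij: "i < n" "j < n" by simp_all
  have T: "dim_row (T_mat n d) = n" "dim_col (T_mat n d) = n" by (simp_all add: T_mat_def)
  have "sym_part (B_mat n d kp km) $$ (i, j) = (kp + km) / 2 * (T_mat n d $$ (i, j) + T_mat n d $$ (j, i))"
    using ij by (simp add: sym_part_def B_mat_def T field_simps)
  also have "\<dots> = (kp + km) * toep_coeff d (ndist i j)"
    unfolding T_mat_add_transpose_index[OF assms ij] by simp
  finally show "sym_part (B_mat n d kp km) $$ (i, j) = mat n n (\<lambda>(i, j). (kp + km) * toep_coeff d (ndist i j)) $$ (i, j)"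
    using ij by simp
qed (simp_all add: sym_part_def B_mat_def T_mat_def)

lemma bform_sym_part:
  assumes "M \<in> carrier_mat n n" "x \<in> carrier_vec n"
  shows "bform (sym_part M) x x = bform M x x"
  using assms by (simp add: sym_part_def bform_smult[of _ n] bform_add[of _ n] bform_transpose[of _ n])

lemma vec_index_nonzero_ex:
  fixes x :: "real vec"
  assumes "x \<in> carrier_vec n" "x \<noteq> 0\<^sub>v n"
  obtains k where "k < n" "vec_index x k \<noteq> 0"
proof -
  have "\<exists>k<n. vec_index x k \<noteq> 0"
  proof (rule ccontr)
    assume "\<not> ?thesis"
    then have "x = 0\<^sub>v n" using assms(1) by (intro eq_vecI) auto
    with assms(2) show False by simp
  qed
  then show thesis using that by blast
qed

text \<open>With h the Hankel matrix H(B) - C, the form of C + s h is positive for |s| <= 2. The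
  three claims are the cases s = 0, s = 2 and s = -2.\<close>

lemma B_mat_form_bounds:
  assumes d: "0 < d" "d < 1" and k: "0 < kp" "0 < km" and x: "x \<in> carrier_vec n"
  defines "B \<equiv> B_mat n d kp km" and "C \<equiv> tau_mat (sym_part (B_mat n d kp km))"
  shows "x \<noteq> 0\<^sub>v n \<Longrightarrow> 0 < bform C x x"
    and "1 / 2 * bform C x x \<le> bform B x x" and "bform B x x \<le> 3 / 2 * bform C x x"
proof -
  define c where "c = (\<lambda>m. (kp + km) * toep_coeff d m)"
  define h where "h = mat n n (\<lambda>(i, j). hankel_coeff n c i j)"
  have kk: "0 < kp + km" using k by simp
  have H: "sym_part (B_mat n d kp km) = mat n n (\<lambda>(i, j). c (ndist i j))"
    unfolding c_def by (rule sym_part_B_mat[OF d(1)])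
  have C: "C = mat n n (\<lambda>(i, j). c (ndist i j) - hankel_coeff n c i j)"
    unfolding C_def by (rule tau_mat_toeplitz[OF H])
  have Cc: "C \<in> carrier_mat n n" and hc: "h \<in> carrier_mat n n"
    by (simp_all add: C h_def)
  have pos: "0 < bform C x x + s * bform h x x" if s2: "\<bar>s\<bar> \<le> 2" and x0: "x \<noteq> 0\<^sub>v n" for s
  proof -
    obtain k where k: "k < n" "vec_index x k \<noteq> 0"
      by (rule vec_index_nonzero_ex[OF x x0])
    have "0 < (\<Sum>i<n. \<Sum>j<n. (c (ndist i j) - hankel_coeff n c i j + s * hankel_coeff n c i j) * (vec_index x i * vec_index x j))"
    proof (rule tau_form_pos[where x = "vec_index x", OF _ _ _ s2 k])
      show "c k \<le> c (Suc k)" if "1 \<le> k" for k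
        using toep_coeff_mono[OF d that] kk by (simp add: c_def)
      show "c k \<le> 0" if "1 \<le> k" for k
        using toep_coeff_nonpos[OF d that] kk by (simp add: c_def mult_nonneg_nonpos)
      have "0 < (kp + km) * (toep_coeff d 0 + 2 * (\<Sum>k = 1..n - 1. toep_coeff d k))"
        using toep_coeff_sum_pos[OF d] kk by simp
      also have "\<dots> = c 0 + 2 * (\<Sum>k = 1..n - 1. c k)"
        unfolding c_def by (simp only: sum_distrib_left distrib_left mult.left_commute)
      finally show "0 < c 0 + 2 * (\<Sum>k = 1..n - 1. c k)" .
    qed
    also have "\<dots> = bform C x x + s * bform h x x"
      unfolding bform_sum[OF Cc x x] bform_sum[OF hc x x] sum_distrib_left sum.distrib[symmetric]
      by (intro sum.cong refl) (simp add: C h_def distrib_right mult.assoc)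
    finally show ?thesis .
  qed
  have nonneg: "0 \<le> bform C x x + s * bform h x x" if "\<bar>s\<bar> \<le> 2" for s
  proof (cases "x = 0\<^sub>v n")
    case True
    then show ?thesis using bform_zero[OF Cc] bform_zero[OF hc] by simp
  next
    case False
    then show ?thesis using pos[OF that] by simp
  qed
  have "sym_part (B_mat n d kp km) = C + h"
    unfolding H C h_def by (rule eq_matI) auto
  then have B: "bform B x x = bform C x x + bform h x x"
    using bform_sym_part[of B n x] x bform_add[OF Cc hc x x] by (simp add: B_def)
  show "0 < bform C x x" if "x \<noteq> 0\<^sub>v n" using pos[of 0] that by simp
  show "1 / 2 * bform C x x \<le> bform B x x" using nonneg[of 2] B by simp
  show "bform B x x \<le> 3 / 2 * bform C x x" using nonneg[of "- 2"] B by simp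
qed

text \<open>The skew part of \<open>B\<close> is that of \<open>T_mat\<close> scaled by
  \<open>kp - km\<close>, the symmetric part is scaled by \<open>kp + km\<close>.\<close>

lemma B_mat_sector:
  assumes d: "0 < d" "d < 1" and k: "0 < kp" "0 < km" and x: "x \<in> carrier_vec n" and y: "y \<in> carrier_vec n"
  defines "B \<equiv> B_mat n d kp km"
  shows "\<bar>bform B x y - bform B y x\<bar> \<le>
    tan (d / 2 * pi) * (\<bar>kp - km\<bar> / (kp + km)) * (bform B x x + bform B y y)"
proof -
  define T where "T = T_mat n d"
  have T: "T \<in> carrier_mat n n" "transpose_mat T \<in> carrier_mat n n" by (simp_all add: T_def)
  have B: "bform B u w = kp * bform T u w + km * bform T w u" if "u \<in> carrier_vec n" "w \<in> carrier_vec n" for u w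
    using that T unfolding B_def B_mat_def T_def[symmetric]
    by (simp add: bform_add[of _ n] bform_smult[of _ n] bform_transpose[of _ n])
  have "bform B x y - bform B y x = (kp - km) * (bform T x y - bform T y x)"
    unfolding B[OF x y] B[OF y x] by (simp add: algebra_simps)
  then have "\<bar>bform B x y - bform B y x\<bar> = \<bar>kp - km\<bar> * \<bar>bform T x y - bform T y x\<bar>"
    by (simp add: abs_mult)
  also have "\<dots> \<le> \<bar>kp - km\<bar> * (tan (d / 2 * pi) * (bform T x x + bform T y y))"
    using T_mat_sector[OF d x y] by (intro mult_left_mono) (simp_all add: bform_def T_def)
  also have "bform T x x + bform T y y = (bform B x x + bform B y y) / (kp + km)"
  proof -
    have "bform B x x + bform B y y = (kp + km) * (bform T x x + bform T y y)"
      unfolding B[OF x x] B[OF y y] by (simp add: algebra_simps)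
    then show ?thesis using k by simp
  qed
  finally show ?thesis by (simp add: mult_ac)
qed

section \<open>Positive eigenvalues in the sine basis\<close>

definition sine_diagonal_pos :: "nat \<Rightarrow> real mat \<Rightarrow> bool" where
  "sine_diagonal_pos n M \<longleftrightarrow> (\<exists>f. (\<forall>k<n. 0 < f k) \<and> M = sine_mat n * mat_diag n f * sine_mat n)"

lemma conj_involution_cancel:
  fixes U D :: "real mat"
  assumes U: "U \<in> carrier_mat n n" and D: "D \<in> carrier_mat n n" and UU: "U * U = 1\<^sub>m n"
  shows "U * (U * D * U) * U = D"
proof -
  have DU: "D * U \<in> carrier_mat n n" using D U by (rule mult_carrier_mat)
  have "U * (U * D * U) = U * U * (D * U)"
    unfolding assoc_mult_mat[OF U D U] by (rule assoc_mult_mat[OF U U DU, symmetric])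
  also have "\<dots> = D * U" unfolding UU using DU by (rule left_mult_one_mat)
  finally show ?thesis
    using assoc_mult_mat[OF D U U] right_mult_one_mat[OF D] by (simp only: UU)
qed

text \<open>The columns of \<open>sine_mat\<close> are orthonormal eigenvectors, so
  \<open>f k\<close> is the value of the form at the k-th column. Positivity of the eigenvalues can
  thus be read off from a form bound.\<close>

lemma sine_diag_eigenvalue_pos:
  assumes pos: "\<And>x. x \<in> carrier_vec n \<Longrightarrow> x \<noteq> 0\<^sub>v n \<Longrightarrow> 0 < bform (sine_mat n * mat_diag n f * sine_mat n) x x"
    and k: "k < n"
  shows "0 < f k"
proof -
  let ?M = "sine_mat n * mat_diag n f * sine_mat n"
  have M: "?M \<in> carrier_mat n n" by (intro mult_carrier_mat[of _ n n]) simp_all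
  define x where "x = col (sine_mat n) k"
  have x: "x \<in> carrier_vec n" by (simp add: x_def carrier_dim_vec)
  have r: "row (sine_mat n) k = x"
    unfolding x_def using k by (intro eq_vecI) (auto simp: sine_mat_sym)
  have xx: "scalar_prod x x = 1"
  proof -
    have "scalar_prod x x = (sine_mat n * sine_mat n) $$ (k, k)" using k r by (simp add: x_def)
    then show ?thesis using k by (simp add: sine_mat_square)
  qed
  have "x \<noteq> 0\<^sub>v n" using xx by auto
  from pos[OF x this] have "0 < scalar_prod x (?M *\<^sub>v x)" by (simp add: bform_def)
  also have "scalar_prod x (?M *\<^sub>v x) = (sine_mat n * ?M * sine_mat n) $$ (k, k)"
  proof -
    have "(sine_mat n * ?M * sine_mat n) $$ (k, k) = (sine_mat n * (?M * sine_mat n)) $$ (k, k)"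
      by (simp only: assoc_mult_mat[OF sine_mat_carrier M sine_mat_carrier])
    also have "\<dots> = scalar_prod (row (sine_mat n) k) (col (?M * sine_mat n) k)"
      using k by (intro index_mult_mat(1)) auto
    also have "col (?M * sine_mat n) k = ?M *\<^sub>v x"
      unfolding x_def using k by (intro col_mult2[OF M sine_mat_carrier])
    finally show ?thesis by (simp add: r)
  qed
  also have "\<dots> = f k" 
    unfolding conj_involution_cancel[OF sine_mat_carrier mat_diag_dim sine_mat_square]
    using k by (simp add: mat_diag_def)
  finally show ?thesis .
qed

lemma tau_mat_carrier [simp]: "M \<in> carrier_mat n n \<Longrightarrow> tau_mat M \<in> carrier_mat n n"
  by (auto simp: tau_mat_def Let_def)

lemma sine_diagonal_pos_tau_B_mat:
  assumes d: "0 < d" "d < 1" and kpm: "0 < kp" "0 < km"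
  shows "sine_diagonal_pos n (tau_mat (sym_part (B_mat n d kp km)))"
proof -
  have "dim_row (sym_part (B_mat n d kp km)) = n"
    by (simp add: sym_part_B_mat[OF d(1)])
  then obtain f where f: "tau_mat (sym_part (B_mat n d kp km)) = sine_mat n * mat_diag n f * sine_mat n"
    unfolding tau_mat_def Let_def by metis
  have "0 < f k" if "k < n" for k
    by (rule sine_diag_eigenvalue_pos[OF _ that]) (unfold f[symmetric], rule B_mat_form_bounds(1)[OF d kpm])
  then show ?thesis unfolding sine_diagonal_pos_def f by blast
qed

lemma A_mat_carrier [simp]: "A_mat n \<in> carrier_mat n n"
  by (simp add: A_mat_def)

text \<open>The Hankel correction involves only coefficients with index at least 2, which vanish for
  a tridiagonal matrix; hence \<open>tau_mat\<close> fixes \<open>A_mat n\<close>. The eigenvalues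
  are 6/8 plus 2/8 times a cosine, and just 6/8 for \<open>n = 1\<close>.\<close>

lemma sine_diagonal_pos_A_mat: "sine_diagonal_pos n (A_mat n)"
proof -
  define c where "c = (\<lambda>m::nat. if m = 0 then 6 / 8 else if m = 1 then 1 / 8 else 0 :: real)"
  have A: "A_mat n = mat n n (\<lambda>(i, j). c (ndist i j))"
    unfolding A_mat_def by (rule eq_matI) (auto simp: c_def ndist_def)
  have tau: "tau_mat (A_mat n) = A_mat n"
    unfolding tau_mat_toeplitz[OF A] unfolding A
    by (rule eq_matI) (auto simp: hankel_coeff_def trunc_coeff_def c_def)
  define f where "f = (\<lambda>k. A_mat n $$ (0, 0) +
         2 * (\<Sum>j = 1..n - 1. A_mat n $$ (0, j) * cos (real (j * (k + 1)) * pi / (real n + 1))))"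
  have dim: "dim_row (A_mat n) = n" by (simp add: A_mat_def)
  have M: "A_mat n = sine_mat n * mat_diag n f * sine_mat n"
  proof -
    have "tau_mat (A_mat n) = sine_mat n * mat_diag n f * sine_mat n"
      unfolding tau_mat_def Let_def dim f_def ..
    then show ?thesis unfolding tau .
  qed
  have "0 < f k" if "k < n" for k
  proof -
    define w where "w = (\<lambda>j. cos (real (j * (k + 1)) * pi / (real n + 1)))"
    have "(\<Sum>j = 1..n - 1. A_mat n $$ (0, j) * w j) = (\<Sum>j = 1..n - 1. if j = 1 then 1 / 8 * w 1 else 0)"
      using that by (intro sum.cong refl) (auto simp: A c_def ndist_def)
    also have "\<dots> = (if 1 \<in> {1..n - 1} then 1 / 8 * w 1 else 0)"
      by (simp add: sum.delta)
    finally have "f k = 6 / 8 + 2 * (if 1 \<in> {1..n - 1} then 1 / 8 * w 1 else 0)"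
      unfolding f_def w_def using that by (simp add: A c_def ndist_def)
    moreover have "- 1 \<le> w 1" by (simp add: w_def)
    ultimately show ?thesis by (simp split: if_splits)
  qed
  then show ?thesis unfolding sine_diagonal_pos_def using M by blast
qed

subsection \<open>Kronecker products\<close>

lemma sum_nat_prod:
  fixes h :: "nat \<Rightarrow> real"
  shows "(\<Sum>k<a * b. h k) = (\<Sum>i<a. \<Sum>j<b. h (i * b + j))"
proof -
  have "sum h {i * b..<i * b + b} = (\<Sum>j<b. h (i * b + j))" for i
    using sum.shift_bounds_nat_ivl[of h 0 "i * b" b] by (simp add: add.commute lessThan_atLeast0)
  then show ?thesis by (simp flip: sum.nat_group)
qed

lemma kron_dim [simp]:
  "dim_row (A \<otimes>\<^sub>m B) = dim_row A * dim_row B" "dim_col (A \<otimes>\<^sub>m B) = dim_col A * dim_col B"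
  by (simp_all add: kron_def)

lemma kron_carrier [simp]:
  "A \<in> carrier_mat a a \<Longrightarrow> B \<in> carrier_mat b b \<Longrightarrow> A \<otimes>\<^sub>m B \<in> carrier_mat (a * b) (a * b)"
  by (auto simp: kron_def)

lemma block_index_less: "i < a \<Longrightarrow> j < b \<Longrightarrow> i * b + j < a * (b::nat)"
proof -
  assume "i < a" "j < b"
  then have "i * b + j < Suc i * b" "Suc i * b \<le> a * b" by (simp, intro mult_le_mono1) simp
  then show ?thesis by linarith
qed

lemma kron_index:
  assumes "A \<in> carrier_mat a a" "B \<in> carrier_mat b b" "i < a * b" "j < a * b"
  shows "(A \<otimes>\<^sub>m B) $$ (i, j) = A $$ (i div b, j div b) * B $$ (i mod b, j mod b)"
  using assms by (auto simp: kron_def)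

lemma kron_block_index:
  assumes "A \<in> carrier_mat a a" "B \<in> carrier_mat b b" "i < a" "i' < b" "j < a" "j' < b"
  shows "(A \<otimes>\<^sub>m B) $$ (i * b + i', j * b + j') = A $$ (i, j) * B $$ (i', j')"
  using assms by (subst kron_index[OF assms(1,2)]) (auto simp: block_index_less)

lemma div_mod_less: "i < a * b \<Longrightarrow> i div b < a \<and> i mod b < (b::nat)"
  by (cases "b = 0") (auto simp: less_mult_imp_div_less)

lemma kron_eqI:
  assumes "A \<in> carrier_mat a a" "B \<in> carrier_mat b b" "M \<in> carrier_mat (a * b) (a * b)"
    and "\<And>i i' j j'. i < a \<Longrightarrow> i' < b \<Longrightarrow> j < a \<Longrightarrow> j' < b \<Longrightarrow>
      M $$ (i * b + i', j * b + j') = A $$ (i, j) * B $$ (i', j')"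
  shows "M = A \<otimes>\<^sub>m B"
proof (rule eq_matI)
  fix i j assume "i < dim_row (A \<otimes>\<^sub>m B)" "j < dim_col (A \<otimes>\<^sub>m B)"
  then have ij: "i < a * b" "j < a * b" using assms(1,2) by auto
  show "M $$ (i, j) = (A \<otimes>\<^sub>m B) $$ (i, j)"
    using assms(4)[of "i div b" "i mod b" "j div b" "j mod b"] div_mod_less[OF ij(1)] div_mod_less[OF ij(2)]
    unfolding kron_index[OF assms(1,2) ij] by simp
qed (use assms in auto)

lemma kron_mult:
  assumes "A \<in> carrier_mat a a" "B \<in> carrier_mat b b" "C \<in> carrier_mat a a" "D \<in> carrier_mat b b"
  shows "(A \<otimes>\<^sub>m B) * (C \<otimes>\<^sub>m D) = (A * C) \<otimes>\<^sub>m (B * D)"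
proof (rule kron_eqI[of _ a _ b])
  fix i i' j j' assume i: "i < a" "i' < b" and j: "j < a" "j' < b"
  note bl = block_index_less[OF i] block_index_less[OF j]
  have "((A \<otimes>\<^sub>m B) * (C \<otimes>\<^sub>m D)) $$ (i * b + i', j * b + j') =
      (\<Sum>k<a * b. (A \<otimes>\<^sub>m B) $$ (i * b + i', k) * (C \<otimes>\<^sub>m D) $$ (k, j * b + j'))"
    using bl assms by (simp add: scalar_prod_def lessThan_atLeast0)
  also have "\<dots> = (\<Sum>k<a. \<Sum>k'<b. (A $$ (i, k) * C $$ (k, j)) * (B $$ (i', k') * D $$ (k', j')))"
    unfolding sum_nat_prod using i j
    by (intro sum.cong refl)
       (simp add: kron_block_index[OF assms(1,2)] kron_block_index[OF assms(3,4)])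
  also have "\<dots> = (A * C) $$ (i, j) * (B * D) $$ (i', j')"
    unfolding sum_product[symmetric] using i j assms by (simp add: scalar_prod_def lessThan_atLeast0)
  finally show "((A \<otimes>\<^sub>m B) * (C \<otimes>\<^sub>m D)) $$ (i * b + i', j * b + j') = (A * C) $$ (i, j) * (B * D) $$ (i', j')" .
qed (use assms in \<open>auto intro!: mult_carrier_mat[of _ "a * b" "a * b"]\<close>)

lemma kron_mat_diag: "mat_diag a f \<otimes>\<^sub>m mat_diag b g = mat_diag (a * b) (\<lambda>i. f (i div b) * g (i mod b))"
proof (rule kron_eqI[symmetric, of _ a _ b])
  fix i i' j j' assume i: "i < a" "i' < b" and j: "j < a" "j' < b"
  have "i * b + i' = j * b + j' \<longleftrightarrow> i = j \<and> i' = j'"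
  proof
    assume eq: "i * b + i' = j * b + j'"
    have "(i * b + i') div b = i" "(i * b + i') mod b = i'" "(j * b + j') div b = j" "(j * b + j') mod b = j'"
      using i j by simp_all
    then show "i = j \<and> i' = j'" unfolding eq by simp
  qed simp
  then show "mat_diag (a * b) (\<lambda>i. f (i div b) * g (i mod b)) $$ (i * b + i', j * b + j') =
      mat_diag a f $$ (i, j) * mat_diag b g $$ (i', j')"
    using block_index_less[OF i] block_index_less[OF j] i j by (simp add: mat_diag_def)
qed simp_all

lemma kron_one: "1\<^sub>m a \<otimes>\<^sub>m 1\<^sub>m b = 1\<^sub>m (a * b)"
  using kron_mat_diag[of a "\<lambda>_. 1" b "\<lambda>_. 1"] by simp

lemma transpose_kron:
  assumes "A \<in> carrier_mat a a" "B \<in> carrier_mat b b"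
  shows "transpose_mat (A \<otimes>\<^sub>m B) = transpose_mat A \<otimes>\<^sub>m transpose_mat B"
proof (rule kron_eqI[of _ a _ b])
  fix i i' j j' assume i: "i < a" "i' < b" and j: "j < a" "j' < b"
  show "transpose_mat (A \<otimes>\<^sub>m B) $$ (i * b + i', j * b + j') = transpose_mat A $$ (i, j) * transpose_mat B $$ (i', j')"
    using i j assms block_index_less[OF i] block_index_less[OF j]
    by (simp add: kron_block_index[OF assms])
qed (use assms in auto)

definition sym_involution :: "nat \<Rightarrow> real mat \<Rightarrow> bool" where
  "sym_involution n U \<longleftrightarrow> U \<in> carrier_mat n n \<and> transpose_mat U = U \<and> U * U = 1\<^sub>m n"

text \<open>Generalises \<open>sine_diagonal_pos\<close> to any symmetric involution
  \<open>U\<close>, so that Kronecker products of sine matrices are covered.\<close>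

definition diagonal_pos_in :: "nat \<Rightarrow> real mat \<Rightarrow> real mat \<Rightarrow> bool" where
  "diagonal_pos_in n U M \<longleftrightarrow> (\<exists>f. (\<forall>k<n. 0 < f k) \<and> M = U * mat_diag n f * U)"

lemma sym_involution_kron:
  assumes "sym_involution a U" "sym_involution b V"
  shows "sym_involution (a * b) (U \<otimes>\<^sub>m V)"
  using assms unfolding sym_involution_def
  by (simp add: transpose_kron[of _ a _ b] kron_mult[of _ a _ b] kron_one)

lemma diagonal_pos_in_kron:
  assumes "sym_involution a U" "sym_involution b V" "diagonal_pos_in a U M" "diagonal_pos_in b V N"
  shows "diagonal_pos_in (a * b) (U \<otimes>\<^sub>m V) (M \<otimes>\<^sub>m N)"
proof -
  obtain f where f: "\<forall>k<a. 0 < f k" "M = U * mat_diag a f * U"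
    using assms(3) unfolding diagonal_pos_in_def by metis
  obtain g where g: "\<forall>k<b. 0 < g k" "N = V * mat_diag b g * V"
    using assms(4) unfolding diagonal_pos_in_def by metis
  have c: "U \<in> carrier_mat a a" "V \<in> carrier_mat b b" using assms by (auto simp: sym_involution_def)
  have c': "U * mat_diag a f \<in> carrier_mat a a" "V * mat_diag b g \<in> carrier_mat b b"
    by (rule mult_carrier_mat[OF c(1) mat_diag_dim] mult_carrier_mat[OF c(2) mat_diag_dim])+
  have eq: "M \<otimes>\<^sub>m N = (U \<otimes>\<^sub>m V) * mat_diag (a * b) (\<lambda>i. f (i div b) * g (i mod b)) * (U \<otimes>\<^sub>m V)"
    unfolding f(2) g(2) kron_mat_diag[symmetric] kron_mult[OF c mat_diag_dim mat_diag_dim] kron_mult[OF c' c] ..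
  have pos: "\<forall>k<a * b. 0 < f (k div b) * g (k mod b)"
    using f(1) g(1) div_mod_less by simp
  show ?thesis unfolding diagonal_pos_in_def by (rule exI, rule conjI[OF pos eq])
qed

lemma diagonal_pos_in_add_smult:
  assumes U: "U \<in> carrier_mat n n" and "diagonal_pos_in n U M" "diagonal_pos_in n U N" and c: "0 < c"
  shows "diagonal_pos_in n U (M + c \<cdot>\<^sub>m N)"
proof -
  obtain f where f: "\<forall>k<n. 0 < f k" "M = U * mat_diag n f * U"
    using assms(2) unfolding diagonal_pos_in_def by metis
  obtain g where g: "\<forall>k<n. 0 < g k" "N = U * mat_diag n g * U"
    using assms(3) unfolding diagonal_pos_in_def by metis
  have d: "mat_diag n (\<lambda>k. f k + c * g k) = mat_diag n f + c \<cdot>\<^sub>m mat_diag n g"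
    by (rule eq_matI) (auto simp: mat_diag_def)
  have cg: "c \<cdot>\<^sub>m mat_diag n g \<in> carrier_mat n n" by simp
  have m: "U * mat_diag n f \<in> carrier_mat n n" "U * mat_diag n g \<in> carrier_mat n n"
    "c \<cdot>\<^sub>m (U * mat_diag n g) \<in> carrier_mat n n"
    by (intro smult_carrier_mat mult_carrier_mat[OF U mat_diag_dim])+
  have eq: "M + c \<cdot>\<^sub>m N = U * mat_diag n (\<lambda>k. f k + c * g k) * U"
    unfolding d mult_add_distrib_mat[OF U mat_diag_dim cg] mult_smult_distrib[OF U mat_diag_dim]
      add_mult_distrib_mat[OF m(1,3) U] mult_smult_assoc_mat[OF m(2) U] f(2) g(2) ..
  have pos: "\<forall>k<n. 0 < f k + c * g k" using f g c by (simp add: add_pos_pos)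
  show ?thesis unfolding diagonal_pos_in_def by (rule exI, rule conjI[OF pos eq])
qed

text \<open>
  Positive semidefiniteness in the form \<open>M = W W\<^sup>T\<close>, which turns the form of \<open>M \<otimes> X\<close> into a sum of
  values of the form of \<open>X\<close>.
\<close>

definition has_gram :: "nat \<Rightarrow> real mat \<Rightarrow> bool" where
  "has_gram n M \<longleftrightarrow> M \<in> carrier_mat n n \<and>
     (\<exists>W. \<forall>i<n. \<forall>j<n. M $$ (i, j) = (\<Sum>p<n. W i p * W j p))"

lemma diagonal_pos_in_has_gram:
  assumes U: "sym_involution n U" and M: "diagonal_pos_in n U M"
  shows "has_gram n M"
proof -
  obtain f where f: "\<forall>k<n. 0 < f k" "M = U * mat_diag n f * U"
    using M unfolding diagonal_pos_in_def by metis
  have Uc: "U \<in> carrier_mat n n" and Ut: "transpose_mat U = U" using U by (auto simp: sym_involution_def)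
  have sym: "U $$ (i, j) = U $$ (j, i)" if "i < n" "j < n" for i j
    using Uc that index_transpose_mat(1)[of j U i] by (simp add: Ut)
  have "M $$ (i, j) = (\<Sum>p<n. (U $$ (i, p) * sqrt (f p)) * (U $$ (j, p) * sqrt (f p)))" if "i < n" "j < n" for i j
  proof -
    have "M $$ (i, j) = (\<Sum>p<n. U $$ (i, p) * f p * U $$ (p, j))"
      unfolding f mat_diag_mult_right[OF Uc] using Uc that by (simp add: scalar_prod_def lessThan_atLeast0)
    also have "\<dots> = (\<Sum>p<n. (U $$ (i, p) * sqrt (f p)) * (U $$ (j, p) * sqrt (f p)))"
    proof (intro sum.cong refl)
      fix p assume "p \<in> {..<n}"
      then have p: "p < n" by simp
      then have s: "f p = sqrt (f p) * sqrt (f p)" using f(1) by (simp add: less_imp_le)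
      show "U $$ (i, p) * f p * U $$ (p, j) = (U $$ (i, p) * sqrt (f p)) * (U $$ (j, p) * sqrt (f p))"
        using sym[OF p that(2)] by (subst s) (simp only: mult_ac)
    qed
    finally show ?thesis .
  qed
  moreover have "M \<in> carrier_mat n n" unfolding f by (rule mult_carrier_mat[OF mult_carrier_mat[OF Uc mat_diag_dim] Uc])
  ultimately show ?thesis unfolding has_gram_def by (intro conjI exI[of _ "\<lambda>i p. U $$ (i, p) * sqrt (f p)"]) auto
qed

lemma gram_bilinear:
  fixes u w :: "nat \<Rightarrow> real"
  assumes W: "\<And>i j. i < n \<Longrightarrow> j < n \<Longrightarrow> M $$ (i, j) = (\<Sum>p<n. W i p * W j p)"
  shows "(\<Sum>i<n. \<Sum>j<n. M $$ (i, j) * (u i * w j)) = (\<Sum>p<n. (\<Sum>i<n. u i * W i p) * (\<Sum>j<n. w j * W j p))"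
proof -
  have "(\<Sum>i<n. \<Sum>j<n. M $$ (i, j) * (u i * w j)) = (\<Sum>i<n. \<Sum>j<n. \<Sum>p<n. (u i * W i p) * (w j * W j p))"
    by (intro sum.cong refl) (simp add: W sum_distrib_right sum_distrib_left mult_ac)
  also have "\<dots> = (\<Sum>i<n. \<Sum>p<n. \<Sum>j<n. (u i * W i p) * (w j * W j p))"
    by (rule sum.cong[OF refl], rule sum.swap)
  also have "\<dots> = (\<Sum>p<n. \<Sum>i<n. \<Sum>j<n. (u i * W i p) * (w j * W j p))"
    by (rule sum.swap)
  finally show ?thesis unfolding sum_product .
qed

lemma has_gram_form:
  assumes "has_gram n M"
  obtains L where "\<And>x y. x \<in> carrier_vec n \<Longrightarrow> y \<in> carrier_vec n \<Longrightarrow> bform M x y = (\<Sum>p<n. L x p * L y p)"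
proof -
  obtain W where W: "\<And>i j. i < n \<Longrightarrow> j < n \<Longrightarrow> M $$ (i, j) = (\<Sum>p<n. W i p * W j p)"
    and M: "M \<in> carrier_mat n n" using assms unfolding has_gram_def by blast
  show thesis
    by (rule that[of "\<lambda>x p. \<Sum>i<n. vec_index x i * W i p"])
       (simp only: bform_sum[OF M] gram_bilinear[OF W])
qed

text \<open>\<open>L p x\<close> contracts the left block index of \<open>x\<close> with the p-th
  column of a Gram factor of \<open>A\<close>. Since \<open>q\<close> and \<open>L\<close> do not
  depend on \<open>X\<close>, the same vectors serve two matrices that are to be compared.\<close>

lemma bform_kron_left:
  assumes A: "has_gram a A"
  obtains q :: nat and L where
    "\<And>p x. L p x \<in> carrier_vec b"
    "\<And>X x y. X \<in> carrier_mat b b \<Longrightarrow> x \<in> carrier_vec (a * b) \<Longrightarrow> y \<in> carrier_vec (a * b) \<Longrightarrow>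
       bform (A \<otimes>\<^sub>m X) x y = (\<Sum>p<q. bform X (L p x) (L p y))"
proof -
  obtain W where W: "\<And>i j. i < a \<Longrightarrow> j < a \<Longrightarrow> A $$ (i, j) = (\<Sum>p<a. W i p * W j p)"
    and Ac: "A \<in> carrier_mat a a" using A unfolding has_gram_def by blast
  have gram: "(\<Sum>i<a. \<Sum>j<a. A $$ (i, j) * (u i * w j)) = (\<Sum>p<a. (\<Sum>i<a. u i * W i p) * (\<Sum>j<a. w j * W j p))" for u w
    by (rule gram_bilinear) (rule W)
  define l where "l x i' p = (\<Sum>i<a. vec_index x (i * b + i') * W i p)" for x i' p
  define L where "L p x = vec b (\<lambda>i'. l x i' p)" for p x
  show thesis
  proof (rule that[of L a])
    show "L p x \<in> carrier_vec b" for p x by (simp add: L_def)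
    fix X :: "real mat" and x y :: "real vec"
    assume X: "X \<in> carrier_mat b b" and xy: "x \<in> carrier_vec (a * b)" "y \<in> carrier_vec (a * b)"
    have "bform (A \<otimes>\<^sub>m X) x y = (\<Sum>i<a. \<Sum>i'<b. \<Sum>j<a. \<Sum>j'<b.
        X $$ (i', j') * (A $$ (i, j) * (vec_index x (i * b + i') * vec_index y (j * b + j'))))"
      unfolding bform_sum[OF kron_carrier[OF Ac X] xy] sum_nat_prod
      by (intro sum.cong refl) (simp add: kron_block_index[OF Ac X])
    also have "\<dots> = (\<Sum>i'<b. \<Sum>j'<b. \<Sum>i<a. \<Sum>j<a.
        X $$ (i', j') * (A $$ (i, j) * (vec_index x (i * b + i') * vec_index y (j * b + j'))))"
      by (simp only: sum.swap[of _ "{..<b}" "{..<a}"])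
    also have "\<dots> = (\<Sum>i'<b. \<Sum>j'<b. X $$ (i', j') * (\<Sum>p<a. l x i' p * l y j' p))"
      unfolding sum_distrib_left[symmetric] gram l_def ..
    also have "\<dots> = (\<Sum>p<a. \<Sum>i'<b. \<Sum>j'<b. X $$ (i', j') * (l x i' p * l y j' p))"
      by (simp only: sum_distrib_left sum.swap[of _ "{..<b}" "{..<a}"])
    also have "\<dots> = (\<Sum>p<a. bform X (L p x) (L p y))"
      by (intro sum.cong refl) (simp add: bform_sum[OF X] L_def)
    finally show "bform (A \<otimes>\<^sub>m X) x y = (\<Sum>p<a. bform X (L p x) (L p y))" .
  qed
qed

text \<open>Mirror image: the right block index is contracted.\<close>

lemma bform_kron_right:
  assumes A: "has_gram b A"
  obtains q :: nat and L where
    "\<And>p x. L p x \<in> carrier_vec a"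
    "\<And>X x y. X \<in> carrier_mat a a \<Longrightarrow> x \<in> carrier_vec (a * b) \<Longrightarrow> y \<in> carrier_vec (a * b) \<Longrightarrow>
       bform (X \<otimes>\<^sub>m A) x y = (\<Sum>p<q. bform X (L p x) (L p y))"
proof -
  obtain W where W: "\<And>i j. i < b \<Longrightarrow> j < b \<Longrightarrow> A $$ (i, j) = (\<Sum>p<b. W i p * W j p)"
    and Ac: "A \<in> carrier_mat b b" using A unfolding has_gram_def by blast
  have gram: "(\<Sum>i<b. \<Sum>j<b. A $$ (i, j) * (u i * w j)) = (\<Sum>p<b. (\<Sum>i<b. u i * W i p) * (\<Sum>j<b. w j * W j p))" for u w
    by (rule gram_bilinear) (rule W)
  define l where "l x i p = (\<Sum>i'<b. vec_index x (i * b + i') * W i' p)" for x i p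
  define L where "L p x = vec a (\<lambda>i. l x i p)" for p x
  show thesis
  proof (rule that[of L b])
    show "L p x \<in> carrier_vec a" for p x by (simp add: L_def)
    fix X :: "real mat" and x y :: "real vec"
    assume X: "X \<in> carrier_mat a a" and xy: "x \<in> carrier_vec (a * b)" "y \<in> carrier_vec (a * b)"
    have "bform (X \<otimes>\<^sub>m A) x y = (\<Sum>i<a. \<Sum>i'<b. \<Sum>j<a. \<Sum>j'<b.
        X $$ (i, j) * (A $$ (i', j') * (vec_index x (i * b + i') * vec_index y (j * b + j'))))"
      unfolding bform_sum[OF kron_carrier[OF X Ac] xy] sum_nat_prod
      by (intro sum.cong refl) (simp add: kron_block_index[OF X Ac])
    also have "\<dots> = (\<Sum>i<a. \<Sum>j<a. \<Sum>i'<b. \<Sum>j'<b.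
        X $$ (i, j) * (A $$ (i', j') * (vec_index x (i * b + i') * vec_index y (j * b + j'))))"
      by (simp only: sum.swap[of _ "{..<b}" "{..<a}"])
    also have "\<dots> = (\<Sum>i<a. \<Sum>j<a. X $$ (i, j) * (\<Sum>p<b. l x i p * l y j p))"
      unfolding sum_distrib_left[symmetric] gram l_def ..
    also have "\<dots> = (\<Sum>p<b. \<Sum>i<a. \<Sum>j<a. X $$ (i, j) * (l x i p * l y j p))"
      by (simp only: sum_distrib_left sum.swap[of _ "{..<a}" "{..<b}"])
    also have "\<dots> = (\<Sum>p<b. bform X (L p x) (L p y))"
      by (intro sum.cong refl) (simp add: bform_sum[OF X] L_def)
    finally show "bform (X \<otimes>\<^sub>m A) x y = (\<Sum>p<b. bform X (L p x) (L p y))" .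
  qed
qed

text \<open>The skew bound has a sum, not a geometric mean, of form values on its right-hand side,
  so it adds up over the terms of a Kronecker form and over weighted sums of matrices. The product
  version is recovered by scaling one vector in \<open>form_controlled_gmres_bound\<close>.\<close>

definition form_controlled :: "nat \<Rightarrow> real \<Rightarrow> real mat \<Rightarrow> real mat \<Rightarrow> bool" where
  "form_controlled n s B C \<longleftrightarrow> B \<in> carrier_mat n n \<and> C \<in> carrier_mat n n \<and>
     (\<forall>x\<in>carrier_vec n. 1 / 2 * bform C x x \<le> bform B x x \<and> bform B x x \<le> 3 / 2 * bform C x x) \<and>
     (\<forall>x\<in>carrier_vec n. \<forall>y\<in>carrier_vec n. \<bar>bform B x y - bform B y x\<bar> \<le> s * (bform C x x + bform C y y))"

lemma form_controlled_sum:
  assumes "form_controlled m s B C" "B' \<in> carrier_mat n n" "C' \<in> carrier_mat n n"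
    and L: "\<And>p x. L p x \<in> carrier_vec m"
    and eB: "\<And>x y. x \<in> carrier_vec n \<Longrightarrow> y \<in> carrier_vec n \<Longrightarrow> bform B' x y = (\<Sum>p<(q::nat). bform B (L p x) (L p y))"
    and eC: "\<And>x y. x \<in> carrier_vec n \<Longrightarrow> y \<in> carrier_vec n \<Longrightarrow> bform C' x y = (\<Sum>p<q. bform C (L p x) (L p y))"
  shows "form_controlled n s B' C'"
proof -
  have 1: "1 / 2 * bform C' x x \<le> bform B' x x \<and> bform B' x x \<le> 3 / 2 * bform C' x x" if "x \<in> carrier_vec n" for x
    unfolding eB[OF that that] eC[OF that that] sum_distrib_left
    by (intro conjI sum_mono) (use assms(1) L in \<open>auto simp: form_controlled_def\<close>)
  have 2: "\<bar>bform B' x y - bform B' y x\<bar> \<le> s * (bform C' x x + bform C' y y)"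
    if "x \<in> carrier_vec n" "y \<in> carrier_vec n" for x y
  proof -
    have "\<bar>bform B' x y - bform B' y x\<bar> \<le> (\<Sum>p<q. \<bar>bform B (L p x) (L p y) - bform B (L p y) (L p x)\<bar>)"
      unfolding eB[OF that] eB[OF that(2,1)] sum_subtractf[symmetric] by (rule sum_abs)
    also have "\<dots> \<le> (\<Sum>p<q. s * (bform C (L p x) (L p x) + bform C (L p y) (L p y)))"
      using assms(1) L by (intro sum_mono) (simp add: form_controlled_def)
    finally show ?thesis
      unfolding eC[OF that(1) that(1)] eC[OF that(2) that(2)] sum.distrib[symmetric] sum_distrib_left .
  qed
  show ?thesis unfolding form_controlled_def using 1 2 assms(2,3) by blast
qed

lemma form_controlled_kron_left:
  assumes "has_gram a A" "form_controlled b s B C"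
  shows "form_controlled (a * b) s (A \<otimes>\<^sub>m B) (A \<otimes>\<^sub>m C)"
proof -
  have c: "A \<in> carrier_mat a a" "B \<in> carrier_mat b b" "C \<in> carrier_mat b b"
    using assms by (auto simp: has_gram_def form_controlled_def)
  show ?thesis
  proof (rule bform_kron_left[OF assms(1), where b = b])
    fix q :: nat and L
    assume L: "\<And>p x. L p x \<in> carrier_vec b"
      and eq: "\<And>X x y. X \<in> carrier_mat b b \<Longrightarrow> x \<in> carrier_vec (a * b) \<Longrightarrow> y \<in> carrier_vec (a * b) \<Longrightarrow>
        bform (A \<otimes>\<^sub>m X) x y = (\<Sum>p<q. bform X (L p x) (L p y))"
    show ?thesis
      by (rule form_controlled_sum[OF assms(2) kron_carrier[OF c(1,2)] kron_carrier[OF c(1,3)] L eq[OF c(2)] eq[OF c(3)]])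
  qed
qed

lemma form_controlled_kron_right:
  assumes "has_gram b A" "form_controlled a s B C"
  shows "form_controlled (a * b) s (B \<otimes>\<^sub>m A) (C \<otimes>\<^sub>m A)"
proof -
  have c: "A \<in> carrier_mat b b" "B \<in> carrier_mat a a" "C \<in> carrier_mat a a"
    using assms by (auto simp: has_gram_def form_controlled_def)
  show ?thesis
  proof (rule bform_kron_right[OF assms(1), where a = a])
    fix q :: nat and L
    assume L: "\<And>p x. L p x \<in> carrier_vec a"
      and eq: "\<And>X x y. X \<in> carrier_mat a a \<Longrightarrow> x \<in> carrier_vec (a * b) \<Longrightarrow> y \<in> carrier_vec (a * b) \<Longrightarrow>
        bform (X \<otimes>\<^sub>m A) x y = (\<Sum>p<q. bform X (L p x) (L p y))"
    show ?thesis
      by (rule form_controlled_sum[OF assms(2) kron_carrier[OF c(2,1)] kron_carrier[OF c(3,1)] L eq[OF c(2)] eq[OF c(3)]])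
  qed
qed

lemma form_controlled_add_smult:
  assumes 1: "form_controlled n s B C" and 2: "form_controlled n s B' C'" and c: "0 < c"
  shows "form_controlled n s (B + c \<cdot>\<^sub>m B') (C + c \<cdot>\<^sub>m C')"
proof -
  have car: "B \<in> carrier_mat n n" "C \<in> carrier_mat n n" "B' \<in> carrier_mat n n" "C' \<in> carrier_mat n n"
    using 1 2 by (auto simp: form_controlled_def)
  have lin: "bform (X + c \<cdot>\<^sub>m Y) x y = bform X x y + c * bform Y x y"
    if "X \<in> carrier_mat n n" "Y \<in> carrier_mat n n" "x \<in> carrier_vec n" "y \<in> carrier_vec n" for X Y x y
    using that by (simp add: bform_add[of _ n] bform_smult[of _ n])
  have a: "1 / 2 * bform (C + c \<cdot>\<^sub>m C') x x \<le> bform (B + c \<cdot>\<^sub>m B') x x \<and>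
      bform (B + c \<cdot>\<^sub>m B') x x \<le> 3 / 2 * bform (C + c \<cdot>\<^sub>m C') x x" if x: "x \<in> carrier_vec n" for x
  proof -
    have "1 / 2 * bform C x x \<le> bform B x x" "bform B x x \<le> 3 / 2 * bform C x x"
      using 1 x by (auto simp: form_controlled_def)
    moreover have "c * (1 / 2 * bform C' x x) \<le> c * bform B' x x" "c * bform B' x x \<le> c * (3 / 2 * bform C' x x)"
      using 2 x c by (auto simp: form_controlled_def)
    ultimately show ?thesis using car x by (simp add: lin)
  qed
  have b: "\<bar>bform (B + c \<cdot>\<^sub>m B') x y - bform (B + c \<cdot>\<^sub>m B') y x\<bar>
      \<le> s * (bform (C + c \<cdot>\<^sub>m C') x x + bform (C + c \<cdot>\<^sub>m C') y y)"
    if x: "x \<in> carrier_vec n" and y: "y \<in> carrier_vec n" for x y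
  proof -
    have "\<bar>bform B x y - bform B y x\<bar> \<le> s * (bform C x x + bform C y y)"
      using 1 x y by (auto simp: form_controlled_def)
    moreover have "c * \<bar>bform B' x y - bform B' y x\<bar> \<le> c * (s * (bform C' x x + bform C' y y))"
      using 2 x y c by (auto simp: form_controlled_def)
    moreover have "\<bar>bform (B + c \<cdot>\<^sub>m B') x y - bform (B + c \<cdot>\<^sub>m B') y x\<bar>
        \<le> \<bar>bform B x y - bform B y x\<bar> + c * \<bar>bform B' x y - bform B' y x\<bar>"
    proof -
      have "bform (B + c \<cdot>\<^sub>m B') x y - bform (B + c \<cdot>\<^sub>m B') y x =
          (bform B x y - bform B y x) + c * (bform B' x y - bform B' y x)"
        using car x y by (simp add: lin algebra_simps)
      then show ?thesis using abs_triangle_ineq[of "bform B x y - bform B y x" "c * (bform B' x y - bform B' y x)"] c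
        by (simp add: abs_mult)
    qed
    ultimately have "\<bar>bform (B + c \<cdot>\<^sub>m B') x y - bform (B + c \<cdot>\<^sub>m B') y x\<bar>
        \<le> s * (bform C x x + bform C y y) + c * (s * (bform C' x x + bform C' y y))" by linarith
    also have "\<dots> = s * (bform (C + c \<cdot>\<^sub>m C') x x + bform (C + c \<cdot>\<^sub>m C') y y)"
      using car x y by (simp add: lin algebra_simps)
    finally show ?thesis .
  qed
  show ?thesis unfolding form_controlled_def using a b car by (auto intro!: add_carrier_mat)
qed

text \<open>Serves the term without fractional factor, which the system and the preconditioner
  share.\<close>

lemma form_controlled_refl:
  assumes "has_gram n A" "0 \<le> s"
  shows "form_controlled n s A A"
proof (rule has_gram_form[OF assms(1)])
  fix L
  assume L: "\<And>x y. x \<in> carrier_vec n \<Longrightarrow> y \<in> carrier_vec n \<Longrightarrow> bform A x y = (\<Sum>p<n. L x p * L y p)"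
  have nn: "0 \<le> bform A x x" if "x \<in> carrier_vec n" for x
    unfolding L[OF that that] by (intro sum_nonneg) simp
  moreover have "bform A x y = bform A y x" if "x \<in> carrier_vec n" "y \<in> carrier_vec n" for x y
    unfolding L[OF that] L[OF that(2,1)] by (simp add: mult.commute)
  ultimately show ?thesis using assms unfolding form_controlled_def has_gram_def by auto
qed

subsection \<open>Square roots of positive definite matrices\<close>

lemma bform_conj:
  assumes M: "M \<in> carrier_mat n n" and U: "U \<in> carrier_mat n n" and Ut: "transpose_mat U = U"
    and x: "x \<in> carrier_vec n" and y: "y \<in> carrier_vec n"
  shows "bform (U * M * U) x y = bform M (U *\<^sub>v x) (U *\<^sub>v y)"
proof -
  have Uy: "U *\<^sub>v y \<in> carrier_vec n" and MUy: "M *\<^sub>v (U *\<^sub>v y) \<in> carrier_vec n"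
    by (rule mult_mat_vec_carrier[OF U y] mult_mat_vec_carrier[OF M mult_mat_vec_carrier[OF U y]])+
  have "(U * M * U) *\<^sub>v y = U *\<^sub>v (M *\<^sub>v (U *\<^sub>v y))"
    unfolding assoc_mult_mat_vec[OF mult_carrier_mat[OF U M] U y] by (rule assoc_mult_mat_vec[OF U M Uy])
  then show ?thesis
    unfolding bform_def using transpose_vec_mult_scalar[OF U MUy x] by (simp add: Ut)
qed

lemma scalar_prod_self_pos:
  fixes x :: "real vec"
  assumes "x \<in> carrier_vec n" "x \<noteq> 0\<^sub>v n"
  shows "0 < scalar_prod x x"
proof -
  obtain k where k: "k < n" "vec_index x k \<noteq> 0"
    by (rule vec_index_nonzero_ex[OF assms])
  have "0 < (\<Sum>i<n. vec_index x i * vec_index x i)"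
    by (rule sum_pos2[of _ k]) (use k in \<open>auto simp: zero_less_mult_iff linorder_neq_iff\<close>)
  then show ?thesis using assms by (simp add: scalar_prod_def lessThan_atLeast0)
qed

lemma bform_one: "x \<in> carrier_vec n \<Longrightarrow> y \<in> carrier_vec n \<Longrightarrow> bform (1\<^sub>m n) x y = scalar_prod x y"
  by (simp add: bform_def)

lemma bform_mat_diag:
  assumes "x \<in> carrier_vec n" "y \<in> carrier_vec n"
  shows "bform (mat_diag n f) x y = (\<Sum>i<n. f i * (vec_index x i * vec_index y i))"
proof -
  have "bform (mat_diag n f) x y = (\<Sum>i<n. \<Sum>j<n. if j = i then f i * (vec_index x i * vec_index y i) else 0)"
    unfolding bform_sum[OF mat_diag_dim assms] by (intro sum.cong refl) (simp add: mat_diag_def)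
  then show ?thesis by simp
qed

lemma spd_mat_diagonal_pos_in:
  assumes U: "sym_involution n U" and f: "\<And>k. k < n \<Longrightarrow> 0 < f k"
  shows "spd_mat n (U * mat_diag n f * U)"
proof -
  have Uc: "U \<in> carrier_mat n n" and Ut: "transpose_mat U = U" and UU: "U * U = 1\<^sub>m n"
    using U by (auto simp: sym_involution_def)
  note UD = mult_carrier_mat[OF Uc mat_diag_dim]
  have Dt: "transpose_mat (mat_diag n f) = mat_diag n f"
    by (rule eq_matI) (auto simp: mat_diag_def)
  have "transpose_mat (U * mat_diag n f * U) = U * (mat_diag n f * U)"
    unfolding transpose_mult[OF UD Uc] transpose_mult[OF Uc mat_diag_dim] Ut Dt ..
  also have "\<dots> = U * mat_diag n f * U" by (rule assoc_mult_mat[OF Uc mat_diag_dim Uc, symmetric])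
  finally have "transpose_mat (U * mat_diag n f * U) = U * mat_diag n f * U" .
  moreover have "0 < scalar_prod x ((U * mat_diag n f * U) *\<^sub>v x)" if x: "x \<in> carrier_vec n" "x \<noteq> 0\<^sub>v n" for x
  proof -
    define z where "z = U *\<^sub>v x"
    have z: "z \<in> carrier_vec n" unfolding z_def by (rule mult_mat_vec_carrier[OF Uc x(1)])
    have Uz: "U *\<^sub>v z = x"
      unfolding z_def assoc_mult_mat_vec[OF Uc Uc x(1), symmetric] UU using x(1) by simp
    have "U *\<^sub>v 0\<^sub>v n = 0\<^sub>v n" using Uc by (intro eq_vecI) auto
    then have "z \<noteq> 0\<^sub>v n" using Uz x(2) by auto
    obtain k where k: "k < n" "vec_index z k \<noteq> 0"
      by (rule vec_index_nonzero_ex[OF z \<open>z \<noteq> 0\<^sub>v n\<close>])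
    have "0 < (\<Sum>i<n. f i * (vec_index z i * vec_index z i))"
    proof (rule sum_pos2[of _ k])
      have "0 < vec_index z k * vec_index z k" using k(2) by (auto simp: zero_less_mult_iff linorder_neq_iff)
      then show "0 < f k * (vec_index z k * vec_index z k)" using f[OF k(1)] by simp
      show "0 \<le> f i * (vec_index z i * vec_index z i)" if "i \<in> {..<n}" for i
        using f[of i] that by simp
    qed (use k in auto)
    then show ?thesis
      unfolding bform_def[symmetric] bform_conj[OF mat_diag_dim Uc Ut x(1) x(1)] z_def[symmetric]
        bform_mat_diag[OF z z] .
  qed
  ultimately show ?thesis unfolding spd_mat_def using mult_carrier_mat[OF UD Uc] by blast
qed

lemma spd_mat_pos: "spd_mat n R \<Longrightarrow> x \<in> carrier_vec n \<Longrightarrow> x \<noteq> 0\<^sub>v n \<Longrightarrow> 0 < scalar_prod x (R *\<^sub>v x)"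
  by (simp add: spd_mat_def)

lemma spd_mat_nonneg:
  assumes "spd_mat n R" "x \<in> carrier_vec n"
  shows "0 \<le> scalar_prod x (R *\<^sub>v x)"
  using assms by (cases "x = 0\<^sub>v n") (auto simp: spd_mat_def less_imp_le)

lemma index_mult_sum:
  fixes A B :: "real mat"
  assumes "A \<in> carrier_mat n n" "B \<in> carrier_mat n n" "i < n" "j < n"
  shows "(A * B) $$ (i, j) = (\<Sum>k<n. A $$ (i, k) * B $$ (k, j))"
  using assms by (simp add: scalar_prod_def lessThan_atLeast0)

text \<open>
  With \<open>D = R - R'\<close> one has \<open>R D + D R' = R\<^sup>2 - R'\<^sup>2 = 0\<close>; taking the trace of \<open>D (R D + D R')\<close>
  gives \<open>\<Sum>\<^sub>i (D e\<^sub>i \<bullet> R D e\<^sub>i + D e\<^sub>i \<bullet> R' D e\<^sub>i) = 0\<close>, so every column of \<open>D\<close> vanishes.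
\<close>

lemma spd_mat_square_unique:
  assumes R: "spd_mat n R" and R': "spd_mat n R'" and eq: "R * R = R' * R'"
  shows "R = R'"
proof -
  have Rc: "R \<in> carrier_mat n n" "R' \<in> carrier_mat n n" using R R' by (auto simp: spd_mat_def)
  define D where "D = R - R'"
  have Dc: "D \<in> carrier_mat n n" using Rc by (auto simp: D_def intro: minus_carrier_mat)
  have sym: "M $$ (i, j) = M $$ (j, i)" if "spd_mat n M" "i < n" "j < n" for M i j
    using that index_transpose_mat(1)[of j M i] by (auto simp: spd_mat_def)
  have Dsym: "D $$ (i, j) = D $$ (j, i)" if "i < n" "j < n" for i j
    using sym[OF R that] sym[OF R' that] that Rc by (simp add: D_def)
  have zero: "(R * D) $$ (k, i) + (D * R') $$ (k, i) = 0" if "k < n" "i < n" for k i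
  proof -
    have "(R * D) $$ (k, i) + (D * R') $$ (k, i) = (R * R) $$ (k, i) - (R' * R') $$ (k, i)"
      unfolding index_mult_sum[OF Rc(1) Dc that] index_mult_sum[OF Dc Rc(2) that]
        index_mult_sum[OF Rc(1,1) that] index_mult_sum[OF Rc(2,2) that] sum.distrib[symmetric] sum_subtractf[symmetric]
      by (intro sum.cong refl) (use Rc that in \<open>simp add: D_def algebra_simps\<close>)
    then show ?thesis by (simp add: eq)
  qed
  have quad: "(\<Sum>i<n. scalar_prod (col D i) (M *\<^sub>v col D i)) = (\<Sum>i<n. \<Sum>k<n. D $$ (i, k) * (M * D) $$ (k, i))"
    if M: "M \<in> carrier_mat n n" for M
  proof (intro sum.cong refl)
    fix i assume "i \<in> {..<n}"
    then have i: "i < n" by simp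
    have "scalar_prod (col D i) (col (M * D) i) = (\<Sum>k<n. vec_index (col D i) k * vec_index (col (M * D) i) k)"
      using M Dc by (simp only: scalar_prod_def lessThan_atLeast0 dim_col index_mult_mat carrier_matD)
    also have "\<dots> = (\<Sum>k<n. D $$ (i, k) * (M * D) $$ (k, i))"
    proof (intro sum.cong refl)
      fix k assume "k \<in> {..<n}"
      then show "vec_index (col D i) k * vec_index (col (M * D) i) k = D $$ (i, k) * (M * D) $$ (k, i)"
        using i M Dc by (simp only: index_col carrier_matD index_mult_mat(2,3) lessThan_iff Dsym[of k i])
    qed
    finally show "scalar_prod (col D i) (M *\<^sub>v col D i) = (\<Sum>k<n. D $$ (i, k) * (M * D) $$ (k, i))"
      unfolding col_mult2[OF M Dc i] .
  qed
  have "(\<Sum>i<n. \<Sum>k<n. D $$ (i, k) * (R' * D) $$ (k, i)) = (\<Sum>i<n. \<Sum>k<n. D $$ (i, k) * (D * R') $$ (k, i))"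
  proof -
    have tr: "(R' * D) $$ (k, i) = (D * R') $$ (i, k)" if "i < n" "k < n" for i k
      unfolding index_mult_sum[OF Rc(2) Dc that(2,1)] index_mult_sum[OF Dc Rc(2) that]
    proof (intro sum.cong refl)
      fix l assume "l \<in> {..<n}"
      then have l: "l < n" by simp
      show "R' $$ (k, l) * D $$ (l, i) = D $$ (i, l) * R' $$ (l, k)"
        unfolding Dsym[OF l that(1)] sym[OF R' that(2) l] by (rule mult.commute)
    qed
    have "(\<Sum>i<n. \<Sum>k<n. D $$ (i, k) * (R' * D) $$ (k, i)) = (\<Sum>i<n. \<Sum>k<n. D $$ (k, i) * (D * R') $$ (i, k))"
    proof (intro sum.cong refl)
      fix i k assume "i \<in> {..<n}" "k \<in> {..<n}"
      then have ik: "i < n" "k < n" by simp_all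
      show "D $$ (i, k) * (R' * D) $$ (k, i) = D $$ (k, i) * (D * R') $$ (i, k)"
        unfolding tr[OF ik] Dsym[OF ik] ..
    qed
    also have "\<dots> = (\<Sum>i<n. \<Sum>k<n. D $$ (i, k) * (D * R') $$ (k, i))"
      by (rule sum.swap)
    finally show ?thesis .
  qed
  then have "(\<Sum>i<n. scalar_prod (col D i) (R *\<^sub>v col D i)) + (\<Sum>i<n. scalar_prod (col D i) (R' *\<^sub>v col D i))
      = (\<Sum>i<n. \<Sum>k<n. D $$ (i, k) * ((R * D) $$ (k, i) + (D * R') $$ (k, i)))"
    unfolding quad[OF Rc(1)] quad[OF Rc(2)] by (simp only: sum.distrib distrib_left)
  also have "\<dots> = 0"
    by (intro sum.neutral ballI) (simp only: zero lessThan_iff mult_zero_right)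
  finally have s: "(\<Sum>i<n. scalar_prod (col D i) (R *\<^sub>v col D i)) + (\<Sum>i<n. scalar_prod (col D i) (R' *\<^sub>v col D i)) = 0" .
  have cD: "col D i \<in> carrier_vec n" for i
    by (rule carrier_vecI) (use Dc in simp)
  have "0 \<le> (\<Sum>i<n. scalar_prod (col D i) (R *\<^sub>v col D i))" "0 \<le> (\<Sum>i<n. scalar_prod (col D i) (R' *\<^sub>v col D i))"
    by (intro sum_nonneg spd_mat_nonneg[OF R cD] spd_mat_nonneg[OF R' cD])+
  with s have S: "(\<Sum>i<n. scalar_prod (col D i) (R *\<^sub>v col D i)) = 0"
    by (simp only: add_nonneg_eq_0_iff)
  have eq0: "scalar_prod (col D i) (R *\<^sub>v col D i) = 0" if "i < n" for i
    by (rule sum_nonneg_0[OF finite_lessThan _ S]) (use that in \<open>simp_all add: spd_mat_nonneg[OF R cD]\<close>)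
  have col: "col D i = 0\<^sub>v n" if "i < n" for i
  proof (rule ccontr)
    assume "col D i \<noteq> 0\<^sub>v n"
    then have "0 < scalar_prod (col D i) (R *\<^sub>v col D i)"
      by (rule spd_mat_pos[OF R cD])
    with eq0[OF that] show False by simp
  qed
  show ?thesis
  proof (rule eq_matI)
    fix i j assume "i < dim_row R'" "j < dim_col R'"
    then have ij: "i < n" "j < n" using Rc by auto
    have "vec_index (col D j) i = 0" using col[OF ij(2)] ij by simp
    then show "R $$ (i, j) = R' $$ (i, j)" using ij Rc Dc by (simp add: D_def)
  qed (use Rc in auto)
qed

text \<open>\<open>spd_sqrt\<close> is a definite description: U diag (sqrt f) U shows that a root
  exists, \<open>spd_mat_square_unique\<close> that it is the one described. The explicit inverse
  makes it a unit, so \<open>mat_inverse\<close> cannot return \<open>None\<close>.\<close>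

lemma inv_sqrt_mat_properties:
  assumes U: "sym_involution n U" and P: "diagonal_pos_in n U P"
  defines "Q \<equiv> inv_sqrt_mat P"
  shows "Q \<in> carrier_mat n n" "transpose_mat Q = Q" "Q * P * Q = 1\<^sub>m n"
proof -
  have Uc: "U \<in> carrier_mat n n" and Ut: "transpose_mat U = U" and UU: "U * U = 1\<^sub>m n"
    using U by (auto simp: sym_involution_def)
  obtain f where f: "\<forall>k<n. 0 < f k" "P = U * mat_diag n f * U"
    using P unfolding diagonal_pos_in_def by metis
  have conj: "(U * mat_diag n g * U) * (U * mat_diag n h * U) = U * mat_diag n (\<lambda>k. g k * h k) * U" for g h
  proof -
    note Ug = mult_carrier_mat[OF Uc mat_diag_dim, of g] and hU = mult_carrier_mat[OF mat_diag_dim Uc, of h]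
    have "(U * mat_diag n g * U) * (U * mat_diag n h * U) = U * mat_diag n g * (U * (U * (mat_diag n h * U)))"
      unfolding assoc_mult_mat[OF Uc mat_diag_dim Uc, of h]
      by (rule assoc_mult_mat[OF Ug Uc mult_carrier_mat[OF Uc hU]])
    also have "U * (U * (mat_diag n h * U)) = mat_diag n h * U"
      unfolding assoc_mult_mat[OF Uc Uc hU, symmetric] UU by (rule left_mult_one_mat[OF hU])
    also have "U * mat_diag n g * (mat_diag n h * U) = U * mat_diag n g * mat_diag n h * U"
      by (rule assoc_mult_mat[OF Ug mat_diag_dim Uc, symmetric])
    also have "U * mat_diag n g * mat_diag n h = U * mat_diag n (\<lambda>k. g k * h k)"
      unfolding assoc_mult_mat[OF Uc mat_diag_dim mat_diag_dim] mat_diag_diag ..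
    finally show ?thesis .
  qed
  have one: "U * mat_diag n g * U = 1\<^sub>m n" if "\<And>k. k < n \<Longrightarrow> g k = 1" for g
  proof -
    have "mat_diag n g = 1\<^sub>m n" by (rule eq_matI) (auto simp: mat_diag_def that)
    then show ?thesis using Uc UU by simp
  qed
  define R where "R = U * mat_diag n (\<lambda>k. sqrt (f k)) * U"
  define R1 where "R1 = U * mat_diag n (\<lambda>k. 1 / sqrt (f k)) * U"
  have Rc: "R \<in> carrier_mat n n" "R1 \<in> carrier_mat n n" unfolding R_def R1_def
    by (rule mult_carrier_mat[OF mult_carrier_mat[OF Uc mat_diag_dim] Uc])+
  have Rspd: "spd_mat n R" unfolding R_def using f(1) by (intro spd_mat_diagonal_pos_in[OF U]) simp
  have RR: "R * R = P"
  proof -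
    have "mat_diag n (\<lambda>k. sqrt (f k) * sqrt (f k)) = mat_diag n f"
      by (rule eq_matI) (use f(1) in \<open>auto simp: mat_diag_def less_imp_le\<close>)
    then show ?thesis unfolding R_def conj f(2) by simp
  qed
  have RR1: "R * R1 = 1\<^sub>m n" "R1 * R = 1\<^sub>m n"
    unfolding R_def R1_def conj using f(1) by (auto intro!: one)
  have Pc: "P \<in> carrier_mat n n" unfolding RR[symmetric] by (rule mult_carrier_mat[OF Rc(1,1)])
  have dim: "dim_row P = n" using Pc by simp
  have "spd_sqrt P = R"
    unfolding spd_sqrt_def dim
    by (rule the_equality) (auto simp: Rspd RR intro!: spd_mat_square_unique[of n _ R])
  moreover have "R \<in> Units (ring_mat TYPE(real) n ())"
    unfolding Units_def ring_mat_simps using Rc RR1 by auto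
  then obtain Q' where Q': "mat_inverse R = Some Q'"
    using mat_inverse(1)[OF Rc(1), where b = "()"] by (cases "mat_inverse R") auto
  ultimately have "Q = Q'" by (simp add: Q_def inv_sqrt_mat_def)
  then have Q: "R * Q = 1\<^sub>m n" "Q * R = 1\<^sub>m n" "Q \<in> carrier_mat n n"
    using mat_inverse(2)[OF Rc(1) Q'] by auto
  show "Q \<in> carrier_mat n n" by (rule Q(3))
  have Rt: "transpose_mat R = R" using Rspd by (simp add: spd_mat_def)
  have Qt: "transpose_mat Q \<in> carrier_mat n n" using Q(3) by simp
  have "transpose_mat Q * R = 1\<^sub>m n"
    using transpose_mult[OF Rc(1) Q(3)] by (simp add: Q(1) Rt)
  then have "transpose_mat Q * R * Q = Q" using Q(3) by simp
  then show "transpose_mat Q = Q"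
    unfolding assoc_mult_mat[OF Qt Rc(1) Q(3)] Q(1) right_mult_one_mat[OF Qt] .
  have "Q * P * Q = (Q * R) * R * Q"
    unfolding RR[symmetric] assoc_mult_mat[OF Q(3) Rc(1,1)] ..
  also have "\<dots> = 1\<^sub>m n" unfolding Q(2) left_mult_one_mat[OF Rc(1)] by (rule Q(1))
  finally show "Q * P * Q = 1\<^sub>m n" .
qed

subsection \<open>Contraction of a minimal residual step\<close>

lemma quadratic_nonneg_imp_le:
  fixes a b c :: real
  assumes "\<And>t. 0 \<le> a + t * b + t\<^sup>2 * c" and "0 \<le> c"
  shows "b\<^sup>2 \<le> 4 * a * c"
proof (cases "c = 0")
  case True
  have "b = 0"
  proof (rule ccontr)
    assume "b \<noteq> 0"
    \<comment> \<open>This \<open>t\<close> makes a + t b equal to -1.\<close>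
    then show False using assms(1)[of "- (a + 1) / b"] True by simp
  qed
  then show ?thesis using True by simp
next
  case False
  then have "c > 0" using assms(2) by simp
  have "0 \<le> a + (- b / (2 * c)) * b + (- b / (2 * c))\<^sup>2 * c" by (rule assms)
  also have "\<dots> = a - b\<^sup>2 / (4 * c)" using False by (simp add: power2_eq_square field_simps)
  finally show ?thesis using \<open>c > 0\<close> by (simp add: field_simps)
qed

lemma bform_add_left:
  assumes "M \<in> carrier_mat n n" "x \<in> carrier_vec n" "y \<in> carrier_vec n" "z \<in> carrier_vec n"
  shows "bform M (x + c \<cdot>\<^sub>v y) z = bform M x z + c * bform M y z"
proof -
  have c: "x + c \<cdot>\<^sub>v y \<in> carrier_vec n" using assms by simp
  show ?thesis
    unfolding bform_sum[OF assms(1) c assms(4)] bform_sum[OF assms(1,2,4)] bform_sum[OF assms(1,3,4)]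
      sum_distrib_left sum.distrib[symmetric]
    by (intro sum.cong refl) (use assms in \<open>simp add: algebra_simps\<close>)
qed

lemma bform_add_right:
  assumes "M \<in> carrier_mat n n" "x \<in> carrier_vec n" "y \<in> carrier_vec n" "z \<in> carrier_vec n"
  shows "bform M z (x + c \<cdot>\<^sub>v y) = bform M z x + c * bform M z y"
proof -
  have c: "x + c \<cdot>\<^sub>v y \<in> carrier_vec n" using assms by simp
  show ?thesis
    unfolding bform_sum[OF assms(1,4) c] bform_sum[OF assms(1,4,2)] bform_sum[OF assms(1,4,3)]
      sum_distrib_left sum.distrib[symmetric]
    by (intro sum.cong refl) (use assms in \<open>simp add: algebra_simps\<close>)
qed

lemma bform_Cauchy_Schwarz:
  assumes M: "M \<in> carrier_mat n n" and nonneg: "\<And>x. x \<in> carrier_vec n \<Longrightarrow> 0 \<le> bform M x x"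
    and sym: "\<And>x y. x \<in> carrier_vec n \<Longrightarrow> y \<in> carrier_vec n \<Longrightarrow> bform M x y = bform M y x"
    and x: "x \<in> carrier_vec n" and y: "y \<in> carrier_vec n"
  shows "(bform M x y)\<^sup>2 \<le> bform M x x * bform M y y"
proof -
  have "(2 * bform M x y)\<^sup>2 \<le> 4 * bform M x x * bform M y y"
  proof (rule quadratic_nonneg_imp_le)
    fix t
    have v: "x + t \<cdot>\<^sub>v y \<in> carrier_vec n" using x y by simp
    have "bform M (x + t \<cdot>\<^sub>v y) (x + t \<cdot>\<^sub>v y) = bform M x x + t * (2 * bform M x y) + t\<^sup>2 * bform M y y"
      unfolding bform_add_left[OF M x y v] bform_add_right[OF M x y x] bform_add_right[OF M x y y]
      using sym[OF x y] by (simp add: power2_eq_square algebra_simps)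
    then show "0 \<le> bform M x x + t * (2 * bform M x y) + t\<^sup>2 * bform M y y"
      using nonneg[OF v] by simp
    show "0 \<le> bform M y y" by (rule nonneg[OF y])
  qed
  then show ?thesis by (simp add: power_mult_distrib)
qed

lemma pos_def_solvable:
  fixes H :: "real mat"
  assumes H: "H \<in> carrier_mat n n" and pos: "\<And>x. x \<in> carrier_vec n \<Longrightarrow> x \<noteq> 0\<^sub>v n \<Longrightarrow> 0 < bform H x x"
    and b: "b \<in> carrier_vec n"
  obtains w where "w \<in> carrier_vec n" "H *\<^sub>v w = b"
proof -
  have "Determinant.det H \<noteq> 0"
  proof
    assume "Determinant.det H = 0"
    then obtain v where v: "v \<in> carrier_vec n" "v \<noteq> 0\<^sub>v n" "H *\<^sub>v v = 0\<^sub>v n"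
      using det_0_iff_vec_prod_zero_field[OF H] by blast
    have "bform H v v = 0" using v(1) by (simp add: bform_def v(3))
    then show False using pos[OF v(1,2)] by simp
  qed
  from det_non_zero_imp_unit[OF H this, of "()"]
  obtain B where B: "B \<in> carrier_mat n n" "H * B = 1\<^sub>m n"
    unfolding Units_def ring_mat_simps by auto
  have "H *\<^sub>v (B *\<^sub>v b) = b"
    unfolding assoc_mult_mat_vec[OF H B(1) b, symmetric] B(2) using b by simp
  then show thesis using that[of "B *\<^sub>v b"] mult_mat_vec_carrier[OF B(1) b] by simp
qed

text \<open>
  Write \<open>Z = H + S\<close> with \<open>H\<close> symmetric and \<open>S\<close> skew, \<open>u = Z x\<close>, and solve \<open>H w = S u\<close>.
  Then \<open>u \<bullet> u = Z\<^sup>T u \<bullet> x = H (u - w) \<bullet> x\<close>, and \<open>S u \<bullet> u = 0\<close> makes the \<open>H\<close>-norm of \<open>u - w\<close> split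
  orthogonally; the plain triangle inequality would lose the sharp constant.
\<close>

lemma form_controlled_gmres_bound:
  assumes Z: "form_controlled n s Z (1\<^sub>m n)" and s: "0 \<le> s" and x: "x \<in> carrier_vec n"
  shows "scalar_prod (Z *\<^sub>v x) (Z *\<^sub>v x) * scalar_prod x x \<le> (3 + 4 * s\<^sup>2) * (bform Z x x)\<^sup>2"
proof -
  have Zc: "Z \<in> carrier_mat n n" using Z by (simp add: form_controlled_def)
  have low: "1 / 2 * scalar_prod y y \<le> bform Z y y" and up: "bform Z y y \<le> 3 / 2 * scalar_prod y y"
    if "y \<in> carrier_vec n" for y
    using Z that by (auto simp: form_controlled_def bform_one)
  have sp0: "0 \<le> scalar_prod y y" if "y \<in> carrier_vec n" for y :: "real vec"
    using scalar_prod_self_pos[OF that] that by (cases "y = 0\<^sub>v n") (auto simp: less_imp_le)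
  define H where "H = sym_part Z"
  have Hc: "H \<in> carrier_mat n n" using Zc by (simp add: H_def)
  have Hf: "bform H y z = (bform Z y z + bform Z z y) / 2" if "y \<in> carrier_vec n" "z \<in> carrier_vec n" for y z
  proof -
    have Zt: "transpose_mat Z \<in> carrier_mat n n" using Zc by simp
    show ?thesis
      unfolding H_def sym_part_def bform_smult[OF add_carrier_mat[OF Zt] that] bform_add[OF Zc Zt that]
        bform_transpose[OF Zc that] by simp
  qed
  have HZ: "bform H y y = bform Z y y" if "y \<in> carrier_vec n" for y
    using Hf[OF that that] by simp
  have H0: "0 \<le> bform H y y" if "y \<in> carrier_vec n" for y
    unfolding HZ[OF that] using low[OF that] sp0[OF that] by linarith
  have Hpos: "0 < bform H y y" if "y \<in> carrier_vec n" "y \<noteq> 0\<^sub>v n" for y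
    unfolding HZ[OF that(1)] using low[OF that(1)] scalar_prod_self_pos[OF that] by linarith
  have Hsym: "bform H y z = bform H z y" if "y \<in> carrier_vec n" "z \<in> carrier_vec n" for y z
    unfolding Hf[OF that] Hf[OF that(2,1)] by simp
  define u where "u = Z *\<^sub>v x"
  have u: "u \<in> carrier_vec n" unfolding u_def by (rule mult_mat_vec_carrier[OF Zc x])
  define K where "K = (1 / 2) \<cdot>\<^sub>m (Z + (- 1) \<cdot>\<^sub>m transpose_mat Z)"
  have Zt: "(- 1) \<cdot>\<^sub>m transpose_mat Z \<in> carrier_mat n n" and Zt': "transpose_mat Z \<in> carrier_mat n n"
    using Zc by simp_all
  have Kc: "K \<in> carrier_mat n n" unfolding K_def by (rule smult_carrier_mat[OF add_carrier_mat[OF Zt]])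
  have Kf: "bform K y z = (bform Z y z - bform Z z y) / 2" if "y \<in> carrier_vec n" "z \<in> carrier_vec n" for y z
    unfolding K_def bform_smult[OF add_carrier_mat[OF Zt] that] bform_add[OF Zc Zt that] bform_smult[OF Zt' that]
      bform_transpose[OF Zc that] by simp
  obtain w where w: "w \<in> carrier_vec n" "H *\<^sub>v w = K *\<^sub>v u"
    by (rule pos_def_solvable[OF Hc Hpos mult_mat_vec_carrier[OF Kc u]])
  have Hw: "bform H y w = (bform Z y u - bform Z u y) / 2" if "y \<in> carrier_vec n" for y
    using Kf[OF that u] by (simp add: bform_def w(2))
  define v where "v = u + (- 1) \<cdot>\<^sub>v w"
  have v: "v \<in> carrier_vec n" using u w by (simp add: v_def)
  have uu: "scalar_prod u u = bform H v x"
  proof -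
    have "bform H v x = bform H u x - bform H w x"
      unfolding v_def bform_add_left[OF Hc u w(1) x] by simp
    also have "\<dots> = bform Z u x"
      unfolding Hsym[OF w(1) x] Hw[OF x] Hf[OF u x] by (simp add: field_simps)
    also have "\<dots> = scalar_prod u u" by (simp add: bform_def u_def)
    finally show ?thesis ..
  qed
  define h where "h = bform H w w"
  have h0: "0 \<le> h" unfolding h_def by (rule H0[OF w(1)])
  have h_le: "h \<le> 2 * s\<^sup>2 * scalar_prod u u"
  proof -
    define d where "d = bform Z w u - bform Z u w"
    \<comment> \<open>Applying the additive skew bound to t w and \<open>u\<close> for every real
      \<open>t\<close> and taking the discriminant turns its right-hand side into a product. The
      summand \<open>0\<^sub>v n\<close> gives t w the shape expected by
      \<open>bform_add_left\<close> and \<open>bform_add_right\<close>.\<close>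
    have "d\<^sup>2 \<le> 4 * (s * scalar_prod u u) * (s * scalar_prod w w)"
    proof (rule quadratic_nonneg_imp_le)
      fix t
      have zt: "0\<^sub>v n + t \<cdot>\<^sub>v w \<in> carrier_vec n" using w by simp
      have Z0: "bform Z (0\<^sub>v n) u = 0" "bform Z u (0\<^sub>v n) = 0"
        using Zc u by (simp_all add: bform_sum[of _ n])
      have 1: "bform (1\<^sub>m n) (0\<^sub>v n + t \<cdot>\<^sub>v w) (0\<^sub>v n + t \<cdot>\<^sub>v w) = t\<^sup>2 * scalar_prod w w"
        using w zt by (simp add: bform_one power2_eq_square)
      have "\<bar>bform Z (0\<^sub>v n + t \<cdot>\<^sub>v w) u - bform Z u (0\<^sub>v n + t \<cdot>\<^sub>v w)\<bar>
          \<le> s * (t\<^sup>2 * scalar_prod w w + scalar_prod u u)"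
        using Z zt u unfolding form_controlled_def 1[symmetric] bform_one[OF u u, symmetric] by blast
      moreover have "bform Z (0\<^sub>v n + t \<cdot>\<^sub>v w) u - bform Z u (0\<^sub>v n + t \<cdot>\<^sub>v w) = t * d"
        unfolding bform_add_left[OF Zc zero_carrier_vec w(1) u] bform_add_right[OF Zc zero_carrier_vec w(1) u] Z0 d_def
        by (simp add: algebra_simps)
      ultimately have "- (t * d) \<le> s * (t\<^sup>2 * scalar_prod w w + scalar_prod u u)" by simp
      then show "0 \<le> s * scalar_prod u u + t * d + t\<^sup>2 * (s * scalar_prod w w)"
        by (simp add: algebra_simps)
      show "0 \<le> s * scalar_prod w w" using s sp0[OF w(1)] by simp
    qed
    moreover have "d = 2 * h" unfolding d_def h_def Hw[OF w(1)] by simp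
    ultimately have "h\<^sup>2 \<le> s\<^sup>2 * scalar_prod u u * scalar_prod w w" by (simp add: power2_eq_square mult_ac)
    also have "\<dots> \<le> s\<^sup>2 * scalar_prod u u * (2 * h)"
      using low[OF w(1)] HZ[OF w(1)] sp0[OF u] by (intro mult_left_mono) (simp_all add: h_def)
    finally have "h * h \<le> (2 * s\<^sup>2 * scalar_prod u u) * h" by (simp add: power2_eq_square mult_ac)
    then show ?thesis using h0 sp0[OF u]
      by (cases "h = 0") (simp_all add: mult_le_cancel_right)
  qed
  have vv: "bform H v v \<le> (3 / 2 + 2 * s\<^sup>2) * scalar_prod u u"
  proof -
    have "bform H v v = bform H u u - 2 * bform H u w + bform H w w"
      unfolding v_def bform_add_left[OF Hc u w(1) v[unfolded v_def]] bform_add_right[OF Hc u w(1) u]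
        bform_add_right[OF Hc u w(1) w(1)] using Hsym[OF u w(1)] by simp
    also have "bform H u w = 0" unfolding Hw[OF u] by simp
    finally show ?thesis using up[OF u] HZ[OF u] h_le by (simp add: h_def algebra_simps)
  qed
  have "(scalar_prod u u)\<^sup>2 \<le> bform H v v * bform H x x"
    unfolding uu by (rule bform_Cauchy_Schwarz[OF Hc H0 Hsym v x])
  also have "\<dots> \<le> (3 / 2 + 2 * s\<^sup>2) * scalar_prod u u * bform H x x"
    by (rule mult_right_mono[OF vv H0[OF x]])
  finally have "scalar_prod u u * scalar_prod u u \<le> ((3 / 2 + 2 * s\<^sup>2) * bform Z x x) * scalar_prod u u"
    by (simp add: power2_eq_square HZ[OF x] mult_ac)
  moreover have Zx0: "0 \<le> bform Z x x" using H0[OF x] HZ[OF x] by simp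
  ultimately have "scalar_prod u u \<le> (3 / 2 + 2 * s\<^sup>2) * bform Z x x"
    using sp0[OF u] by (cases "scalar_prod u u = 0") (simp_all add: mult_le_cancel_right)
  \<comment> \<open>Origin of 3 + 4 s^2: 3/2 is the upper bound of the symmetric part, 2 s^2 the
    share of the skew part, and both are doubled by |x|^2 <= 2 x.Zx.\<close>
  then have "scalar_prod u u * scalar_prod x x \<le> ((3 / 2 + 2 * s\<^sup>2) * bform Z x x) * (2 * bform Z x x)"
    using low[OF x] sp0[OF x] Zx0 by (intro mult_mono) simp_all
  then show "scalar_prod (Z *\<^sub>v x) (Z *\<^sub>v x) * scalar_prod x x \<le> (3 + 4 * s\<^sup>2) * (bform Z x x)\<^sup>2"
    unfolding u_def by (simp add: power2_eq_square algebra_simps)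
qed

text \<open>The minimising step length leaves the fraction 1 - (x.Zx)^2 / (|x|^2 |Zx|^2) of the
  squared norm, which the preceding bound limits to 1 - 1 / (3 + 4 s^2).\<close>

lemma form_controlled_contraction:
  assumes Z: "form_controlled n s Z (1\<^sub>m n)" and s: "0 \<le> s" and x: "x \<in> carrier_vec n"
  obtains \<alpha> where "vnorm2 (x - \<alpha> \<cdot>\<^sub>v (Z *\<^sub>v x)) \<le> sqrt ((2 + 4 * s\<^sup>2) / (3 + 4 * s\<^sup>2)) * vnorm2 x"
proof -
  have Zc: "Z \<in> carrier_mat n n" using Z by (simp add: form_controlled_def)
  define u where "u = Z *\<^sub>v x"
  have u: "u \<in> carrier_vec n" unfolding u_def by (rule mult_mat_vec_carrier[OF Zc x])
  define \<alpha> where "\<alpha> = scalar_prod x u / scalar_prod u u"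
  note bound = form_controlled_gmres_bound[OF Z s x, folded u_def, unfolded bform_def, folded u_def]
  have c: "3 + 4 * s\<^sup>2 > 0" by (simp add: add_pos_nonneg)
  have xx: "0 \<le> scalar_prod x x"
    using scalar_prod_self_pos[OF x] x by (cases "x = 0\<^sub>v n") (auto simp: less_imp_le)
  have expand: "scalar_prod (x - \<alpha> \<cdot>\<^sub>v u) (x - \<alpha> \<cdot>\<^sub>v u) =
      scalar_prod x x - 2 * \<alpha> * scalar_prod x u + \<alpha>\<^sup>2 * scalar_prod u u"
    using x u comm_scalar_prod[OF x u]
    by (simp add: minus_scalar_prod_distrib[of _ n] scalar_prod_minus_distrib[of _ n] power2_eq_square algebra_simps)
  have "scalar_prod (x - \<alpha> \<cdot>\<^sub>v u) (x - \<alpha> \<cdot>\<^sub>v u) \<le> (2 + 4 * s\<^sup>2) / (3 + 4 * s\<^sup>2) * scalar_prod x x"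
  proof (cases "scalar_prod u u = 0")
    case True
    \<comment> \<open>The lower bound on the form of \<open>Z\<close> then forces \<open>x\<close>
      to vanish as well.\<close>
    have "u = 0\<^sub>v n" using scalar_prod_self_pos[OF u] True by auto
    then have "scalar_prod x u = 0" using x by simp
    moreover have "1 / 2 * scalar_prod x x \<le> scalar_prod x u"
      using Z x by (auto simp: form_controlled_def bform_one) (simp add: bform_def u_def)
    ultimately have "scalar_prod x x = 0" using xx by simp
    then show ?thesis unfolding expand using True \<open>scalar_prod x u = 0\<close> by simp
  next
    case False
    have u0: "0 < scalar_prod u u" using scalar_prod_self_pos[OF u] False u by (cases "u = 0\<^sub>v n") auto
    have "scalar_prod x x / (3 + 4 * s\<^sup>2) \<le> (scalar_prod x u)\<^sup>2 / scalar_prod u u"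
      using bound c u0 by (simp add: field_simps)
    moreover have "scalar_prod x x - 2 * \<alpha> * scalar_prod x u + \<alpha>\<^sup>2 * scalar_prod u u
        = scalar_prod x x - (scalar_prod x u)\<^sup>2 / scalar_prod u u"
      using u0 by (simp add: \<alpha>_def power2_eq_square field_simps)
    moreover have "(2 + 4 * s\<^sup>2) / (3 + 4 * s\<^sup>2) * scalar_prod x x = scalar_prod x x - scalar_prod x x / (3 + 4 * s\<^sup>2)"
      using c by (simp add: field_simps)
    ultimately show ?thesis unfolding expand by linarith
  qed
  then have "vnorm2 (x - \<alpha> \<cdot>\<^sub>v u) \<le> sqrt ((2 + 4 * s\<^sup>2) / (3 + 4 * s\<^sup>2)) * vnorm2 x"
    unfolding vnorm2_def real_sqrt_mult[symmetric] by (rule real_sqrt_le_mono)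
  then show thesis using that unfolding u_def by blast
qed

subsection \<open>Krylov spaces and the convergence bound\<close>

lemma krylov_facts:
  fixes Z :: "real mat" and r :: "real vec"
  assumes Z: "Z \<in> carrier_mat n n" and r: "r \<in> carrier_vec n"
  shows krylov_carrier: "y \<in> krylov Z r k \<Longrightarrow> y \<in> carrier_vec n"
    and krylov_zero: "0\<^sub>v n \<in> krylov Z r k"
    and krylov_add: "x \<in> krylov Z r k \<Longrightarrow> y \<in> krylov Z r k \<Longrightarrow> x + y \<in> krylov Z r k"
    and krylov_smult: "y \<in> krylov Z r k \<Longrightarrow> c \<cdot>\<^sub>v y \<in> krylov Z r k"
    and krylov_mono: "k \<le> l \<Longrightarrow> krylov Z r k \<subseteq> krylov Z r l"
    and krylov_initial: "0 < k \<Longrightarrow> r \<in> krylov Z r k"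
    and krylov_mult: "y \<in> krylov Z r k \<Longrightarrow> Z *\<^sub>v y \<in> krylov Z r (Suc k)"
proof -
  interpret vec_space "TYPE(real)" n .
  define G where "G k = (\<lambda>i. (Z ^\<^sub>m i) *\<^sub>v r) ` {..<k}" for k
  have K: "krylov Z r k = span (G k)" for k
    using r by (simp add: krylov_def G_def)
  have G: "G k \<subseteq> carrier_vec n" for k
    unfolding G_def using mult_mat_vec_carrier[OF pow_carrier_mat[OF Z] r] by blast
  show 1: "y \<in> carrier_vec n" if "y \<in> krylov Z r k" for y k
    using span_closed[OF G] that unfolding K by simp
  show 2: "0\<^sub>v n \<in> krylov Z r k" for k unfolding K using span_zero by simp
  show 3: "x + y \<in> krylov Z r k" if "x \<in> krylov Z r k" "y \<in> krylov Z r k" for x y k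
    using span_add1[OF G that[unfolded K]] unfolding K by simp
  show 4: "c \<cdot>\<^sub>v y \<in> krylov Z r k" if "y \<in> krylov Z r k" for y c k
    using smult_in_span[OF G that[unfolded K]] unfolding K .
  show "krylov Z r k \<subseteq> krylov Z r l" if "k \<le> l"
    unfolding K G_def using that by (intro span_is_monotone image_mono) auto
  show "r \<in> krylov Z r k" if "0 < k"
  proof -
    have "r = (Z ^\<^sub>m 0) *\<^sub>v r" using Z r by simp
    then have "r \<in> G k" unfolding G_def using that by blast
    then show ?thesis unfolding K using span_mem[OF G] by blast
  qed
  have shift: "Z *\<^sub>v ((Z ^\<^sub>m i) *\<^sub>v r) = (Z ^\<^sub>m Suc i) *\<^sub>v r" for i
  proof -
    \<comment> \<open>The recursion of \<open>pow_mat\<close> multiplies by \<open>Z\<close> on the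
      right, the shift on the left.\<close>
    have comm: "Z * Z ^\<^sub>m i = Z ^\<^sub>m i * Z" for i
    proof (induction i)
      case 0
      then show ?case using Z by simp
    next
      case (Suc i)
      have "Z * Z ^\<^sub>m Suc i = Z * Z ^\<^sub>m i * Z"
        unfolding pow_mat.simps by (rule assoc_mult_mat[OF Z pow_carrier_mat[OF Z] Z, symmetric])
      also have "\<dots> = Z ^\<^sub>m Suc i * Z" by (simp only: Suc pow_mat.simps)
      finally show ?case .
    qed
    have "Z *\<^sub>v ((Z ^\<^sub>m i) *\<^sub>v r) = (Z * Z ^\<^sub>m i) *\<^sub>v r"
      by (rule assoc_mult_mat_vec[OF Z pow_carrier_mat[OF Z] r, symmetric])
    then show ?thesis by (simp only: comm pow_mat.simps)
  qed
  \<comment> \<open>\<open>N\<close> is the preimage of the next Krylov space under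
    \<open>Z\<close>. It is a submodule containing the generators of the present one, hence also
    their span.\<close>
  define N where "N = {y \<in> carrier_vec n. Z *\<^sub>v y \<in> span (G (Suc k))}"
  have "submodule class_ring N V"
  proof (unfold_locales)
    show "N \<subseteq> carrier V" by (auto simp: N_def)
    show "x \<oplus>\<^bsub>V\<^esub> y \<in> N" if "x \<in> N" "y \<in> N" for x y
      using that 3[of "Z *\<^sub>v x" "Suc k" "Z *\<^sub>v y"] Z
      by (simp add: N_def K mult_add_distrib_mat_vec[OF Z])
    have "Z *\<^sub>v 0\<^sub>v n = 0\<^sub>v n" using Z by (intro eq_vecI) auto
    then show "\<zero>\<^bsub>V\<^esub> \<in> N" using 2[of "Suc k"] by (simp add: N_def K)
    show "c \<odot>\<^bsub>V\<^esub> x \<in> N" if "c \<in> carrier class_ring" "x \<in> N" for c x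
      using that 4[of "Z *\<^sub>v x" "Suc k" c] Z
      by (simp add: N_def K mult_mat_vec[OF Z])
  qed
  moreover have "G k \<subseteq> N"
  proof
    fix g assume "g \<in> G k"
    then obtain i where i: "i < k" "g = (Z ^\<^sub>m i) *\<^sub>v r" by (auto simp: G_def)
    have "Z *\<^sub>v g \<in> G (Suc k)" unfolding i(2) shift G_def using i(1) by blast
    then show "g \<in> N" unfolding N_def using span_mem[OF G] G \<open>g \<in> G k\<close> by blast
  qed
  ultimately have "span (G k) \<subseteq> N" using span_is_subset by blast
  then show "Z *\<^sub>v y \<in> krylov Z r (Suc k)" if "y \<in> krylov Z r k"
    using that unfolding K N_def by blast
qed

text \<open>The residual \<open>r\<close> of \<open>u\<close> is r0 minus \<open>Z\<close> times an
  element of the Krylov space of order \<open>j\<close>, so it lies in the space of order j + 1.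
  Hence u + alpha r competes with \<open>u'\<close>, and its residual is r - alpha Z r. The first
  alternative for \<open>u\<close> is the start of a cycle, which is prescribed rather than obtained
  as a minimiser.\<close>

lemma gmres_step:
  fixes Z :: "real mat"
  assumes Z: "Z \<in> carrier_mat n n" and w: "w \<in> carrier_vec n" and v0: "v0 \<in> carrier_vec n"
    and contr: "\<And>x. x \<in> carrier_vec n \<Longrightarrow> \<exists>\<alpha>. vnorm2 (x - \<alpha> \<cdot>\<^sub>v (Z *\<^sub>v x)) \<le> \<omega> * vnorm2 x"
    and u: "j = 0 \<and> u = v0 \<or> is_gmres_iterate Z w v0 j u"
    and u': "is_gmres_iterate Z w v0 (Suc j) u'"
  shows "u' \<in> carrier_vec n" and "vnorm2 (w - Z *\<^sub>v u') \<le> \<omega> * vnorm2 (w - Z *\<^sub>v u)"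
proof -
  define r0 where "r0 = w - Z *\<^sub>v v0"
  have r0: "r0 \<in> carrier_vec n" unfolding r0_def using w mult_mat_vec_carrier[OF Z v0] by simp
  note kry = krylov_facts[OF Z r0]
  have "\<exists>y. y \<in> krylov Z r0 j \<and> u = v0 + y"
  proof (cases "j = 0 \<and> u = v0")
    case True
    then show ?thesis using kry(2) v0 by (intro exI[of _ "0\<^sub>v n"]) auto
  next
    case False
    then have "is_gmres_iterate Z w v0 j u" using u by blast
    then show ?thesis unfolding is_gmres_iterate_def is_arg_min_def r0_def by blast
  qed
  then obtain y where y: "y \<in> krylov Z r0 j" "u = v0 + y" by blast
  have yc: "y \<in> carrier_vec n" by (rule kry(1)[OF y(1)])
  have Zy: "Z *\<^sub>v y \<in> carrier_vec n" by (rule mult_mat_vec_carrier[OF Z yc])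
  have uc: "u \<in> carrier_vec n" using v0 yc by (simp add: y(2))
  define r where "r = w - Z *\<^sub>v u"
  have rc: "r \<in> carrier_vec n" unfolding r_def using w mult_mat_vec_carrier[OF Z uc] by simp
  have r_eq: "r = r0 + (- 1) \<cdot>\<^sub>v (Z *\<^sub>v y)"
    unfolding r_def r0_def y(2) mult_add_distrib_mat_vec[OF Z v0 yc]
    using w mult_mat_vec_carrier[OF Z v0] Zy by (intro eq_vecI) auto
  have rK: "r \<in> krylov Z r0 (Suc j)"
    unfolding r_eq by (intro kry(3) kry(4) kry(6) kry(7) y(1)) simp
  obtain \<alpha> where \<alpha>: "vnorm2 (r - \<alpha> \<cdot>\<^sub>v (Z *\<^sub>v r)) \<le> \<omega> * vnorm2 r" using contr[OF rc] by blast
  have Zr: "Z *\<^sub>v r \<in> carrier_vec n" by (rule mult_mat_vec_carrier[OF Z rc])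
  have "y + \<alpha> \<cdot>\<^sub>v r \<in> krylov Z r0 (Suc j)"
    using kry(5)[of j "Suc j"] y(1) by (intro kry(3) kry(4) rK) auto
  then have mem: "v0 + (y + \<alpha> \<cdot>\<^sub>v r) \<in> (\<lambda>y. v0 + y) ` krylov Z r0 (Suc j)" by blast
  have "w - Z *\<^sub>v (v0 + (y + \<alpha> \<cdot>\<^sub>v r)) = r - \<alpha> \<cdot>\<^sub>v (Z *\<^sub>v r)"
  proof -
    have ar: "\<alpha> \<cdot>\<^sub>v r \<in> carrier_vec n" using rc by simp
    have "v0 + (y + \<alpha> \<cdot>\<^sub>v r) = u + \<alpha> \<cdot>\<^sub>v r" unfolding y(2) by (rule assoc_add_vec[OF v0 yc ar, symmetric])
    then show ?thesis
      unfolding r_def[symmetric] using mult_add_distrib_mat_vec[OF Z uc ar] mult_mat_vec[OF Z rc] w mult_mat_vec_carrier[OF Z uc] Zr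
      by (intro eq_vecI) (auto simp: r_def)
  qed
  moreover have "vnorm2 (w - Z *\<^sub>v u') \<le> vnorm2 (w - Z *\<^sub>v (v0 + (y + \<alpha> \<cdot>\<^sub>v r)))"
    using u' mem unfolding is_gmres_iterate_def is_arg_min_def r0_def[symmetric] by (metis linorder_not_less)
  ultimately show "vnorm2 (w - Z *\<^sub>v u') \<le> \<omega> * vnorm2 (w - Z *\<^sub>v u)"
    using \<alpha> by (simp only: r_def[symmetric])
  obtain y' where "y' \<in> krylov Z r0 (Suc j)" "u' = v0 + y'"
    using u' unfolding is_gmres_iterate_def is_arg_min_def r0_def[symmetric] by blast
  then show "u' \<in> carrier_vec n" using kry(1) v0 by simp
qed

lemma gmres_residual_bound:
  fixes Z :: "real mat"
  assumes Z: "Z \<in> carrier_mat n n" and w: "w \<in> carrier_vec n" and v0: "v0 \<in> carrier_vec n"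
    and contr: "\<And>x. x \<in> carrier_vec n \<Longrightarrow> \<exists>\<alpha>. vnorm2 (x - \<alpha> \<cdot>\<^sub>v (Z *\<^sub>v x)) \<le> \<omega> * vnorm2 x"
    and \<omega>: "0 \<le> \<omega>"
    and v: "gmres_iterates Z w v0 v \<or> (\<exists>m\<ge>1. restarted_gmres_iterates m Z w v0 v)"
  shows "vnorm2 (w - Z *\<^sub>v v k) \<le> \<omega> ^ k * vnorm2 (w - Z *\<^sub>v v 0)"
proof -
  have step: "v k \<in> carrier_vec n \<and> v (Suc k) \<in> carrier_vec n \<and>
      vnorm2 (w - Z *\<^sub>v v (Suc k)) \<le> \<omega> * vnorm2 (w - Z *\<^sub>v v k)" for k
    using v
  proof
    assume g: "gmres_iterates Z w v0 v"
    have a: "k = 0 \<and> v k = v0 \<or> is_gmres_iterate Z w v0 k (v k)" for k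
      using g by (cases k) (auto simp: gmres_iterates_def)
    have b: "is_gmres_iterate Z w v0 (Suc k) (v (Suc k))" for k
      using g by (simp add: gmres_iterates_def)
    note st = gmres_step[OF Z w v0 contr a b]
    have "v k \<in> carrier_vec n" for k
      using st(1) v0 g by (cases k) (auto simp: gmres_iterates_def)
    then show ?thesis using st by blast
  next
    assume "\<exists>m\<ge>1. restarted_gmres_iterates m Z w v0 v"
    then obtain m where m: "1 \<le> m" and g: "restarted_gmres_iterates m Z w v0 v" by blast
    have it: "is_gmres_iterate Z w (v (c * m)) j (v (c * m + j))" if "1 \<le> j" "j \<le> m" for c j
      using g that by (simp add: restarted_gmres_iterates_def)
    have st: "v (c * m + Suc j) \<in> carrier_vec n \<and>
        vnorm2 (w - Z *\<^sub>v v (c * m + Suc j)) \<le> \<omega> * vnorm2 (w - Z *\<^sub>v v (c * m + j))"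
      if c: "v (c * m) \<in> carrier_vec n" and j: "j < m" for c j
    proof -
      have a: "j = 0 \<and> v (c * m + j) = v (c * m) \<or> is_gmres_iterate Z w (v (c * m)) j (v (c * m + j))"
        using it[of j c] j by (cases j) auto
      have b: "is_gmres_iterate Z w (v (c * m)) (Suc j) (v (c * m + Suc j))"
        by (rule it) (use j in auto)
      show ?thesis using gmres_step[OF Z w c contr a b] by blast
    qed
    have c: "v (c * m) \<in> carrier_vec n" for c
    proof (induction c)
      case 0
      then show ?case using g v0 by (simp add: restarted_gmres_iterates_def)
    next
      case (Suc c)
      \<comment> \<open>The last iterate of cycle \<open>c\<close> is the initial guess of the next
        one.\<close>
      have "c * m + Suc (m - 1) = Suc c * m" "m - 1 < m" using m by simp_all
      then show ?case using st[OF Suc.IH, of "m - 1"] by (simp only:)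
    qed
    have k: "k div m * m + k mod m = k" "k mod m < m" using m by simp_all
    have "v k \<in> carrier_vec n"
    proof (cases "k mod m")
      case 0
      then show ?thesis using c[of "k div m"] k(1) by simp
    next
      case (Suc j)
      then show ?thesis using st[OF c, of j "k div m"] k by (metis Suc_lessD)
    qed
    moreover have "k div m * m + Suc (k mod m) = Suc k" using k(1) by simp
    ultimately show ?thesis using st[OF c k(2), of "k div m"] k(1) by simp
  qed
  show ?thesis
  proof (induction k)
    case (Suc k)
    have "vnorm2 (w - Z *\<^sub>v v (Suc k)) \<le> \<omega> * vnorm2 (w - Z *\<^sub>v v k)" using step by blast
    also have "\<dots> \<le> \<omega> * (\<omega> ^ k * vnorm2 (w - Z *\<^sub>v v 0))" using Suc.IH \<omega> by (rule mult_left_mono)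
    finally show ?case by (simp add: mult.assoc)
  qed simp
qed

section \<open>Assembly of the three-dimensional estimate\<close>

lemma form_controlled_B_mat_tau:
  assumes d: "0 < d" "d < 1" and k: "0 < kp" "0 < km"
    and s: "3 / 2 * (tan (d / 2 * pi) * (\<bar>kp - km\<bar> / (kp + km))) \<le> s"
  shows "form_controlled n s (B_mat n d kp km) (tau_mat (sym_part (B_mat n d kp km)))"
proof -
  define B where "B = B_mat n d kp km"
  define C where "C = tau_mat (sym_part B)"
  define \<theta> where "\<theta> = tan (d / 2 * pi) * (\<bar>kp - km\<bar> / (kp + km))"
  have "0 < tan (d / 2 * pi)" using d by (intro tan_gt_zero) auto
  then have \<theta>: "0 \<le> \<theta>" using k by (simp add: \<theta>_def)
  have c: "B \<in> carrier_mat n n" "C \<in> carrier_mat n n" by (simp_all add: B_def C_def)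
  note bounds = B_mat_form_bounds[OF d k, where n = n, folded B_def, folded C_def]
  have C0: "0 \<le> bform C x x" if "x \<in> carrier_vec n" for x
    using bounds(1)[OF that] bform_zero[OF c(2)] by (cases "x = 0\<^sub>v n") (auto simp: less_imp_le)
  have "\<bar>bform B x y - bform B y x\<bar> \<le> s * (bform C x x + bform C y y)"
    if x: "x \<in> carrier_vec n" and y: "y \<in> carrier_vec n" for x y
  proof -
    have "\<bar>bform B x y - bform B y x\<bar> \<le> \<theta> * (bform B x x + bform B y y)"
      using B_mat_sector[OF d k x y] by (simp add: B_def \<theta>_def)
    \<comment> \<open>The sector bound is measured against \<open>B\<close>; passing to
      \<open>C\<close> costs 3/2, the factor in front of the maximum in
      \<open>varsigma\<close>.\<close>
    also have "\<dots> \<le> \<theta> * (3 / 2 * (bform C x x + bform C y y))"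
      using bounds(3)[OF x] bounds(3)[OF y] \<theta> by (intro mult_left_mono) auto
    also have "\<dots> = (3 / 2 * \<theta>) * (bform C x x + bform C y y)" by simp
    also have "\<dots> \<le> s * (bform C x x + bform C y y)"
      using s C0[OF x] C0[OF y] by (intro mult_right_mono) (simp_all add: \<theta>_def)
    finally show ?thesis .
  qed
  then show ?thesis
    using c bounds(2,3) unfolding form_controlled_def B_def[symmetric] C_def[symmetric] by blast
qed

lemma sym_involution_sine_mat: "sym_involution n (sine_mat n)"
  by (simp add: sym_involution_def sine_mat_square)

lemma diagonal_pos_in_sine_mat: "sine_diagonal_pos n M \<Longrightarrow> diagonal_pos_in n (sine_mat n) M"
  by (simp add: sine_diagonal_pos_def diagonal_pos_in_def)

lemma precond_mat_diagonal_pos_in: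
  assumes d: "\<forall>i\<in>{1, 2, 3}. 0 < \<delta> i \<and> \<delta> i < 1" and k: "\<forall>i\<in>{1, 2, 3}. 0 < kp i \<and> 0 < km i"
    and \<eta>: "\<forall>i\<in>{1, 2, 3}. 0 < \<eta> i"
  shows "diagonal_pos_in (n 3 * n 2 * n 1) (sine_mat (n 3) \<otimes>\<^sub>m sine_mat (n 2) \<otimes>\<^sub>m sine_mat (n 1))
    (precond_mat n \<eta> \<delta> kp km)"
proof -
  define C where "C i = tau_mat (sym_part (B_mat (n i) (\<delta> i) (kp i) (km i)))" for i
  note S = sym_involution_sine_mat
  have A: "diagonal_pos_in (n i) (sine_mat (n i)) (A_mat (n i))" for i
    by (rule diagonal_pos_in_sine_mat[OF sine_diagonal_pos_A_mat])
  have C: "diagonal_pos_in (n i) (sine_mat (n i)) (C i)" if "i \<in> {1, 2, 3}" for i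
    unfolding C_def using d k that by (intro diagonal_pos_in_sine_mat sine_diagonal_pos_tau_B_mat) auto
  have K: "diagonal_pos_in (n 3 * n 2 * n 1) (sine_mat (n 3) \<otimes>\<^sub>m sine_mat (n 2) \<otimes>\<^sub>m sine_mat (n 1)) (X \<otimes>\<^sub>m Y \<otimes>\<^sub>m W)"
    if "diagonal_pos_in (n 3) (sine_mat (n 3)) X" "diagonal_pos_in (n 2) (sine_mat (n 2)) Y"
      "diagonal_pos_in (n 1) (sine_mat (n 1)) W" for X Y W
    by (rule diagonal_pos_in_kron[OF sym_involution_kron[OF S S] S diagonal_pos_in_kron[OF S S that(1,2)] that(3)])
  have U: "sine_mat (n 3) \<otimes>\<^sub>m sine_mat (n 2) \<otimes>\<^sub>m sine_mat (n 1) \<in> carrier_mat (n 3 * n 2 * n 1) (n 3 * n 2 * n 1)"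
    by simp
  show ?thesis
    unfolding precond_mat_def Let_def C_def[symmetric]
    by (intro diagonal_pos_in_add_smult[OF U] K A C) (use \<eta> in auto)
qed

lemma has_gram_A_mat: "has_gram n (A_mat n)"
  by (rule diagonal_pos_in_has_gram[OF sym_involution_sine_mat diagonal_pos_in_sine_mat[OF sine_diagonal_pos_A_mat]])

lemma has_gram_kron_A_mat: "has_gram (m * n) (A_mat m \<otimes>\<^sub>m A_mat n)"
proof (rule diagonal_pos_in_has_gram)
  show "sym_involution (m * n) (sine_mat m \<otimes>\<^sub>m sine_mat n)"
    by (intro sym_involution_kron sym_involution_sine_mat)
  show "diagonal_pos_in (m * n) (sine_mat m \<otimes>\<^sub>m sine_mat n) (A_mat m \<otimes>\<^sub>m A_mat n)"
    by (intro diagonal_pos_in_kron sym_involution_sine_mat diagonal_pos_in_sine_mat sine_diagonal_pos_A_mat)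
qed

text \<open>A common \<open>s\<close> for the three directions lets the positively weighted terms be
  added; this is why the rate contains a maximum over the directions.\<close>

lemma form_controlled_system_precond:
  assumes d: "\<forall>i\<in>{1, 2, 3}. 0 < \<delta> i \<and> \<delta> i < 1" and k: "\<forall>i\<in>{1, 2, 3}. 0 < kp i \<and> 0 < km i"
    and \<eta>: "\<forall>i\<in>{1, 2, 3}. 0 < \<eta> i" and s: "0 \<le> s"
    and sb: "\<forall>i\<in>{1, 2, 3}. 3 / 2 * (tan (\<delta> i / 2 * pi) * (\<bar>kp i - km i\<bar> / (kp i + km i))) \<le> s"
  shows "form_controlled (n 3 * n 2 * n 1) s (system_mat n \<eta> \<delta> kp km) (precond_mat n \<eta> \<delta> kp km)"
proof -
  define B where "B i = B_mat (n i) (\<delta> i) (kp i) (km i)" for i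
  define C where "C i = tau_mat (sym_part (B i))" for i
  have BC: "form_controlled (n i) s (B i) (C i)" if "i \<in> {1, 2, 3}" for i
    unfolding B_def C_def using d k sb that by (intro form_controlled_B_mat_tau) auto
  note A = has_gram_A_mat
  have 0: "form_controlled (n 3 * n 2 * n 1) s (A_mat (n 3) \<otimes>\<^sub>m A_mat (n 2) \<otimes>\<^sub>m A_mat (n 1))
      (A_mat (n 3) \<otimes>\<^sub>m A_mat (n 2) \<otimes>\<^sub>m A_mat (n 1))"
    by (rule form_controlled_kron_right[OF A form_controlled_refl[OF has_gram_kron_A_mat s]])
  have 1: "form_controlled (n 3 * n 2 * n 1) s (A_mat (n 3) \<otimes>\<^sub>m A_mat (n 2) \<otimes>\<^sub>m B 1) (A_mat (n 3) \<otimes>\<^sub>m A_mat (n 2) \<otimes>\<^sub>m C 1)"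
    by (rule form_controlled_kron_left[OF has_gram_kron_A_mat BC]) simp
  have 2: "form_controlled (n 3 * n 2 * n 1) s (A_mat (n 3) \<otimes>\<^sub>m B 2 \<otimes>\<^sub>m A_mat (n 1)) (A_mat (n 3) \<otimes>\<^sub>m C 2 \<otimes>\<^sub>m A_mat (n 1))"
    by (rule form_controlled_kron_right[OF A form_controlled_kron_left[OF A BC]]) simp
  have 3: "form_controlled (n 3 * n 2 * n 1) s (B 3 \<otimes>\<^sub>m A_mat (n 2) \<otimes>\<^sub>m A_mat (n 1)) (C 3 \<otimes>\<^sub>m A_mat (n 2) \<otimes>\<^sub>m A_mat (n 1))"
    by (rule form_controlled_kron_right[OF A form_controlled_kron_right[OF A BC]]) simp
  show ?thesis
    unfolding system_mat_def precond_mat_def Let_def B_def[symmetric] C_def[symmetric]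
    by (intro form_controlled_add_smult 0 1 2 3) (use \<eta> in auto)
qed

text \<open>Substituting Q x for \<open>x\<close> turns the form of \<open>P\<close> into the inner
  product and the form of \<open>A\<close> into that of Q A Q, with the constants unchanged.\<close>

lemma form_controlled_preconditioned:
  assumes fc: "form_controlled n s A P" and Q: "Q \<in> carrier_mat n n" "transpose_mat Q = Q" "Q * P * Q = 1\<^sub>m n"
  shows "form_controlled n s (Q * A * Q) (1\<^sub>m n)"
proof -
  have c: "A \<in> carrier_mat n n" "P \<in> carrier_mat n n" using fc by (auto simp: form_controlled_def)
  have Z: "Q * A * Q \<in> carrier_mat n n" by (rule mult_carrier_mat[OF mult_carrier_mat[OF Q(1) c(1)] Q(1)])
  have fA: "bform (Q * A * Q) x y = bform A (Q *\<^sub>v x) (Q *\<^sub>v y)"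
    and fP: "bform (1\<^sub>m n) x y = bform P (Q *\<^sub>v x) (Q *\<^sub>v y)"
    if "x \<in> carrier_vec n" "y \<in> carrier_vec n" for x y
    using bform_conj[OF c(1) Q(1,2) that] bform_conj[OF c(2) Q(1,2) that] by (simp_all add: Q(3))
  show ?thesis
    unfolding form_controlled_def
  proof (intro conjI ballI Z one_carrier_mat)
    fix x :: "real vec" assume x: "x \<in> carrier_vec n"
    note Qx = mult_mat_vec_carrier[OF Q(1) x]
    show "1 / 2 * bform (1\<^sub>m n) x x \<le> bform (Q * A * Q) x x" "bform (Q * A * Q) x x \<le> 3 / 2 * bform (1\<^sub>m n) x x"
      unfolding fA[OF x x] fP[OF x x] using fc Qx by (auto simp: form_controlled_def)
    fix y :: "real vec" assume y: "y \<in> carrier_vec n"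
    note Qy = mult_mat_vec_carrier[OF Q(1) y]
    show "\<bar>bform (Q * A * Q) x y - bform (Q * A * Q) y x\<bar> \<le> s * (bform (1\<^sub>m n) x x + bform (1\<^sub>m n) y y)"
      unfolding fA[OF x y] fA[OF y x] fP[OF x x] fP[OF y y] using fc Qx Qy by (auto simp: form_controlled_def)
  qed
qed

lemma varsigma_bounds:
  assumes "\<forall>i\<in>{1, 2, 3}. 0 < \<delta> i \<and> \<delta> i < 1" "\<forall>i\<in>{1, 2, 3}. 0 < kp i \<and> 0 < km i"
  shows "0 \<le> varsigma \<delta> kp km"
    and "\<forall>i\<in>{1, 2, 3}. 3 / 2 * (tan (\<delta> i / 2 * pi) * (\<bar>kp i - km i\<bar> / (kp i + km i))) \<le> varsigma \<delta> kp km"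
proof -
  define g where "g i = tan (\<delta> i / 2 * pi) * (\<bar>kp i - km i\<bar> / (kp i + km i))" for i
  have le: "g i \<le> (MAX i\<in>{1, 2, 3}. g i)" if "i \<in> {1, 2, 3}" for i
    using that by (intro Max_ge) auto
  show "\<forall>i\<in>{1, 2, 3}. 3 / 2 * (tan (\<delta> i / 2 * pi) * (\<bar>kp i - km i\<bar> / (kp i + km i))) \<le> varsigma \<delta> kp km"
    unfolding varsigma_def g_def[symmetric] using le by (intro ballI mult_left_mono) auto
  have "0 < tan (\<delta> 1 / 2 * pi)" using assms(1) by (intro tan_gt_zero) auto
  then have "0 \<le> g 1" using assms(2) by (simp add: g_def)
  then show "0 \<le> varsigma \<delta> kp km"
    unfolding varsigma_def g_def[symmetric] using le[of 1] by simp
qed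

theorem theorem3p2:
  fixes \<delta> a b kp km h \<eta> :: "nat \<Rightarrow> real"
    and n :: "nat \<Rightarrow> nat" and M N :: nat
    and T \<Delta>t \<omega> :: real
    and A P Q Z :: "real mat"
    and rhs v0 :: "real vec"
    and v r :: "nat \<Rightarrow> real vec"
  assumes "\<forall>i\<in>{1, 2, 3}. 0 < \<delta> i \<and> \<delta> i < 1"
    and "\<forall>i\<in>{1, 2, 3}. a i < b i"
    and "\<forall>i\<in>{1, 2, 3}. 0 < kp i \<and> 0 < km i"
    and "0 < T" and "0 < M" and "\<forall>i\<in>{1, 2, 3}. 0 < n i"
    and "\<Delta>t = T / real M"
    and "\<forall>i\<in>{1, 2, 3}. h i = (b i - a i) / (real (n i) + 1)"
    and "N = n 1 * n 2 * n 3"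
    and "\<forall>i\<in>{1, 2, 3}. \<eta> i = \<Delta>t / (2 * Gamma (\<delta> i + 1) * h i powr (2 - \<delta> i))"
    and "A = system_mat n \<eta> \<delta> kp km"
    and "P = precond_mat n \<eta> \<delta> kp km"
    and "Q = inv_sqrt_mat P"
    and "Z = Q * A * Q"
    and "rhs \<in> carrier_vec N" and "v0 \<in> carrier_vec N"
    and "gmres_iterates Z (Q *\<^sub>v rhs) v0 v \<or>
         (\<exists>m\<ge>1. restarted_gmres_iterates m Z (Q *\<^sub>v rhs) v0 v)"
    and "\<forall>k. r k = Q *\<^sub>v rhs - Z *\<^sub>v v k"
    and "\<omega> = omega_rate \<delta> kp km"
  shows "(\<forall>k\<ge>1. vnorm2 (r k) \<le> \<omega> ^ k * vnorm2 (r 0)) \<and>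
         \<omega> \<in> {sqrt (2 / 3)..<1} \<and> {sqrt (2 / 3)..<1} \<subset> {0::real<..<1}"
proof -
  have \<eta>: "\<forall>i\<in>{1, 2, 3}. 0 < \<eta> i"
  proof
    fix i :: nat assume i: "i \<in> {1, 2, 3}"
    have "h i = (b i - a i) / (real (n i) + 1)" "a i < b i" using assms(2,8) i by blast+
    then have "0 < h i" by (simp add: add_pos_nonneg)
    then have "0 < 2 * Gamma (\<delta> i + 1) * h i powr (2 - \<delta> i)"
      using assms(1) i by (intro mult_pos_pos Gamma_real_pos) auto
    moreover have "0 < \<Delta>t" using assms(4,5,7) by simp
    moreover have "\<eta> i = \<Delta>t / (2 * Gamma (\<delta> i + 1) * h i powr (2 - \<delta> i))" using assms(10) i by blast
    ultimately show "0 < \<eta> i" by (simp only: divide_pos_pos)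
  qed
  define s where "s = varsigma \<delta> kp km"
  have s: "0 \<le> s" unfolding s_def by (rule varsigma_bounds(1)[OF assms(1,3)])
  have N: "n 3 * n 2 * n 1 = N" using assms(9) by simp
  have fc: "form_controlled N s A P"
    unfolding N[symmetric] assms(11,12) s_def
    by (rule form_controlled_system_precond[OF assms(1,3) \<eta> varsigma_bounds[OF assms(1,3)]])
  have diag: "diagonal_pos_in N (sine_mat (n 3) \<otimes>\<^sub>m sine_mat (n 2) \<otimes>\<^sub>m sine_mat (n 1)) P"
    unfolding N[symmetric] assms(12) by (rule precond_mat_diagonal_pos_in[OF assms(1,3) \<eta>])
  have inv: "sym_involution N (sine_mat (n 3) \<otimes>\<^sub>m sine_mat (n 2) \<otimes>\<^sub>m sine_mat (n 1))"
    unfolding N[symmetric] by (intro sym_involution_kron sym_involution_sine_mat)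
  note Q = inv_sqrt_mat_properties[OF inv diag, folded assms(13)]
  have Z: "form_controlled N s Z (1\<^sub>m N)"
    unfolding assms(14) by (rule form_controlled_preconditioned[OF fc Q])
  have \<omega>: "\<omega> = sqrt ((2 + 4 * s\<^sup>2) / (3 + 4 * s\<^sup>2))"
    unfolding assms(19) omega_rate_def s_def ..
  have s2: "0 < 3 + 4 * s\<^sup>2" by (simp add: add_pos_nonneg)
  have "2 / 3 \<le> (2 + 4 * s\<^sup>2) / (3 + 4 * s\<^sup>2)" "(2 + 4 * s\<^sup>2) / (3 + 4 * s\<^sup>2) < 1"
    using s2 by (simp_all add: field_simps)
  then have \<omega>_range: "\<omega> \<in> {sqrt (2 / 3)..<1}"
    unfolding \<omega> by (simp add: real_sqrt_le_mono del: real_sqrt_divide)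
  have "vnorm2 (r k) \<le> \<omega> ^ k * vnorm2 (r 0)" for k
    unfolding assms(18)[rule_format]
  proof (rule gmres_residual_bound[OF _ _ assms(16) _ _ assms(17)])
    show "Z \<in> carrier_mat N N" using Z by (simp add: form_controlled_def)
    show "Q *\<^sub>v rhs \<in> carrier_vec N" by (rule mult_mat_vec_carrier[OF Q(1) assms(15)])
    show "\<exists>\<alpha>. vnorm2 (x - \<alpha> \<cdot>\<^sub>v (Z *\<^sub>v x)) \<le> \<omega> * vnorm2 x" if "x \<in> carrier_vec N" for x
      unfolding \<omega> by (rule form_controlled_contraction[OF Z s that]) blast
    show "0 \<le> \<omega>" unfolding \<omega> using s2 by simp
  qed
  moreover have "{q..<1} \<subset> {0::real<..<1}" if "0 < q" "q < 1" for q
  proof -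
    have "q / 2 \<in> {0<..<1}" "q / 2 \<notin> {q..<1}" using that by auto
    then have "{q..<1} \<noteq> {0<..<1}" by metis
    then show ?thesis using that(1) by auto
  qed
  then have "{sqrt (2 / 3)..<1} \<subset> {0::real<..<1}"
    by (simp del: real_sqrt_divide)
  ultimately show ?thesis using \<omega>_range by blast
qed

end
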